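(* Let $\Phi$ be a unital commutative associative ring containing $1/2$, let $\Phi_C[t_1,t_2,t_3]$ be the ring of Cayley polynomials over $\Phi$, and let $T=\{t_1^pt_2^qt_3^r\}_{p,q,r\in 2\mathbb{N}}\subset \Phi_C[t_1,t_2,t_3]$. (1) $T$ is a multiplicative subset of the center of $\Phi_C[t_1,t_2,t_3]$ which does not contain zero divisors of $\Phi_C[t_1,t_2,t_3]$, and the ring of quotients $T^{-1}\Phi_C[t_1,t_2,t_3]$ can be identified with (is isomorphic to) the Cayley torus $S^{-1}D$ via $t_1\mapsto v_1$, $t_2\mapsto v_2$, $t_3\mapsto v_3$. (2) If $A$ is an alternative algebra over $\Phi$ generated by $a_1,a_2,a_3$, and they satisfy the Cayley relations $a_1a_2=-a_2a_1$, $a_1a_3=-a_3a_1$, $a_2a_3=-a_3a_2$ and $(a_1a_2)a_3=-a_1(a_2a_3)$, then $A$ is a homomorphic image of $\Phi_C[t_1,t_2,t_3]$ via $t_1\mapsto a_1$, $t_2\mapsto a_2$, $t_3\mapsto a_3$, and $a_1^2,a_2^2,a_3^2$ are central in $A$. If, moreover, $a_1,a_2,a_3$ are invertible, then $A$ is a homomorphic image of the Cayley torus $T^{-1}\Phi_C[t_1,t_2,t_3]$ via the same map. (3) The Cayley torus has the following presentation in the category of alternative algebras over $\Phi$: generators $t_1^{\pm1},t_2^{\pm1},t_3^{\pm1}$ with relations $t_it_i^{-1}=1$ for $i=1,2,3$ and the Cayley relations $t_2t_1=-t_1t_2$, $t_3t_1=-t_1t_3$, $t_3t_2=-t_2t_3$,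 $(t_1t_2)t_3=-t_1(t_2t_3)$.
   Context: All algebras are unital. For an algebra write $[a,b]=ab-ba$ and $(a,b,c)=(ab)c-a(bc)$. An algebra is alternative if $(a,a,b)=0=(b,a,a)$ for all $a,b$. The center of an alternative algebra $A$ is $\{z\in A\mid [z,a]=(z,a,b)=0 \text{ for all } a,b\in A\}$. For a multiplicative subset $S$ of the center of $A$ containing no zero divisors of $A$, $S^{-1}A$ denotes the ring of quotients (central localization). Cayley-Dickson process. Let $k$ be a unital commutative associative ring containing $1/2$, $B$ a faithful unital $k$-algebra (i.e. $\alpha 1=0$ implies $\alpha=0$ for $\alpha\in k$) with a scalar involution $*$ (an anti-automorphism of period 2 with $bb^*\in k1$ for all $b$), and let $\mu\in k$ be a cancellable scalar (i.e. $\mu b=0$ implies $b=0$ for $b\in B$). Then $(B,\mu)$ is the algebra $B\oplus vB$ with product $(a+vb)(c+vd)=(ac+\mu db^* )+v(a^*d+cb)$ and new involution $(a+vb)^*=a^*-vb$; $v$ is called the basic generator and $v^2=\mu$. Iterating three times starting from $k$ with the trivial involution, with cancellable $\mu_1,\mu_2,\mu_3\in k$, gives the octonion algebra $(k,\mu_1,\mu_2,\mu_3)$ over $k$, with basic generators $v_1,v_2,v_3$ satisfying $v_i^2=\mu_i$. The ring of Cayley polynomials $\Phi_C[t_1,t_2,t_3]$ is the alternative algebra over $\Phi$ presented, in the category of (unital) alternative algebras, by generators $t_1,t_2,t_3$ and the Cayley relations $t_2t_1=-t_1t_2$, $t_3t_1=-t_1t_3$, $t_3t_2=-t_2t_3$,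 $(t_1t_2)t_3=-t_1(t_2t_3)$. $D=(\Phi[z_1,z_2,z_3],z_1,z_2,z_3)$ is the octonion algebra over the ordinary polynomial algebra $\Phi[z_1,z_2,z_3]$ with basic generators $v_1,v_2,v_3$ ($v_i^2=z_i$). Let $S=\{z_1^pz_2^qz_3^r\}_{p,q,r\in\mathbb{N}}$. The ring of quotients $S^{-1}D$ equals the octonion algebra $(\Phi[z_1^{\pm1},z_2^{\pm1},z_3^{\pm1}],z_1,z_2,z_3)$, in which each $v_i$ is invertible with $v_i^{-1}=z_i^{-1}v_i$; with the $\mathbb{Z}^3$-grading given by $\deg v_1^{\pm1}=(\pm1,0,0)$, $\deg v_2^{\pm1}=(0,\pm1,0)$, $\deg v_3^{\pm1}=(0,0,\pm1)$, it is called the Cayley torus (or octonion $3$-torus). Here $\mathbb{N}$ includes $0$. *)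

theory Defs
  imports "HOL-Algebra.UnivPoly"
begin

section \<open>Alternative algebras\<close>

text \<open>
  The HOL-Algebra record \<open>('k, 'a) module\<close> has the operations of a ring and a scalar
  multiplication. No axiom about the ring multiplication is part of the locale \<open>module\<close>,
  so the record serves for nonassociative algebras.
\<close>

locale nonassoc_algebra = module R A
  for R :: "('k, 'm) ring_scheme" (structure) and A :: "('k, 'a, 'n) module_scheme" (structure) +
  assumes mult_closed: "\<lbrakk>x \<in> carrier A; y \<in> carrier A\<rbrakk> \<Longrightarrow> x \<otimes>\<^bsub>A\<^esub> y \<in> carrier A"
    and one_closed: "\<one>\<^bsub>A\<^esub> \<in> carrier A"
    and one_left: "x \<in> carrier A \<Longrightarrow> \<one>\<^bsub>A\<^esub> \<otimes>\<^bsub>A\<^esub> x = x"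
    and one_right: "x \<in> carrier A \<Longrightarrow> x \<otimes>\<^bsub>A\<^esub> \<one>\<^bsub>A\<^esub> = x"
    and distrib_left: "\<lbrakk>x \<in> carrier A; y \<in> carrier A; z \<in> carrier A\<rbrakk>
      \<Longrightarrow> x \<otimes>\<^bsub>A\<^esub> (y \<oplus>\<^bsub>A\<^esub> z) = x \<otimes>\<^bsub>A\<^esub> y \<oplus>\<^bsub>A\<^esub> x \<otimes>\<^bsub>A\<^esub> z"
    and distrib_right: "\<lbrakk>x \<in> carrier A; y \<in> carrier A; z \<in> carrier A\<rbrakk>
      \<Longrightarrow> (x \<oplus>\<^bsub>A\<^esub> y) \<otimes>\<^bsub>A\<^esub> z = x \<otimes>\<^bsub>A\<^esub> z \<oplus>\<^bsub>A\<^esub> y \<otimes>\<^bsub>A\<^esub> z"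
    and smult_mult_left: "\<lbrakk>c \<in> carrier R; x \<in> carrier A; y \<in> carrier A\<rbrakk>
      \<Longrightarrow> (c \<odot>\<^bsub>A\<^esub> x) \<otimes>\<^bsub>A\<^esub> y = c \<odot>\<^bsub>A\<^esub> (x \<otimes>\<^bsub>A\<^esub> y)"
    and smult_mult_right: "\<lbrakk>c \<in> carrier R; x \<in> carrier A; y \<in> carrier A\<rbrakk>
      \<Longrightarrow> x \<otimes>\<^bsub>A\<^esub> (c \<odot>\<^bsub>A\<^esub> y) = c \<odot>\<^bsub>A\<^esub> (x \<otimes>\<^bsub>A\<^esub> y)"

definition commutator :: "('a, 'm) ring_scheme \<Rightarrow> 'a \<Rightarrow> 'a \<Rightarrow> 'a" where
  "commutator A a b = a \<otimes>\<^bsub>A\<^esub> b \<ominus>\<^bsub>A\<^esub> b \<otimes>\<^bsub>A\<^esub> a"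

definition associator :: "('a, 'm) ring_scheme \<Rightarrow> 'a \<Rightarrow> 'a \<Rightarrow> 'a \<Rightarrow> 'a" where
  "associator A a b c = (a \<otimes>\<^bsub>A\<^esub> b) \<otimes>\<^bsub>A\<^esub> c \<ominus>\<^bsub>A\<^esub> a \<otimes>\<^bsub>A\<^esub> (b \<otimes>\<^bsub>A\<^esub> c)"

locale alternative_algebra = nonassoc_algebra +
  assumes left_alternative: "\<lbrakk>a \<in> carrier A; b \<in> carrier A\<rbrakk> \<Longrightarrow> associator A a a b = \<zero>\<^bsub>A\<^esub>"
    and right_alternative: "\<lbrakk>a \<in> carrier A; b \<in> carrier A\<rbrakk> \<Longrightarrow> associator A b a a = \<zero>\<^bsub>A\<^esub>"

definition alg_center :: "('a, 'm) ring_scheme \<Rightarrow> 'a set" where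
  "alg_center A = {z \<in> carrier A. \<forall>a\<in>carrier A. \<forall>b\<in>carrier A.
     commutator A z a = \<zero>\<^bsub>A\<^esub> \<and> associator A z a b = \<zero>\<^bsub>A\<^esub>}"

definition zero_divisors :: "('a, 'm) ring_scheme \<Rightarrow> 'a set" where
  "zero_divisors A = {z \<in> carrier A. \<exists>a\<in>carrier A. a \<noteq> \<zero>\<^bsub>A\<^esub> \<and>
     (z \<otimes>\<^bsub>A\<^esub> a = \<zero>\<^bsub>A\<^esub> \<or> a \<otimes>\<^bsub>A\<^esub> z = \<zero>\<^bsub>A\<^esub>)}"

definition alg_hom ::
  "('k, 'm) ring_scheme \<Rightarrow> ('k, 'a, 'n) module_scheme \<Rightarrow> ('k, 'b, 'l) module_scheme \<Rightarrow> ('a \<Rightarrow> 'b) set"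
where
  "alg_hom R A B = {h \<in> ring_hom A B.
     \<forall>c\<in>carrier R. \<forall>x\<in>carrier A. h (c \<odot>\<^bsub>A\<^esub> x) = c \<odot>\<^bsub>B\<^esub> h x}"

definition alg_iso ::
  "('k, 'm) ring_scheme \<Rightarrow> ('k, 'a, 'n) module_scheme \<Rightarrow> ('k, 'b, 'l) module_scheme \<Rightarrow> ('a \<Rightarrow> 'b) set"
where
  "alg_iso R A B = {h \<in> alg_hom R A B. bij_betw h (carrier A) (carrier B)}"

definition unital_subalgebra ::
  "('k, 'm) ring_scheme \<Rightarrow> ('k, 'a, 'n) module_scheme \<Rightarrow> 'a set \<Rightarrow> bool"
where
  "unital_subalgebra R A B \<longleftrightarrow> B \<subseteq> carrier A \<and> \<zero>\<^bsub>A\<^esub> \<in> B \<and> \<one>\<^bsub>A\<^esub> \<in> B \<and>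
     (\<forall>x\<in>B. \<forall>y\<in>B. x \<oplus>\<^bsub>A\<^esub> y \<in> B \<and> x \<otimes>\<^bsub>A\<^esub> y \<in> B) \<and> (\<forall>c\<in>carrier R. \<forall>x\<in>B. c \<odot>\<^bsub>A\<^esub> x \<in> B)"

definition generated_subalgebra ::
  "('k, 'm) ring_scheme \<Rightarrow> ('k, 'a, 'n) module_scheme \<Rightarrow> 'a set \<Rightarrow> 'a set"
where
  "generated_subalgebra R A X = \<Inter> {B. unital_subalgebra R A B \<and> X \<subseteq> B}"


section \<open>Presentations in the category of unital alternative algebras\<close>

text \<open>
  The alternative \<open>R\<close>-algebra presented by the generators \<open>'x\<close> and a set \<open>rels\<close> of relations (pairs
  of terms) consists of the terms in the generators modulo the least congruence that contains the
  axioms of unital alternative \<open>R\<close>-algebras and the relations. Terms with scalars outside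
  \<open>carrier R\<close> are excluded throughout.
\<close>

datatype (scalars: 'k, dead 'x) alg_term =
    TGen 'x
  | TZero
  | TOne
  | TNeg "('k, 'x) alg_term"
  | TAdd "('k, 'x) alg_term" "('k, 'x) alg_term"
  | TMul "('k, 'x) alg_term" "('k, 'x) alg_term"
  | TScal 'k "('k, 'x) alg_term"

definition alg_terms :: "('k, 'm) ring_scheme \<Rightarrow> ('k, 'x) alg_term set" where
  "alg_terms R = {t. scalars t \<subseteq> carrier R}"

inductive_set alt_cong ::
  "('k, 'm) ring_scheme \<Rightarrow> (('k, 'x) alg_term \<times> ('k, 'x) alg_term) set
    \<Rightarrow> (('k, 'x) alg_term \<times> ('k, 'x) alg_term) set"
  for R :: "('k, 'm) ring_scheme" (structure)
    and rels :: "(('k, 'x) alg_term \<times> ('k, 'x) alg_term) set"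
where
  refl: "s \<in> alg_terms R \<Longrightarrow> (s, s) \<in> alt_cong R rels"
| sym: "(s, t) \<in> alt_cong R rels \<Longrightarrow> (t, s) \<in> alt_cong R rels"
| trans: "\<lbrakk>(s, t) \<in> alt_cong R rels; (t, u) \<in> alt_cong R rels\<rbrakk> \<Longrightarrow> (s, u) \<in> alt_cong R rels"
| neg: "(s, s') \<in> alt_cong R rels \<Longrightarrow> (TNeg s, TNeg s') \<in> alt_cong R rels"
| add: "\<lbrakk>(s, s') \<in> alt_cong R rels; (t, t') \<in> alt_cong R rels\<rbrakk>
    \<Longrightarrow> (TAdd s t, TAdd s' t') \<in> alt_cong R rels"
| mul: "\<lbrakk>(s, s') \<in> alt_cong R rels; (t, t') \<in> alt_cong R rels\<rbrakk>
    \<Longrightarrow> (TMul s t, TMul s' t') \<in> alt_cong R rels"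
| scal: "\<lbrakk>c \<in> carrier R; (s, s') \<in> alt_cong R rels\<rbrakk>
    \<Longrightarrow> (TScal c s, TScal c s') \<in> alt_cong R rels"
| add_assoc: "\<lbrakk>s \<in> alg_terms R; t \<in> alg_terms R; u \<in> alg_terms R\<rbrakk>
    \<Longrightarrow> (TAdd (TAdd s t) u, TAdd s (TAdd t u)) \<in> alt_cong R rels"
| add_comm: "\<lbrakk>s \<in> alg_terms R; t \<in> alg_terms R\<rbrakk>
    \<Longrightarrow> (TAdd s t, TAdd t s) \<in> alt_cong R rels"
| add_zero: "s \<in> alg_terms R \<Longrightarrow> (TAdd TZero s, s) \<in> alt_cong R rels"
| add_neg: "s \<in> alg_terms R \<Longrightarrow> (TAdd (TNeg s) s, TZero) \<in> alt_cong R rels"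
| scal_add_left: "\<lbrakk>c \<in> carrier R; d \<in> carrier R; s \<in> alg_terms R\<rbrakk>
    \<Longrightarrow> (TScal (c \<oplus> d) s, TAdd (TScal c s) (TScal d s)) \<in> alt_cong R rels"
| scal_add_right: "\<lbrakk>c \<in> carrier R; s \<in> alg_terms R; t \<in> alg_terms R\<rbrakk>
    \<Longrightarrow> (TScal c (TAdd s t), TAdd (TScal c s) (TScal c t)) \<in> alt_cong R rels"
| scal_scal: "\<lbrakk>c \<in> carrier R; d \<in> carrier R; s \<in> alg_terms R\<rbrakk>
    \<Longrightarrow> (TScal (c \<otimes> d) s, TScal c (TScal d s)) \<in> alt_cong R rels"
| scal_one: "s \<in> alg_terms R \<Longrightarrow> (TScal \<one> s, s) \<in> alt_cong R rels"
| mul_one_left: "s \<in> alg_terms R \<Longrightarrow> (TMul TOne s, s) \<in> alt_cong R rels"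
| mul_one_right: "s \<in> alg_terms R \<Longrightarrow> (TMul s TOne, s) \<in> alt_cong R rels"
| mul_add_left: "\<lbrakk>s \<in> alg_terms R; t \<in> alg_terms R; u \<in> alg_terms R\<rbrakk>
    \<Longrightarrow> (TMul s (TAdd t u), TAdd (TMul s t) (TMul s u)) \<in> alt_cong R rels"
| mul_add_right: "\<lbrakk>s \<in> alg_terms R; t \<in> alg_terms R; u \<in> alg_terms R\<rbrakk>
    \<Longrightarrow> (TMul (TAdd s t) u, TAdd (TMul s u) (TMul t u)) \<in> alt_cong R rels"
| scal_mul_left: "\<lbrakk>c \<in> carrier R; s \<in> alg_terms R; t \<in> alg_terms R\<rbrakk>
    \<Longrightarrow> (TMul (TScal c s) t, TScal c (TMul s t)) \<in> alt_cong R rels"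
| scal_mul_right: "\<lbrakk>c \<in> carrier R; s \<in> alg_terms R; t \<in> alg_terms R\<rbrakk>
    \<Longrightarrow> (TMul s (TScal c t), TScal c (TMul s t)) \<in> alt_cong R rels"
| left_alternative: "\<lbrakk>s \<in> alg_terms R; t \<in> alg_terms R\<rbrakk>
    \<Longrightarrow> (TMul (TMul s s) t, TMul s (TMul s t)) \<in> alt_cong R rels"
| right_alternative: "\<lbrakk>s \<in> alg_terms R; t \<in> alg_terms R\<rbrakk>
    \<Longrightarrow> (TMul (TMul t s) s, TMul t (TMul s s)) \<in> alt_cong R rels"
| relation: "\<lbrakk>(s, t) \<in> rels; s \<in> alg_terms R; t \<in> alg_terms R\<rbrakk> \<Longrightarrow> (s, t) \<in> alt_cong R rels"

definition term_class ::
  "('k, 'm) ring_scheme \<Rightarrow> (('k, 'x) alg_term \<times> ('k, 'x) alg_term) set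
    \<Rightarrow> ('k, 'x) alg_term \<Rightarrow> ('k, 'x) alg_term set"
where
  "term_class R rels t = alt_cong R rels `` {t}"

definition presented_algebra ::
  "('k, 'm) ring_scheme \<Rightarrow> (('k, 'x) alg_term \<times> ('k, 'x) alg_term) set
    \<Rightarrow> ('k, ('k, 'x) alg_term set) module"
where
  "presented_algebra R rels =
    \<lparr>carrier = alg_terms R // alt_cong R rels,
     mult = (\<lambda>X Y. \<Union>s\<in>X. \<Union>t\<in>Y. term_class R rels (TMul s t)),
     one = term_class R rels TOne,
     zero = term_class R rels TZero,
     add = (\<lambda>X Y. \<Union>s\<in>X. \<Union>t\<in>Y. term_class R rels (TAdd s t)),
     smult = (\<lambda>c X. \<Union>s\<in>X. term_class R rels (TScal c s))\<rparr>"


section \<open>Central localization\<close>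

text \<open>
  Fractions \<open>a / s\<close> with \<open>s\<close> in a multiplicative subset \<open>S\<close> of the center that contains no zero
  divisors; under this assumption \<open>a / s = b / t \<longleftrightarrow> t a = s b\<close> is an equivalence relation and the
  operations below do not depend on the choice of representatives.
\<close>

definition frac_rel :: "('a, 'm) ring_scheme \<Rightarrow> 'a set \<Rightarrow> (('a \<times> 'a) \<times> ('a \<times> 'a)) set" where
  "frac_rel A S = {((a, s), (b, t)). a \<in> carrier A \<and> b \<in> carrier A \<and> s \<in> S \<and> t \<in> S \<and>
     t \<otimes>\<^bsub>A\<^esub> a = s \<otimes>\<^bsub>A\<^esub> b}"

definition frac :: "('a, 'm) ring_scheme \<Rightarrow> 'a set \<Rightarrow> 'a \<Rightarrow> 'a \<Rightarrow> ('a \<times> 'a) set" where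
  "frac A S a s = frac_rel A S `` {(a, s)}"

definition central_localization ::
  "('k, 'a, 'n) module_scheme \<Rightarrow> 'a set \<Rightarrow> ('k, ('a \<times> 'a) set) module"
where
  "central_localization A S =
    \<lparr>carrier = (carrier A \<times> S) // frac_rel A S,
     mult = (\<lambda>X Y. \<Union>(a, s)\<in>X. \<Union>(b, t)\<in>Y. frac A S (a \<otimes>\<^bsub>A\<^esub> b) (s \<otimes>\<^bsub>A\<^esub> t)),
     one = frac A S \<one>\<^bsub>A\<^esub> \<one>\<^bsub>A\<^esub>,
     zero = frac A S \<zero>\<^bsub>A\<^esub> \<one>\<^bsub>A\<^esub>,
     add = (\<lambda>X Y. \<Union>(a, s)\<in>X. \<Union>(b, t)\<in>Y.
       frac A S (t \<otimes>\<^bsub>A\<^esub> a \<oplus>\<^bsub>A\<^esub> s \<otimes>\<^bsub>A\<^esub> b) (s \<otimes>\<^bsub>A\<^esub> t)),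
     smult = (\<lambda>c X. \<Union>(a, s)\<in>X. frac A S (c \<odot>\<^bsub>A\<^esub> a) s)\<rparr>"


section \<open>The Cayley--Dickson process and octonion algebras\<close>

text \<open>
  A pair \<open>(a, b)\<close> stands for \<open>a + v b\<close>. The process is applied to a faithful algebra \<open>B\<close> over a
  commutative ring containing \<open>1/2\<close>, with a scalar involution \<open>star\<close>, and to a cancellable
  scalar \<open>\<mu>\<close>.
\<close>

definition cayley_dickson ::
  "('k, 'b, 'n) module_scheme \<Rightarrow> ('b \<Rightarrow> 'b) \<Rightarrow> 'k \<Rightarrow> ('k, 'b \<times> 'b) module"
where
  "cayley_dickson B star \<mu> =
    \<lparr>carrier = carrier B \<times> carrier B,
     mult = (\<lambda>(a, b) (c, d).
       (a \<otimes>\<^bsub>B\<^esub> c \<oplus>\<^bsub>B\<^esub> \<mu> \<odot>\<^bsub>B\<^esub> (d \<otimes>\<^bsub>B\<^esub> star b), star a \<otimes>\<^bsub>B\<^esub> d \<oplus>\<^bsub>B\<^esub> c \<otimes>\<^bsub>B\<^esub> b)),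
     one = (\<one>\<^bsub>B\<^esub>, \<zero>\<^bsub>B\<^esub>),
     zero = (\<zero>\<^bsub>B\<^esub>, \<zero>\<^bsub>B\<^esub>),
     add = (\<lambda>(a, b) (c, d). (a \<oplus>\<^bsub>B\<^esub> c, b \<oplus>\<^bsub>B\<^esub> d)),
     smult = (\<lambda>r (a, b). (r \<odot>\<^bsub>B\<^esub> a, r \<odot>\<^bsub>B\<^esub> b))\<rparr>"

definition cd_star :: "('b, 'n) ring_scheme \<Rightarrow> ('b \<Rightarrow> 'b) \<Rightarrow> 'b \<times> 'b \<Rightarrow> 'b \<times> 'b" where
  "cd_star B star = (\<lambda>(a, b). (star a, \<ominus>\<^bsub>B\<^esub> b))"

definition ring_as_algebra :: "('k, 'm) ring_scheme \<Rightarrow> ('k, 'k) module" where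
  "ring_as_algebra K =
    \<lparr>carrier = carrier K, mult = mult K, one = one K, zero = zero K, add = add K, smult = mult K\<rparr>"

definition cd1 :: "('k, 'm) ring_scheme \<Rightarrow> 'k \<Rightarrow> ('k, 'k \<times> 'k) module" where
  "cd1 K \<mu>1 = cayley_dickson (ring_as_algebra K) (\<lambda>x. x) \<mu>1"

definition cd1_star :: "('k, 'm) ring_scheme \<Rightarrow> 'k \<times> 'k \<Rightarrow> 'k \<times> 'k" where
  "cd1_star K = cd_star (ring_as_algebra K) (\<lambda>x. x)"

definition cd2 ::
  "('k, 'm) ring_scheme \<Rightarrow> 'k \<Rightarrow> 'k \<Rightarrow> ('k, ('k \<times> 'k) \<times> ('k \<times> 'k)) module"
where
  "cd2 K \<mu>1 \<mu>2 = cayley_dickson (cd1 K \<mu>1) (cd1_star K) \<mu>2"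

definition cd2_star ::
  "('k, 'm) ring_scheme \<Rightarrow> 'k \<Rightarrow> ('k \<times> 'k) \<times> ('k \<times> 'k) \<Rightarrow> ('k \<times> 'k) \<times> ('k \<times> 'k)"
where
  "cd2_star K \<mu>1 = cd_star (cd1 K \<mu>1) (cd1_star K)"

type_synonym 'k oct = "(('k \<times> 'k) \<times> ('k \<times> 'k)) \<times> (('k \<times> 'k) \<times> ('k \<times> 'k))"

definition octonion_algebra ::
  "('k, 'm) ring_scheme \<Rightarrow> 'k \<Rightarrow> 'k \<Rightarrow> 'k \<Rightarrow> ('k, 'k oct) module"
where
  "octonion_algebra K \<mu>1 \<mu>2 \<mu>3 = cayley_dickson (cd2 K \<mu>1 \<mu>2) (cd2_star K \<mu>1) \<mu>3"

datatype index3 = I1 | I2 | I3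

text \<open>
  The basic generators: the generator \<open>v = (0, 1)\<close> of each step, embedded by \<open>b \<mapsto> (b, 0)\<close> in the
  later steps.
\<close>

fun basic_generator :: "('k, 'm) ring_scheme \<Rightarrow> index3 \<Rightarrow> 'k oct" where
  "basic_generator K I1 =
    (((\<zero>\<^bsub>K\<^esub>, \<one>\<^bsub>K\<^esub>), (\<zero>\<^bsub>K\<^esub>, \<zero>\<^bsub>K\<^esub>)), ((\<zero>\<^bsub>K\<^esub>, \<zero>\<^bsub>K\<^esub>), (\<zero>\<^bsub>K\<^esub>, \<zero>\<^bsub>K\<^esub>)))"
| "basic_generator K I2 =
    (((\<zero>\<^bsub>K\<^esub>, \<zero>\<^bsub>K\<^esub>), (\<one>\<^bsub>K\<^esub>, \<zero>\<^bsub>K\<^esub>)), ((\<zero>\<^bsub>K\<^esub>, \<zero>\<^bsub>K\<^esub>), (\<zero>\<^bsub>K\<^esub>, \<zero>\<^bsub>K\<^esub>)))"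
| "basic_generator K I3 =
    (((\<zero>\<^bsub>K\<^esub>, \<zero>\<^bsub>K\<^esub>), (\<zero>\<^bsub>K\<^esub>, \<zero>\<^bsub>K\<^esub>)), ((\<one>\<^bsub>K\<^esub>, \<zero>\<^bsub>K\<^esub>), (\<zero>\<^bsub>K\<^esub>, \<zero>\<^bsub>K\<^esub>)))"


section \<open>The Cayley torus\<close>

text \<open>The polynomial algebra in \<open>z\<^sub>1, z\<^sub>2, z\<^sub>3\<close> is rendered as the iterated one \<open>R[z\<^sub>1][z\<^sub>2][z\<^sub>3]\<close>.\<close>

type_synonym 'k poly3 = "nat \<Rightarrow> nat \<Rightarrow> nat \<Rightarrow> 'k"

definition poly3 ::
  "('k, 'm) ring_scheme \<Rightarrow> (nat \<Rightarrow> nat \<Rightarrow> 'k, 'k poly3) up_ring"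
where
  "poly3 R = UP (UP (UP R))"

definition const3 :: "('k, 'm) ring_scheme \<Rightarrow> 'k \<Rightarrow> 'k poly3" where
  "const3 R c = monom (UP (UP (UP R))) (monom (UP (UP R)) (monom (UP R) c 0) 0) 0"

fun var3 :: "('k, 'm) ring_scheme \<Rightarrow> index3 \<Rightarrow> 'k poly3" where
  "var3 R I1 = monom (UP (UP (UP R))) (monom (UP (UP R)) (monom (UP R) \<one>\<^bsub>R\<^esub> 1) 0) 0"
| "var3 R I2 = monom (UP (UP (UP R))) (monom (UP (UP R)) \<one>\<^bsub>UP R\<^esub> 1) 0"
| "var3 R I3 = monom (UP (UP (UP R))) \<one>\<^bsub>UP (UP R)\<^esub> 1"

definition octonion_poly3 :: "('k, 'm) ring_scheme \<Rightarrow> ('k poly3, 'k poly3 oct) module" where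
  "octonion_poly3 R = octonion_algebra (poly3 R) (var3 R I1) (var3 R I2) (var3 R I3)"

text \<open>The algebra \<open>D\<close>: the preceding octonion algebra with scalars restricted to \<open>R\<close>.\<close>

definition cayley_D :: "('k, 'm) ring_scheme \<Rightarrow> ('k, 'k poly3 oct) module" where
  "cayley_D R = (let D = octonion_poly3 R in
    \<lparr>carrier = carrier D, mult = mult D, one = one D, zero = zero D, add = add D,
     smult = (\<lambda>c x. const3 R c \<odot>\<^bsub>D\<^esub> x)\<rparr>)"

definition v_gen :: "('k, 'm) ring_scheme \<Rightarrow> index3 \<Rightarrow> 'k poly3 oct" where
  "v_gen R i = basic_generator (poly3 R) i"

definition z_elem :: "('k, 'm) ring_scheme \<Rightarrow> index3 \<Rightarrow> 'k poly3 oct" where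
  "z_elem R i = var3 R i \<odot>\<^bsub>octonion_poly3 R\<^esub> \<one>\<^bsub>octonion_poly3 R\<^esub>"

definition cayley_S :: "('k, 'm) ring_scheme \<Rightarrow> 'k poly3 oct set" where
  "cayley_S R = {(var3 R I1 [^]\<^bsub>poly3 R\<^esub> p \<otimes>\<^bsub>poly3 R\<^esub> var3 R I2 [^]\<^bsub>poly3 R\<^esub> q
      \<otimes>\<^bsub>poly3 R\<^esub> var3 R I3 [^]\<^bsub>poly3 R\<^esub> r) \<odot>\<^bsub>octonion_poly3 R\<^esub> \<one>\<^bsub>octonion_poly3 R\<^esub>
    | (p::nat) (q::nat) (r::nat). True}"

definition cayley_torus ::
  "('k, 'm) ring_scheme \<Rightarrow> ('k, ('k poly3 oct \<times> 'k poly3 oct) set) module"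
where
  "cayley_torus R = central_localization (cayley_D R) (cayley_S R)"

definition torus_v :: "('k, 'm) ring_scheme \<Rightarrow> index3 \<Rightarrow> ('k poly3 oct \<times> 'k poly3 oct) set" where
  "torus_v R i = frac (cayley_D R) (cayley_S R) (v_gen R i) \<one>\<^bsub>cayley_D R\<^esub>"

text \<open>The inverse of \<open>v\<^sub>i\<close>, as the fraction \<open>v\<^sub>i / z\<^sub>i\<close>.\<close>

definition torus_v_inv :: "('k, 'm) ring_scheme \<Rightarrow> index3 \<Rightarrow> ('k poly3 oct \<times> 'k poly3 oct) set"
where
  "torus_v_inv R i = frac (cayley_D R) (cayley_S R) (v_gen R i) (z_elem R i)"


section \<open>Cayley polynomials\<close>

definition cayley_rels ::
  "(index3 \<Rightarrow> ('k, 'x) alg_term) \<Rightarrow> (('k, 'x) alg_term \<times> ('k, 'x) alg_term) set"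
where
  "cayley_rels t =
    {(TMul (t I2) (t I1), TNeg (TMul (t I1) (t I2))),
     (TMul (t I3) (t I1), TNeg (TMul (t I1) (t I3))),
     (TMul (t I3) (t I2), TNeg (TMul (t I2) (t I3))),
     (TMul (TMul (t I1) (t I2)) (t I3), TNeg (TMul (t I1) (TMul (t I2) (t I3))))}"

definition cayley_poly :: "('k, 'm) ring_scheme \<Rightarrow> ('k, ('k, index3) alg_term set) module" where
  "cayley_poly R = presented_algebra R (cayley_rels TGen)"

definition t_gen :: "('k, 'm) ring_scheme \<Rightarrow> index3 \<Rightarrow> ('k, index3) alg_term set" where
  "t_gen R i = term_class R (cayley_rels TGen) (TGen i)"

definition cayley_T :: "('k, 'm) ring_scheme \<Rightarrow> ('k, index3) alg_term set set" where
  "cayley_T R = {(t_gen R I1 [^]\<^bsub>cayley_poly R\<^esub> p \<otimes>\<^bsub>cayley_poly R\<^esub> t_gen R I2 [^]\<^bsub>cayley_poly R\<^esub> q)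
      \<otimes>\<^bsub>cayley_poly R\<^esub> t_gen R I3 [^]\<^bsub>cayley_poly R\<^esub> r
    | (p::nat) (q::nat) (r::nat). even p \<and> even q \<and> even r}"

definition cayley_poly_loc ::
  "('k, 'm) ring_scheme
    \<Rightarrow> ('k, (('k, index3) alg_term set \<times> ('k, index3) alg_term set) set) module"
where
  "cayley_poly_loc R = central_localization (cayley_poly R) (cayley_T R)"

definition loc_t ::
  "('k, 'm) ring_scheme \<Rightarrow> index3
    \<Rightarrow> (('k, index3) alg_term set \<times> ('k, index3) alg_term set) set"
where
  "loc_t R i = frac (cayley_poly R) (cayley_T R) (t_gen R i) \<one>\<^bsub>cayley_poly R\<^esub>"


section \<open>Presentation with invertible generators\<close>

text \<open>
  \<open>Inv i\<close> is the formal generator \<open>t\<^sub>i\<^sup>-\<^sup>1\<close>. Only the one-sided relations \<open>t\<^sub>i t\<^sub>i\<^sup>-\<^sup>1 = 1\<close> are imposed.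
\<close>

datatype torus_gen = Pos index3 | Inv index3

definition torus_rels :: "(('k, torus_gen) alg_term \<times> ('k, torus_gen) alg_term) set" where
  "torus_rels = {(TMul (TGen (Pos i)) (TGen (Inv i)), TOne) | i. True}
     \<union> cayley_rels (\<lambda>i. TGen (Pos i))"

definition torus_presentation ::
  "('k, 'm) ring_scheme \<Rightarrow> ('k, ('k, torus_gen) alg_term set) module"
where
  "torus_presentation R = presented_algebra R torus_rels"

definition torus_t :: "('k, 'm) ring_scheme \<Rightarrow> torus_gen \<Rightarrow> ('k, torus_gen) alg_term set" where
  "torus_t R g = term_class R torus_rels (TGen g)"

end

theory Submission
  imports Defs
begin

text \<open>
  Two facts about an alternative algebra \<open>A\<close> carry the proof. First, if \<open>x\<close> and \<open>y\<close> anticommute,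
  then \<open>x\<^sup>2\<close> commutes with \<open>y\<close> and \<open>(x\<^sup>2, y, w) = 0\<close> for every \<open>w\<close> (\<open>square_commute\<close>,
  \<open>square_associating\<close>). For fixed \<open>z\<close> the elements that commute with \<open>z\<close> and have zero associator
  with \<open>z\<close> and every third element form a subalgebra, so the squares of pairwise anticommuting
  generators are central. Second, a homomorphism \<open>\<phi>\<close> from an algebra \<open>B\<close> with scalar involution to
  \<open>A\<close> extends to the double \<open>B \<oplus> vB\<close> as soon as the image \<open>v\<close> of the new generator satisfies
  \<open>v b = b\<^sup>* v\<close> and \<open>v\<^sup>2\<close> acts as \<open>\<mu>\<close>, and the traces \<open>b + b\<^sup>*\<close> are central (\<open>cd_lift_star_hom\<close>): the
  linearized alternative laws and the middle Moufang identity then force the multiplication rule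
  of the Cayley--Dickson process. Starting from the evaluation of polynomials at the central
  elements \<open>a\<^sub>i\<^sup>2\<close> and doubling three times yields a homomorphism \<open>D \<rightarrow> A\<close>, \<open>v\<^sub>i \<mapsto> a\<^sub>i\<close>, for all
  \<open>a\<^sub>1, a\<^sub>2, a\<^sub>3\<close> with central squares that satisfy the Cayley relations (\<open>cayley_D_hom\<close>). The relation
  \<open>(a\<^sub>1 a\<^sub>2) a\<^sub>3 = - a\<^sub>1 (a\<^sub>2 a\<^sub>3)\<close> is what makes \<open>a\<^sub>3\<close> anticommute with \<open>a\<^sub>1 a\<^sub>2\<close>, as the third doubling
  demands.

  Hence \<open>D\<close> has the universal property of the ring of Cayley polynomials, and the two are isomorphic
  (\<open>cayley_poly_iso\<close>). Under the isomorphism \<open>t\<^sub>i\<^sup>2\<close> becomes \<open>z\<^sub>i\<close>, so \<open>T\<close> becomes \<open>S\<close>, and the assertions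
  on \<open>T\<close> are read off from the polynomial ring, where monomials are not zero divisors. A homomorphism
  that sends the denominators to invertible central elements extends to the localization
  (\<open>localization_hom\<close>); this gives the homomorphic images of the torus.

  The presentation of the torus imposes \<open>t\<^sub>i t\<^sub>i\<^sup>-\<^sup>1 = 1\<close> on one side only. That the inverses are two-sided
  is a consequence of the Cayley relations and of \<open>1/2\<close> (\<open>cayley_triple_right_inverse\<close>); in an
  associative algebra it could fail, as one-sided shifts show. After that the squares of the
  generators are invertible and central in the presented algebra, and the homomorphisms to and from
  the torus are inverse to each other.
\<close>

section \<open>Alternative rings\<close>

text \<open>
  The multiplicative laws of an algebra for a single structure, so that the identities below are
  free of subscripts and scalars.
\<close>

locale nonassoc_ring = abelian_group A for A (structure) +
  assumes m_closed [simp, intro]: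
      "\<lbrakk>x \<in> carrier A; y \<in> carrier A\<rbrakk> \<Longrightarrow> x \<otimes> y \<in> carrier A"
    and one_closed [simp, intro]: "\<one> \<in> carrier A"
    and l_one [simp]: "x \<in> carrier A \<Longrightarrow> \<one> \<otimes> x = x"
    and r_one [simp]: "x \<in> carrier A \<Longrightarrow> x \<otimes> \<one> = x"
    and l_distr: "\<lbrakk>x \<in> carrier A; y \<in> carrier A; z \<in> carrier A\<rbrakk>
      \<Longrightarrow> (x \<oplus> y) \<otimes> z = x \<otimes> z \<oplus> y \<otimes> z"
    and r_distr: "\<lbrakk>x \<in> carrier A; y \<in> carrier A; z \<in> carrier A\<rbrakk>
      \<Longrightarrow> z \<otimes> (x \<oplus> y) = z \<otimes> x \<oplus> z \<otimes> y"
begin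

lemma l_null [simp]:
  assumes "x \<in> carrier A" shows "\<zero> \<otimes> x = \<zero>"
proof -
  have "\<zero> \<otimes> x \<oplus> \<zero> \<otimes> x = \<zero> \<otimes> x"
    using l_distr[of \<zero> \<zero> x] assms by simp
  then show ?thesis using assms by (metis add.l_cancel_one m_closed zero_closed)
qed

lemma r_null [simp]:
  assumes "x \<in> carrier A" shows "x \<otimes> \<zero> = \<zero>"
proof -
  have "x \<otimes> \<zero> \<oplus> x \<otimes> \<zero> = x \<otimes> \<zero>"
    using r_distr[of \<zero> \<zero> x] assms by simp
  then show ?thesis using assms by (metis add.l_cancel_one m_closed zero_closed)
qed

lemma l_minus:
  assumes "x \<in> carrier A" "y \<in> carrier A" shows "(\<ominus> x) \<otimes> y = \<ominus> (x \<otimes> y)"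
proof -
  have "(\<ominus> x) \<otimes> y \<oplus> x \<otimes> y = \<zero>"
    using assms by (simp add: l_distr[symmetric] l_neg)
  then show ?thesis using assms by (simp add: add.inv_equality)
qed

lemma r_minus:
  assumes "x \<in> carrier A" "y \<in> carrier A" shows "x \<otimes> (\<ominus> y) = \<ominus> (x \<otimes> y)"
proof -
  have "x \<otimes> (\<ominus> y) \<oplus> x \<otimes> y = \<zero>"
    using assms by (simp add: r_distr[symmetric] l_neg)
  then show ?thesis using assms by (simp add: add.inv_equality)
qed

lemma minus_zero [simp]: "\<ominus> \<zero> = \<zero>"
  by (simp add: add.inv_equality)

lemma associator_closed [simp, intro]:
  "\<lbrakk>x \<in> carrier A; y \<in> carrier A; z \<in> carrier A\<rbrakk> \<Longrightarrow> associator A x y z \<in> carrier A"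
  by (simp add: associator_def)

text \<open>
  Registered for the method \<open>algebra\<close>: it expands products by distributivity, leaves their
  bracketing alone, and normalizes the resulting sums in the abelian group.
\<close>

lemmas nonassoc_ring_simprules [algebra nonassoc_ring "zero A" "add A" "a_inv A" "a_minus A" "one A" "mult A"] =
  a_closed zero_closed a_inv_closed minus_closed m_closed one_closed associator_closed
  a_assoc l_zero l_neg a_comm l_one r_one l_distr r_distr minus_eq
  r_zero r_neg r_neg1 r_neg2 minus_add minus_minus minus_zero a_lcomm l_null r_null l_minus r_minus

lemma diff_eq_zero_iff:
  "\<lbrakk>x \<in> carrier A; y \<in> carrier A\<rbrakk> \<Longrightarrow> x \<ominus> y = \<zero> \<longleftrightarrow> x = y"
  by (metis a_inv_closed minus_eq minus_equality minus_minus r_neg)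

lemma sum_eq_zero_iff:
  "\<lbrakk>x \<in> carrier A; y \<in> carrier A\<rbrakk> \<Longrightarrow> x \<oplus> y = \<zero> \<longleftrightarrow> x = \<ominus> y"
  using minus_equality l_neg by metis

lemma associator_add:
  assumes "x \<in> carrier A" "x' \<in> carrier A" "y \<in> carrier A" "z \<in> carrier A"
  shows "associator A (x \<oplus> x') y z = associator A x y z \<oplus> associator A x' y z"
    and "associator A y (x \<oplus> x') z = associator A y x z \<oplus> associator A y x' z"
    and "associator A y z (x \<oplus> x') = associator A y z x \<oplus> associator A y z x'"
  unfolding associator_def using assms by algebra+

lemma teichmueller:
  assumes "w \<in> carrier A" "x \<in> carrier A" "y \<in> carrier A" "z \<in> carrier A"
  shows "associator A (w \<otimes> x) y z \<ominus> associator A w (x \<otimes> y) z \<oplus> associator A w x (y \<otimes> z)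
    = w \<otimes> associator A x y z \<oplus> associator A w x y \<otimes> z"
  unfolding associator_def using assms by algebra

end

locale alternative_ring = nonassoc_ring +
  assumes associator_left: "\<lbrakk>x \<in> carrier A; y \<in> carrier A\<rbrakk> \<Longrightarrow> associator A x x y = \<zero>"
    and associator_right: "\<lbrakk>x \<in> carrier A; y \<in> carrier A\<rbrakk> \<Longrightarrow> associator A y x x = \<zero>"
begin

lemma associator_swap12:
  assumes "x \<in> carrier A" "y \<in> carrier A" "z \<in> carrier A"
  shows "associator A y x z = \<ominus> associator A x y z"
proof -
  have "associator A (x \<oplus> y) (x \<oplus> y) z = associator A y x z \<oplus> associator A x y z"
    using assms by (simp add: associator_add associator_left[of x] associator_left[of y])
  then have "associator A y x z \<oplus> associator A x y z = \<zero>"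
    using assms associator_left[of "x \<oplus> y" z] by simp
  from minus_equality[OF this] show ?thesis using assms by simp
qed

lemma associator_swap23:
  assumes "x \<in> carrier A" "y \<in> carrier A" "z \<in> carrier A"
  shows "associator A x z y = \<ominus> associator A x y z"
proof -
  have "associator A x (y \<oplus> z) (y \<oplus> z) = associator A x z y \<oplus> associator A x y z"
    using assms by (simp add: associator_add associator_right[of y] associator_right[of z])
  then have "associator A x z y \<oplus> associator A x y z = \<zero>"
    using assms associator_right[of "y \<oplus> z" x] by simp
  from minus_equality[OF this] show ?thesis using assms by simp
qed

lemma associator_rotate:
  assumes "x \<in> carrier A" "y \<in> carrier A" "z \<in> carrier A"
  shows "associator A y z x = associator A x y z"
  using assms associator_swap12[of x y z] associator_swap23[of y x z] by simp

lemma associator_outer [simp]: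
  assumes "x \<in> carrier A" "y \<in> carrier A"
  shows "associator A x y x = \<zero>"
  using assms associator_rotate[of x x y] by (simp add: associator_left)

lemma left_alternative: "\<lbrakk>x \<in> carrier A; y \<in> carrier A\<rbrakk> \<Longrightarrow> (x \<otimes> x) \<otimes> y = x \<otimes> (x \<otimes> y)"
  using associator_left[of x y] by (simp add: associator_def diff_eq_zero_iff)

lemma right_alternative: "\<lbrakk>x \<in> carrier A; y \<in> carrier A\<rbrakk> \<Longrightarrow> (y \<otimes> x) \<otimes> x = y \<otimes> (x \<otimes> x)"
  using associator_right[of x y] by (simp add: associator_def diff_eq_zero_iff)

lemma flexible: "\<lbrakk>x \<in> carrier A; y \<in> carrier A\<rbrakk> \<Longrightarrow> (x \<otimes> y) \<otimes> x = x \<otimes> (y \<otimes> x)"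
  using associator_outer[of x y] by (simp add: associator_def diff_eq_zero_iff)

lemma left_alternative_linearized:
  assumes "x \<in> carrier A" "y \<in> carrier A" "z \<in> carrier A"
  shows "x \<otimes> (y \<otimes> z) \<oplus> y \<otimes> (x \<otimes> z) = (x \<otimes> y \<oplus> y \<otimes> x) \<otimes> z"
proof -
  have "associator A x y z \<oplus> associator A y x z = \<zero>"
    using assms associator_swap12[of x y z] by (simp add: r_neg)
  then have "(x \<otimes> y \<oplus> y \<otimes> x) \<otimes> z \<ominus> (x \<otimes> (y \<otimes> z) \<oplus> y \<otimes> (x \<otimes> z)) = \<zero>"
    unfolding associator_def using assms by algebra
  then show ?thesis using assms by (simp add: diff_eq_zero_iff)
qed

lemma right_alternative_linearized:
  assumes "x \<in> carrier A" "y \<in> carrier A" "z \<in> carrier A"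
  shows "(z \<otimes> x) \<otimes> y \<oplus> (z \<otimes> y) \<otimes> x = z \<otimes> (x \<otimes> y \<oplus> y \<otimes> x)"
proof -
  have "associator A z x y \<oplus> associator A z y x = \<zero>"
    using assms associator_swap23[of z x y] by (simp add: r_neg)
  then have "((z \<otimes> x) \<otimes> y \<oplus> (z \<otimes> y) \<otimes> x) \<ominus> z \<otimes> (x \<otimes> y \<oplus> y \<otimes> x) = \<zero>"
    unfolding associator_def using assms by algebra
  then show ?thesis using assms by (simp add: diff_eq_zero_iff)
qed

text \<open>
  The function of Bruck and Kleinfeld is alternating in its four arguments. If it vanishes at one
  arrangement of the arguments for trivial reasons, every rearrangement gives an identity that is
  less trivial; most of the identities below are found in this way.
\<close>

definition bruck_kleinfeld where
  "bruck_kleinfeld w x y z =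
    associator A (w \<otimes> x) y z \<ominus> x \<otimes> associator A w y z \<ominus> associator A x y z \<otimes> w"

lemma bruck_kleinfeld_closed [simp]:
  "\<lbrakk>w \<in> carrier A; x \<in> carrier A; y \<in> carrier A; z \<in> carrier A\<rbrakk> \<Longrightarrow> bruck_kleinfeld w x y z \<in> carrier A"
  by (simp add: bruck_kleinfeld_def)

lemma bruck_kleinfeld_swap:
  assumes "w \<in> carrier A" "x \<in> carrier A" "y \<in> carrier A" "z \<in> carrier A"
  shows "bruck_kleinfeld w x z y = \<ominus> bruck_kleinfeld w x y z"
  unfolding bruck_kleinfeld_def
  using assms associator_swap23[of "w \<otimes> x" y z] associator_swap23[of w y z] associator_swap23[of x y z]
  by algebra

text \<open>
  In the sum of the Teichmueller identities for \<open>w, x, y, z\<close> and \<open>x, y, z, w\<close> two of the three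
  associators of products cancel. What remains is the claim, because the associator is invariant
  under rotation. Rotations and the last transposition generate all permutations.
\<close>

lemma bruck_kleinfeld_rotate:
  assumes "w \<in> carrier A" "x \<in> carrier A" "y \<in> carrier A" "z \<in> carrier A"
  shows "bruck_kleinfeld z w x y = \<ominus> bruck_kleinfeld w x y z"
proof -
  define A1 A2 A3 A4 where "A1 = associator A (w \<otimes> x) y z" and "A2 = associator A (x \<otimes> y) z w"
    and "A3 = associator A (y \<otimes> z) w x" and "A4 = associator A (z \<otimes> w) x y"
  define a b c d where "a = associator A x y z" and "b = associator A w x y"
    and "c = associator A y z w" and "d = associator A z w x"
  note defs = A1_def A2_def A3_def A4_def a_def b_def c_def d_def
  have car: "A1 \<in> carrier A" "A2 \<in> carrier A" "A3 \<in> carrier A" "A4 \<in> carrier A"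
    "a \<in> carrier A" "b \<in> carrier A" "c \<in> carrier A" "d \<in> carrier A"
    using assms by (simp_all add: defs)
  have 1: "A1 \<ominus> A2 \<oplus> A3 = w \<otimes> a \<oplus> b \<otimes> z"
    using teichmueller[OF assms] assms
      associator_rotate[of w "x \<otimes> y" z] associator_rotate[of w x "y \<otimes> z"]
      associator_rotate[of x "y \<otimes> z" w]
    by (simp add: defs)
  have 2: "A2 \<ominus> A3 \<oplus> A4 = x \<otimes> c \<oplus> a \<otimes> w"
    using teichmueller[of x y z w] assms
      associator_rotate[of x "y \<otimes> z" w] associator_rotate[of x y "z \<otimes> w"]
      associator_rotate[of y "z \<otimes> w" x]
    by (simp add: defs)
  have "A1 \<oplus> A4 = (A1 \<ominus> A2 \<oplus> A3) \<oplus> (A2 \<ominus> A3 \<oplus> A4)"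
    using car by algebra
  then have sum: "A1 \<oplus> A4 = (w \<otimes> a \<oplus> b \<otimes> z) \<oplus> (x \<otimes> c \<oplus> a \<otimes> w)"
    by (simp only: 1 2)
  have F: "bruck_kleinfeld w x y z = A1 \<ominus> x \<otimes> c \<ominus> a \<otimes> w"
    unfolding bruck_kleinfeld_def defs using assms associator_rotate[of w y z] by simp
  have F': "bruck_kleinfeld z w x y = A4 \<ominus> w \<otimes> a \<ominus> b \<otimes> z"
    unfolding bruck_kleinfeld_def defs using assms associator_rotate[of z x y] by simp
  have "bruck_kleinfeld z w x y \<oplus> bruck_kleinfeld w x y z
      = (A1 \<oplus> A4) \<ominus> ((w \<otimes> a \<oplus> b \<otimes> z) \<oplus> (x \<otimes> c \<oplus> a \<otimes> w))"
    unfolding F F' using car assms by algebra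
  also have "\<dots> = \<zero>" unfolding sum using car assms by (simp add: diff_eq_zero_iff)
  finally show ?thesis using assms by (simp add: sum_eq_zero_iff)
qed

lemma bruck_kleinfeld_swap_pairs:
  assumes "w \<in> carrier A" "x \<in> carrier A" "y \<in> carrier A" "z \<in> carrier A"
  shows "bruck_kleinfeld y z w x = bruck_kleinfeld w x y z"
  using assms bruck_kleinfeld_rotate[of w x y z] bruck_kleinfeld_rotate[of z w x y] by simp

text \<open>
  A Moufang identity: the difference of both sides is \<open>bruck_kleinfeld y x x z\<close>, and the
  rotated value \<open>bruck_kleinfeld z y x x\<close> is zero since the associator is alternating.
\<close>

lemma associator_mult_left:
  assumes "x \<in> carrier A" "y \<in> carrier A" "z \<in> carrier A"
  shows "associator A (y \<otimes> x) x z = x \<otimes> associator A y x z"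
proof -
  have "bruck_kleinfeld z y x x = \<zero>"
    using assms by (simp add: bruck_kleinfeld_def associator_right minus_eq)
  then have "bruck_kleinfeld y x x z = \<zero>"
    using assms bruck_kleinfeld_rotate[of y x x z]
      by (metis a_inv_closed bruck_kleinfeld_closed minus_minus minus_zero)
  then show ?thesis
    using assms by (simp add: bruck_kleinfeld_def associator_left minus_eq diff_eq_zero_iff[unfolded minus_eq])
qed

lemma associator_mult_right:
  assumes "x \<in> carrier A" "y \<in> carrier A" "z \<in> carrier A"
  shows "associator A (x \<otimes> y) x z = associator A y x z \<otimes> x"
proof -
  have "bruck_kleinfeld z x x y = \<zero>"
    using assms associator_mult_left[of x z y] by (simp add: bruck_kleinfeld_def associator_left minus_eq r_neg)
  then have "bruck_kleinfeld x y z x = \<zero>"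
    using assms bruck_kleinfeld_swap_pairs[of z x x y] by simp
  then have "bruck_kleinfeld x y x z = \<zero>"
    using assms bruck_kleinfeld_swap[of x y z x] by simp
  then show ?thesis
    using assms by (simp add: bruck_kleinfeld_def associator_left minus_eq diff_eq_zero_iff[unfolded minus_eq])
qed

lemma middle_moufang:
  assumes "x \<in> carrier A" "y \<in> carrier A" "z \<in> carrier A"
  shows "(x \<otimes> y) \<otimes> (z \<otimes> x) = x \<otimes> ((y \<otimes> z) \<otimes> x)"
proof -
  have 1: "associator A x y (z \<otimes> x) = x \<otimes> associator A y z x"
    using assms associator_mult_left[of x z y] associator_rotate[of "z \<otimes> x" x y]
      associator_rotate[of x y z] associator_rotate[of z x y] by simp
  have "(x \<otimes> y) \<otimes> (z \<otimes> x) = associator A x y (z \<otimes> x) \<oplus> x \<otimes> (y \<otimes> (z \<otimes> x))"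
    unfolding associator_def using assms by algebra
  also have "\<dots> = x \<otimes> (associator A y z x \<oplus> y \<otimes> (z \<otimes> x))"
    unfolding 1 using assms by (simp add: r_distr)
  also have "associator A y z x \<oplus> y \<otimes> (z \<otimes> x) = (y \<otimes> z) \<otimes> x"
    unfolding associator_def using assms by algebra
  finally show ?thesis .
qed

definition associating :: "'a \<Rightarrow> 'a set" where
  "associating z = {x \<in> carrier A. \<forall>y\<in>carrier A. associator A z x y = \<zero>}"

lemma associatingD:
  assumes "x \<in> associating z" "y \<in> carrier A" "z \<in> carrier A"
  shows "x \<in> carrier A" "associator A z x y = \<zero>" "associator A x y z = \<zero>" "associator A y z x = \<zero>"
    "associator A z y x = \<zero>" "associator A y x z = \<zero>" "associator A x z y = \<zero>"
proof -
  show x: "x \<in> carrier A" and 1: "associator A z x y = \<zero>"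
    using assms by (auto simp: associating_def)
  show 2: "associator A x y z = \<zero>" "associator A y z x = \<zero>"
    using assms x 1 associator_rotate[of z x y] associator_rotate[of x y z] by auto
  show "associator A z y x = \<zero>" "associator A y x z = \<zero>" "associator A x z y = \<zero>"
    using assms x 1 2 associator_swap23[of z x y] associator_swap23[of x y z] associator_swap23[of y z x]
    by auto
qed

text \<open>
  In \<open>bruck_kleinfeld y x x' z\<close> each associator contains \<open>z\<close> together with \<open>x\<close> or \<open>x'\<close>, hence it
  vanishes. In its rotation \<open>bruck_kleinfeld x x' z y\<close> all terms but the associator of \<open>x x'\<close>
  vanish for the same reason.
\<close>

lemma associating_mult:
  assumes z: "z \<in> carrier A" and x: "x \<in> associating z" and x': "x' \<in> associating z"
  shows "x \<otimes> x' \<in> associating z"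
proof -
  have c: "x \<in> carrier A" "x' \<in> carrier A" using x x' by (auto simp: associating_def)
  have "associator A z (x \<otimes> x') y = \<zero>" if y: "y \<in> carrier A" for y
  proof -
    have "bruck_kleinfeld y x x' z = \<zero>"
      using associatingD(5,3,6)[OF x'] y z c associatingD(3)[OF x] by (simp add: bruck_kleinfeld_def minus_eq)
    then have "bruck_kleinfeld x x' z y = \<zero>"
      using bruck_kleinfeld_rotate[of x x' z y] c y z
      by (metis a_inv_closed bruck_kleinfeld_closed minus_minus minus_zero)
    then have "associator A (x \<otimes> x') z y = \<zero>"
      using associatingD[OF x] associatingD[OF x'] y z c by (simp add: bruck_kleinfeld_def minus_eq)
    then show ?thesis
      using associator_swap12[of "x \<otimes> x'" z y] c y z by simp
  qed
  then show ?thesis using c by (simp add: associating_def)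
qed

lemma associating_sym:
  assumes "x \<in> associating z" "z \<in> carrier A" shows "z \<in> associating x"
  using assms associatingD(7)[OF assms(1)] by (simp add: associating_def)

lemma self_associating: "x \<in> carrier A \<Longrightarrow> x \<in> associating x"
  by (simp add: associating_def associator_left)

text \<open>
  The Teichmueller identity for \<open>w, x, x, y\<close> expresses \<open>(w, x\<^sup>2, y)\<close> as \<open>(w x, x, y) + (w, x, x y)\<close>.
  By the Moufang identity the summands are \<open>x (w, x, y)\<close> up to sign, and the signs are opposite
  because \<open>x y = - y x\<close>.
\<close>

lemma square_associating:
  assumes xy: "x \<otimes> y = \<ominus> (y \<otimes> x)" and c: "x \<in> carrier A" "y \<in> carrier A"
  shows "y \<in> associating (x \<otimes> x)"
proof -
  have "associator A (x \<otimes> x) y w = \<zero>" if w: "w \<in> carrier A" for w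
  proof -
    have "associator A (w \<otimes> x) x y \<ominus> associator A w (x \<otimes> x) y \<oplus> associator A w x (x \<otimes> y) = \<zero>"
      using teichmueller[of w x x y] c w by (simp add: associator_left associator_right)
    moreover have 1: "associator A (w \<otimes> x) x y = x \<otimes> associator A w x y"
      using c w by (simp add: associator_mult_left)
    moreover have "associator A w x (x \<otimes> y) = \<ominus> (x \<otimes> associator A w x y)"
    proof -
      have "associator A w x (y \<otimes> x) = associator A (y \<otimes> x) w x"
        using associator_rotate[of "y \<otimes> x" w x] c w by simp
      also have "\<dots> = \<ominus> (x \<otimes> associator A y x w)"
        using associator_swap23[of "y \<otimes> x" x w] associator_mult_left[of x y w] c w by simp
      also have "associator A y x w = \<ominus> associator A w x y"
        using associator_swap23[of y w x] associator_rotate[of y w x] c w by simp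
      finally have "associator A w x (y \<otimes> x) = x \<otimes> associator A w x y"
        using c w by (simp add: r_minus)
      moreover have "associator A w x (x \<otimes> y) = \<ominus> associator A w x (y \<otimes> x)"
        unfolding xy associator_def using c w by algebra
      ultimately show ?thesis by simp
    qed
    ultimately have "x \<otimes> associator A w x y \<ominus> associator A w (x \<otimes> x) y \<oplus> \<ominus> (x \<otimes> associator A w x y) = \<zero>"
      by simp
    moreover have "x \<otimes> associator A w x y \<ominus> associator A w (x \<otimes> x) y \<oplus> \<ominus> (x \<otimes> associator A w x y)
       = \<ominus> associator A w (x \<otimes> x) y" using c w by algebra
    ultimately have "associator A w (x \<otimes> x) y = \<zero>"
      using c w by (metis associator_closed m_closed minus_minus minus_zero)
    then show ?thesis using associator_rotate[of w "x \<otimes> x" y] c w by simp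
  qed
  then show ?thesis using c by (simp add: associating_def)
qed

lemma square_commute:
  assumes xy: "x \<otimes> y = \<ominus> (y \<otimes> x)" and c: "x \<in> carrier A" "y \<in> carrier A"
  shows "(x \<otimes> x) \<otimes> y = y \<otimes> (x \<otimes> x)"
proof -
  have "(x \<otimes> x) \<otimes> y = x \<otimes> (\<ominus> (y \<otimes> x))" using c by (simp add: left_alternative xy)
  also have "\<dots> = \<ominus> ((x \<otimes> y) \<otimes> x)" using c by (simp add: r_minus flexible)
  also have "\<dots> = y \<otimes> (x \<otimes> x)" using c by (simp add: xy l_minus right_alternative)
  finally show ?thesis .
qed

text \<open>
  The associator \<open>q = (t, w, z)\<close> satisfies \<open>w q = 0 = q t\<close> by the two Moufang identities with
  \<open>t w = 1\<close>. Therefore \<open>(t, w, q) = q\<close> and \<open>(q, t, w) = - q\<close>, but these associators are equal, so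
  \<open>2 q = 0\<close>.
\<close>

lemma right_inverse_associating:
  assumes two: "\<And>q. \<lbrakk>q \<in> carrier A; q \<oplus> q = \<zero>\<rbrakk> \<Longrightarrow> q = \<zero>"
    and c: "t \<in> carrier A" "w \<in> carrier A" and tw: "t \<otimes> w = \<one>"
  shows "w \<in> associating t"
proof -
  have "associator A t w z = \<zero>" if z: "z \<in> carrier A" for z
  proof -
    define q where "q = associator A t w z"
    have q: "q \<in> carrier A" using c z by (simp add: q_def)
    have one: "associator A \<one> u v = \<zero>" if "u \<in> carrier A" "v \<in> carrier A" for u v
      using that by (simp add: associator_def minus_eq r_neg)
    have wq: "w \<otimes> q = \<zero>"
      using associator_mult_left[of w t z] c z one[of w z] by (simp add: tw q_def)
    have "associator A w t z \<otimes> t = \<zero>"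
      using associator_mult_right[of t w z] c z one[of t z] by (simp add: tw)
    then have qt: "q \<otimes> t = \<zero>"
      using associator_swap12[of w t z] c z by (simp add: q_def l_minus)
    have "associator A t w q = q" using c q by (simp add: associator_def tw wq minus_eq)
    moreover have "associator A q t w = \<ominus> q" using c q by (simp add: associator_def tw qt minus_eq)
    ultimately have "q = \<ominus> q" using associator_rotate[of q t w] c q by simp
    then have "q \<oplus> q = \<zero>" using q by (metis r_neg)
    from two[OF q this] show ?thesis by (simp add: q_def)
  qed
  then show ?thesis using c by (simp add: associating_def)
qed

end

context alternative_ring
begin

lemma associating_assoc:
  assumes "x \<in> associating z" "y \<in> carrier A" "z \<in> carrier A"
  shows "(z \<otimes> x) \<otimes> y = z \<otimes> (x \<otimes> y)" "(x \<otimes> y) \<otimes> z = x \<otimes> (y \<otimes> z)" "(y \<otimes> z) \<otimes> x = y \<otimes> (z \<otimes> x)"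
    "(z \<otimes> y) \<otimes> x = z \<otimes> (y \<otimes> x)" "(y \<otimes> x) \<otimes> z = y \<otimes> (x \<otimes> z)" "(x \<otimes> z) \<otimes> y = x \<otimes> (z \<otimes> y)"
  using associatingD[OF assms] assms(2,3)
  by (auto simp: associator_def diff_eq_zero_iff)

section \<open>Triples satisfying the Cayley relations\<close>

definition cayley_triple :: "'a \<Rightarrow> 'a \<Rightarrow> 'a \<Rightarrow> bool" where
  "cayley_triple a b c \<longleftrightarrow> a \<in> carrier A \<and> b \<in> carrier A \<and> c \<in> carrier A
    \<and> a \<otimes> b = \<ominus> (b \<otimes> a) \<and> a \<otimes> c = \<ominus> (c \<otimes> a) \<and> b \<otimes> c = \<ominus> (c \<otimes> b)
    \<and> (a \<otimes> b) \<otimes> c = \<ominus> (a \<otimes> (b \<otimes> c))"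

lemma cayley_tripleD:
  assumes "cayley_triple a b c"
  shows "a \<in> carrier A" "b \<in> carrier A" "c \<in> carrier A"
    "a \<otimes> b = \<ominus> (b \<otimes> a)" "a \<otimes> c = \<ominus> (c \<otimes> a)" "b \<otimes> c = \<ominus> (c \<otimes> b)"
    "(a \<otimes> b) \<otimes> c = \<ominus> (a \<otimes> (b \<otimes> c))"
    "b \<otimes> a = \<ominus> (a \<otimes> b)" "c \<otimes> a = \<ominus> (a \<otimes> c)" "c \<otimes> b = \<ominus> (b \<otimes> c)"
    "a \<otimes> (b \<otimes> c) = \<ominus> ((a \<otimes> b) \<otimes> c)"
proof -
  from assms show c: "a \<in> carrier A" "b \<in> carrier A" "c \<in> carrier A"
    and e: "a \<otimes> b = \<ominus> (b \<otimes> a)" "a \<otimes> c = \<ominus> (c \<otimes> a)" "b \<otimes> c = \<ominus> (c \<otimes> b)"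
    "(a \<otimes> b) \<otimes> c = \<ominus> (a \<otimes> (b \<otimes> c))"
    unfolding cayley_triple_def by blast+
  show "b \<otimes> a = \<ominus> (a \<otimes> b)" by (simp only: e(1) minus_minus m_closed c)
  show "c \<otimes> a = \<ominus> (a \<otimes> c)" by (simp only: e(2) minus_minus m_closed c)
  show "c \<otimes> b = \<ominus> (b \<otimes> c)" by (simp only: e(3) minus_minus m_closed c)
  show "a \<otimes> (b \<otimes> c) = \<ominus> ((a \<otimes> b) \<otimes> c)" by (simp only: e(4) minus_minus m_closed c)
qed

lemma cayley_triple_associator:
  assumes "cayley_triple a b c"
  shows "associator A a b c = (a \<otimes> b) \<otimes> c \<oplus> (a \<otimes> b) \<otimes> c"
  unfolding associator_def
  by (simp only: cayley_tripleD(11)[OF assms] minus_eq minus_minus m_closed cayley_tripleD(1-3)[OF assms])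

text \<open>
  The last relation says \<open>(a, b, c) = 2 (a b) c\<close>. Since the associator is alternating, this
  determines how the products of \<open>a\<close>, \<open>b\<close>, \<open>c\<close> in any order and bracketing differ.
\<close>

lemma cayley_triple_products:
  assumes abc: "cayley_triple a b c"
  shows "(a \<otimes> c) \<otimes> b = \<ominus> ((a \<otimes> b) \<otimes> c)" "c \<otimes> (a \<otimes> b) = \<ominus> ((a \<otimes> b) \<otimes> c)"
    "b \<otimes> (c \<otimes> a) = \<ominus> ((a \<otimes> b) \<otimes> c)" "(b \<otimes> c) \<otimes> a = (a \<otimes> b) \<otimes> c"
proof -
  note c = cayley_tripleD(1-3)[OF abc]
  define p where "p = (a \<otimes> b) \<otimes> c"
  have p: "p \<in> carrier A" using c by (simp add: p_def)
  note anti = cayley_tripleD(8-11)[OF abc, folded p_def]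
  note asc = cayley_triple_associator[OF abc, folded p_def]
  have split: "(u \<otimes> v) \<otimes> w = associator A u v w \<oplus> u \<otimes> (v \<otimes> w)"
      "u \<otimes> (v \<otimes> w) = (u \<otimes> v) \<otimes> w \<ominus> associator A u v w"
    if "u \<in> carrier A" "v \<in> carrier A" "w \<in> carrier A" for u v w
    unfolding associator_def using that by algebra+
  have "(a \<otimes> c) \<otimes> b = \<ominus> (p \<oplus> p) \<oplus> a \<otimes> (c \<otimes> b)"
    using split(1)[of a c b] associator_swap23[of a b c] asc c by simp
  also have "a \<otimes> (c \<otimes> b) = p" using c p by (simp only: anti r_minus m_closed minus_minus)
  also have "\<ominus> (p \<oplus> p) \<oplus> p = \<ominus> p" using p by algebra
  finally show acb: "(a \<otimes> c) \<otimes> b = \<ominus> ((a \<otimes> b) \<otimes> c)" unfolding p_def .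
  have "c \<otimes> (a \<otimes> b) = (c \<otimes> a) \<otimes> b \<ominus> (p \<oplus> p)"
    using split(2)[of c a b] associator_rotate[of c a b] asc c by simp
  also have "(c \<otimes> a) \<otimes> b = p" using c p by (simp only: anti l_minus m_closed minus_minus acb p_def)
  also have "p \<ominus> (p \<oplus> p) = \<ominus> p" using p by algebra
  finally show "c \<otimes> (a \<otimes> b) = \<ominus> ((a \<otimes> b) \<otimes> c)" unfolding p_def .
  have "b \<otimes> (a \<otimes> c) = (b \<otimes> a) \<otimes> c \<ominus> \<ominus> (p \<oplus> p)"
    using split(2)[of b a c] associator_swap12[of a b c] asc c by simp
  also have "(b \<otimes> a) \<otimes> c = \<ominus> p" using c p by (simp only: anti l_minus m_closed p_def)
  also have "\<ominus> p \<ominus> \<ominus> (p \<oplus> p) = p" using p by algebra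
  finally show bca: "b \<otimes> (c \<otimes> a) = \<ominus> ((a \<otimes> b) \<otimes> c)"
    using c by (simp only: anti r_minus m_closed p_def)
  have "(b \<otimes> c) \<otimes> a = (p \<oplus> p) \<oplus> b \<otimes> (c \<otimes> a)"
    using split(1)[of b c a] associator_rotate[of a b c] asc c by simp
  also have "\<dots> = p" unfolding bca p_def[symmetric] using p by algebra
  finally show "(b \<otimes> c) \<otimes> a = (a \<otimes> b) \<otimes> c" unfolding p_def .
qed

lemma cayley_triple_rotate:
  assumes abc: "cayley_triple a b c" shows "cayley_triple b c a"
  unfolding cayley_triple_def
  using cayley_tripleD(1-3)[OF abc] cayley_tripleD(6,8,9)[OF abc] cayley_triple_products(3,4)[OF abc]
  by (metis minus_minus m_closed)

text \<open>
  With \<open>q = x y\<close> the Cayley relations give \<open>(t, x, y) = 2 q t = - 2 t q\<close>. Comparing this with the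
  associator \<open>(w, x, y)\<close> shows that \<open>w t\<close> fixes \<open>q\<close> from the left, that is \<open>(w t) (x y) = x y\<close>, and that
  \<open>(w t, x, y) = 0\<close>. So \<open>((w t) x) y = x y\<close>, and the right inverses of \<open>y\<close> and \<open>x\<close> allow cancellation.
\<close>

lemma cayley_triple_right_inverse:
  assumes two: "\<And>q. \<lbrakk>q \<in> carrier A; q \<oplus> q = \<zero>\<rbrakk> \<Longrightarrow> q = \<zero>"
    and txy: "cayley_triple t x y"
    and w: "w \<in> carrier A" and tw: "t \<otimes> w = \<one>"
    and x': "x' \<in> carrier A" "x \<otimes> x' = \<one>" and y': "y' \<in> carrier A" "y \<otimes> y' = \<one>"
  shows "w \<otimes> t = \<one>"
proof -
  have c [simp]: "t \<in> carrier A" "x \<in> carrier A" "y \<in> carrier A"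
    and tx: "t \<otimes> x = \<ominus> (x \<otimes> t)" and ty: "t \<otimes> y = \<ominus> (y \<otimes> t)"
    using cayley_tripleD(1-5)[OF txy] .
  note [simp] = w
  have cancel: "a = b"
    if "a \<otimes> u = b \<otimes> u" "u \<otimes> u' = \<one>" "a \<in> carrier A" "b \<in> carrier A" "u \<in> carrier A" "u' \<in> carrier A"
    for a b u u'
  proof -
    have u': "u' \<in> associating u" using right_inverse_associating[OF two] that by simp
    have "a = (a \<otimes> u) \<otimes> u'" using associating_assoc(3)[OF u', of a] that(2-) by simp
    also have "\<dots> = (b \<otimes> u) \<otimes> u'" by (simp only: that(1))
    also have "\<dots> = b" using associating_assoc(3)[OF u', of b] that(2-) by simp
    finally show ?thesis .
  qed
  define q where "q = x \<otimes> y"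
  have [simp]: "q \<in> carrier A" by (simp add: q_def)
  have wt: "w \<in> associating t" using right_inverse_associating[OF two] tw by simp
  note wtr = associating_assoc[OF wt _ c(1)]
  have qt: "q \<otimes> t = (t \<otimes> x) \<otimes> y" and tq: "t \<otimes> q = \<ominus> (q \<otimes> t)"
    using cayley_triple_products(4)[OF txy] cayley_tripleD(11)[OF txy] by (simp_all only: q_def)
  define b where "b = associator A t x y"
  have b: "b = q \<otimes> t \<oplus> q \<otimes> t"
    using cayley_triple_associator[OF txy] by (simp add: b_def qt)
  define a where "a = associator A w x y"
  have [simp]: "a \<in> carrier A" "b \<in> carrier A" by (simp_all add: a_def b_def)
  define tt where "tt = t \<otimes> t"
  have [simp]: "tt \<in> carrier A" by (simp add: tt_def)
  have xytt: "x \<in> associating tt" 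
    using square_associating[OF tx] by (simp_all add: tt_def)
  have one: "associator A \<one> u v = \<zero>" if "u \<in> carrier A" "v \<in> carrier A" for u v
    using that by (simp add: associator_def minus_eq r_neg)
  \<comment> \<open>Each associator in it contains both \<open>t\<close> and \<open>w\<close>.\<close>
  have F1: "bruck_kleinfeld x y t w = \<zero>"
    using associatingD[OF wt] by (simp add: bruck_kleinfeld_def minus_eq)
  have F2: "bruck_kleinfeld t w x y = \<zero>"
    using F1 bruck_kleinfeld_swap_pairs[of t w x y] by simp
  have F3: "bruck_kleinfeld w t x y = \<zero>"
  proof -
    have "bruck_kleinfeld x y w t = \<zero>"
      using F1 bruck_kleinfeld_swap[of x y t w] by simp
    then show ?thesis using bruck_kleinfeld_swap_pairs[of w t x y] by simp
  qed
  have "tt \<in> associating w"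
    unfolding tt_def using associating_mult associating_sym[OF wt] by simp
  then have wtt: "w \<in> associating tt" using associating_sym by simp
  have "bruck_kleinfeld x y tt w = \<zero>"
    using associatingD[OF wtt] by (simp add: bruck_kleinfeld_def minus_eq)
  then have F4: "bruck_kleinfeld tt w x y = \<zero>"
    using bruck_kleinfeld_swap_pairs[of tt w x y] by simp
  \<comment> \<open>Writing \<open>t\<close> as \<open>t\<^sup>2 w\<close> and using that \<open>t\<^sup>2\<close> associates with \<open>x\<close>, one gets \<open>(t, x, y) = (w, x, y) t\<^sup>2\<close>.\<close>
  have ttw: "tt \<otimes> w = t" by (simp add: tt_def wtr tw)
  \<comment> \<open>This is \<open>F2\<close>, as \<open>(t w, x, y) = (1, x, y) = 0\<close>.\<close>
  have wb: "w \<otimes> b = \<ominus> (a \<otimes> t)"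
  proof -
    have "\<ominus> (w \<otimes> b) \<ominus> a \<otimes> t = \<zero>"
      using F2 by (simp add: bruck_kleinfeld_def tw one a_def b_def minus_eq)
    then have "\<ominus> (w \<otimes> b) = a \<otimes> t" by (simp add: diff_eq_zero_iff)
    then show ?thesis by (metis minus_minus m_closed w \<open>b \<in> carrier A\<close>)
  qed
  have "b = a \<otimes> tt"
  proof -
    have "b \<ominus> a \<otimes> tt = \<zero>"
      using F4 associatingD(2)[OF xytt, of y] by (simp add: bruck_kleinfeld_def ttw a_def b_def minus_eq)
    then show ?thesis by (simp add: diff_eq_zero_iff)
  qed
  then have "b = (a \<otimes> t) \<otimes> t" by (simp add: tt_def right_alternative)
  then have "(q \<oplus> q) \<otimes> t = (a \<otimes> t) \<otimes> t" by (simp add: b l_distr)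
  then have at: "a \<otimes> t = q \<oplus> q"
    using cancel[of "q \<oplus> q" t "a \<otimes> t" w] tw by simp
  have "(w \<otimes> t) \<otimes> q = q"
  proof -
    have "w \<otimes> (q \<otimes> t) \<oplus> w \<otimes> (q \<otimes> t) = \<ominus> (q \<oplus> q)"
      using wb by (simp add: at b r_distr)
    moreover define u where "u = w \<otimes> (q \<otimes> t)"
    ultimately have "u \<oplus> u = \<ominus> (q \<oplus> q)" "u \<in> carrier A" by simp_all
    moreover have "(u \<oplus> q) \<oplus> (u \<oplus> q) = (u \<oplus> u) \<oplus> (q \<oplus> q)"
      using \<open>u \<in> carrier A\<close> by (simp add: a_ac)
    ultimately have "(u \<oplus> q) \<oplus> (u \<oplus> q) = \<zero>"
      by (simp only: l_neg a_closed \<open>q \<in> carrier A\<close>)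
    then have "u \<oplus> q = \<zero>" using two[of "u \<oplus> q"] \<open>u \<in> carrier A\<close> by simp
    then have "u = \<ominus> q" using \<open>u \<in> carrier A\<close> by (simp add: sum_eq_zero_iff)
    then have "w \<otimes> (t \<otimes> q) = q" by (simp add: tq r_minus flip: u_def)
    then show ?thesis by (simp add: wtr(6))
  qed
  moreover have "associator A (w \<otimes> t) x y = \<zero>"
  proof -
    have "associator A (w \<otimes> t) x y \<ominus> (t \<otimes> a \<oplus> b \<otimes> w) = \<zero>"
    proof -
      have "associator A (w \<otimes> t) x y \<ominus> (t \<otimes> a \<oplus> b \<otimes> w) = bruck_kleinfeld w t x y"
        unfolding bruck_kleinfeld_def a_def b_def using c w by algebra
      then show ?thesis using F3 by simp
    qed
    moreover have "b \<otimes> w = q \<oplus> q" by (simp add: b l_distr wtr(3) tw)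
    moreover have "t \<otimes> a = \<ominus> (q \<oplus> q)"
    proof -
      have "a = (a \<otimes> t) \<otimes> w" using wtr(3)[of a] by (simp add: tw)
      then have "t \<otimes> a = t \<otimes> (q \<otimes> w) \<oplus> t \<otimes> (q \<otimes> w)" by (metis at l_distr r_distr c(1) w m_closed \<open>q \<in> carrier A\<close>)
      moreover have "t \<otimes> (q \<otimes> w) = \<ominus> q"
        using wtr(4)[of q] tq wtr(3)[of q] by (simp add: tw l_minus)
      ultimately show ?thesis by (simp add: minus_add)
    qed
    ultimately show ?thesis by (simp add: l_neg minus_eq)
  qed
  ultimately have "((w \<otimes> t) \<otimes> x) \<otimes> y = x \<otimes> y"
    by (simp add: associator_def q_def diff_eq_zero_iff)
  then have "(w \<otimes> t) \<otimes> x = x" using cancel y' by simp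
  then have "(w \<otimes> t) \<otimes> x = \<one> \<otimes> x" by simp
  from cancel[OF this x'(2)] show ?thesis using x'(1) by simp
qed

section \<open>The center\<close>

text \<open>
  The definition of the center constrains one position of the associator only; the alternating law
  supplies the other two.
\<close>

lemma alg_center_iff:
  "z \<in> alg_center A \<longleftrightarrow> z \<in> carrier A \<and> (\<forall>x\<in>carrier A. z \<otimes> x = x \<otimes> z \<and> x \<in> associating z)"
  unfolding alg_center_def commutator_def associating_def by (auto simp: diff_eq_zero_iff)

lemma alg_center_closed: "z \<in> alg_center A \<Longrightarrow> z \<in> carrier A"
  by (simp add: alg_center_iff)

lemma alg_center_comm: "\<lbrakk>z \<in> alg_center A; x \<in> carrier A\<rbrakk> \<Longrightarrow> x \<otimes> z = z \<otimes> x"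
  by (simp add: alg_center_iff)

lemma alg_center_assoc:
  assumes "z \<in> alg_center A" "x \<in> carrier A" "y \<in> carrier A"
  shows "(z \<otimes> x) \<otimes> y = z \<otimes> (x \<otimes> y)" "x \<otimes> (z \<otimes> y) = z \<otimes> (x \<otimes> y)"
proof -
  have z: "z \<in> carrier A" and x: "x \<in> associating z" using assms by (auto simp: alg_center_iff)
  show "(z \<otimes> x) \<otimes> y = z \<otimes> (x \<otimes> y)" using associating_assoc(1)[OF x] assms z by simp
  have "x \<otimes> (z \<otimes> y) = (x \<otimes> z) \<otimes> y" using associating_assoc(6)[OF x] assms z by simp
  also have "\<dots> = z \<otimes> (x \<otimes> y)"
    using associating_assoc(1)[OF x] assms z alg_center_comm[OF assms(1), of x] by simp
  finally show "x \<otimes> (z \<otimes> y) = z \<otimes> (x \<otimes> y)" .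
qed

lemma alg_centerI:
  assumes "z \<in> carrier A" "\<And>x. x \<in> carrier A \<Longrightarrow> x \<otimes> z = z \<otimes> x"
    "\<And>x y. \<lbrakk>x \<in> carrier A; y \<in> carrier A\<rbrakk> \<Longrightarrow> (z \<otimes> x) \<otimes> y = z \<otimes> (x \<otimes> y)"
  shows "z \<in> alg_center A"
  using assms by (simp add: alg_center_def commutator_def associator_def diff_eq_zero_iff)

lemma alg_center_one: "\<one> \<in> alg_center A" by (rule alg_centerI) simp_all

lemma alg_center_zero: "\<zero> \<in> alg_center A" by (rule alg_centerI) simp_all

lemma alg_center_mult:
  assumes "z \<in> alg_center A" "z' \<in> alg_center A"
  shows "z \<otimes> z' \<in> alg_center A"
proof (rule alg_centerI)
  note c = alg_center_closed[OF assms(1)] alg_center_closed[OF assms(2)]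
  show "z \<otimes> z' \<in> carrier A" using c by simp
  fix x assume x: "x \<in> carrier A"
  show "x \<otimes> (z \<otimes> z') = (z \<otimes> z') \<otimes> x"
    using c x alg_center_assoc(1)[OF assms(1) c(2) x] alg_center_assoc(2)[OF assms(1) x c(2)]
    by (simp only: alg_center_comm[OF assms(2) x])
  fix y assume y: "y \<in> carrier A"
  show "((z \<otimes> z') \<otimes> x) \<otimes> y = (z \<otimes> z') \<otimes> (x \<otimes> y)"
    using c x y assms by (simp add: alg_center_assoc)
qed

lemma alg_center_add:
  assumes "z \<in> alg_center A" "z' \<in> alg_center A"
  shows "z \<oplus> z' \<in> alg_center A"
  using assms alg_center_closed alg_center_comm[of z] alg_center_comm[of z'] alg_center_assoc(1)
  by (intro alg_centerI) (simp_all add: l_distr r_distr)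

lemma alg_center_minus:
  assumes "z \<in> alg_center A"
  shows "\<ominus> z \<in> alg_center A"
  using assms alg_center_closed alg_center_comm[of z] alg_center_assoc(1)
  by (intro alg_centerI) (simp_all add: l_minus r_minus)

text \<open>
  One-sided inverses suffice here: a central element commutes with them.
\<close>

definition central_units :: "'a set" where
  "central_units = {z \<in> alg_center A. \<exists>w\<in>carrier A. z \<otimes> w = \<one>}"

lemma central_units_one: "\<one> \<in> central_units"
  by (auto simp: central_units_def alg_center_one intro!: bexI[of _ \<one>])

lemma central_units_mult:
  assumes "z \<in> central_units" "z' \<in> central_units"
  shows "z \<otimes> z' \<in> central_units"
proof -
  obtain w w' where w: "w \<in> carrier A" "z \<otimes> w = \<one>" "w' \<in> carrier A" "z' \<otimes> w' = \<one>"
    using assms by (auto simp: central_units_def)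
  have z: "z \<in> alg_center A" "z' \<in> alg_center A" using assms by (auto simp: central_units_def)
  have "(z \<otimes> z') \<otimes> (w \<otimes> w') = (z \<otimes> w) \<otimes> (z' \<otimes> w')"
    using z w(1,3) by (simp add: alg_center_closed alg_center_assoc)
  then have "(z \<otimes> z') \<otimes> (w \<otimes> w') = \<one>" using w by simp
  then show ?thesis using z w alg_center_mult unfolding central_units_def by auto
qed

lemma central_units_cancel:
  assumes "z \<in> central_units" "x \<in> carrier A" "y \<in> carrier A" "z \<otimes> x = z \<otimes> y"
  shows "x = y"
proof -
  obtain w where w: "w \<in> carrier A" "z \<otimes> w = \<one>" using assms by (auto simp: central_units_def)
  have z: "z \<in> alg_center A" using assms by (auto simp: central_units_def)
  have "w \<otimes> (z \<otimes> u) = u" if u: "u \<in> carrier A" for u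
    using w u alg_center_assoc(1)[OF z w(1) u] alg_center_assoc(2)[OF z w(1) u] by simp
  then show ?thesis using assms by metis
qed

lemma central_units_solve:
  assumes "z \<in> central_units" "y \<in> carrier A"
  obtains x where "x \<in> carrier A" "z \<otimes> x = y"
proof -
  obtain w where w: "w \<in> carrier A" "z \<otimes> w = \<one>" using assms by (auto simp: central_units_def)
  have z: "z \<in> alg_center A" using assms by (auto simp: central_units_def)
  have "z \<otimes> (w \<otimes> y) = y" using w assms z alg_center_assoc(1)[of z w y] by simp
  then show ?thesis using that[of "w \<otimes> y"] w assms by simp
qed

text \<open>
  A right inverse of \<open>a\<close> already makes \<open>a\<^sup>2\<close> invertible: \<open>a\<^sup>2 w\<^sup>2 = a (a w\<^sup>2) = a w = 1\<close>.
\<close>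

lemma square_central_unit:
  assumes "a \<in> carrier A" "w \<in> carrier A" "a \<otimes> w = \<one>" "a \<otimes> a \<in> alg_center A"
  shows "a \<otimes> a \<in> central_units"
proof -
  have "a \<otimes> (w \<otimes> w) = w" using assms right_alternative[of w a] by simp
  then have "(a \<otimes> a) \<otimes> (w \<otimes> w) = \<one>" using assms by (simp add: left_alternative)
  then show ?thesis using assms by (auto simp: central_units_def)
qed

text \<open>
  Needed for inverses adjoined as new generators, to which the closure of \<open>associating z\<close> under
  products does not apply. In \<open>bruck_kleinfeld z y t w\<close> every associator contains \<open>t\<close> and \<open>w\<close>; its
  value at \<open>t, w, z, y\<close> reduces to \<open>- (w, z, y) t\<close>, and \<open>t\<close> can be cancelled.
\<close>

lemma right_inverse_of_associating:
  assumes two: "\<And>q. \<lbrakk>q \<in> carrier A; q \<oplus> q = \<zero>\<rbrakk> \<Longrightarrow> q = \<zero>"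
    and c: "t \<in> carrier A" "w \<in> carrier A" "z \<in> carrier A" and tw: "t \<otimes> w = \<one>" "w \<otimes> t = \<one>"
    and t: "t \<in> associating z" "z \<otimes> t = t \<otimes> z"
  shows "w \<in> associating z" "z \<otimes> w = w \<otimes> z"
proof -
  have wt: "w \<in> associating t" using right_inverse_associating[OF two] c tw by simp
  have one: "associator A \<one> u v = \<zero>" if "u \<in> carrier A" "v \<in> carrier A" for u v
    using that by (simp add: associator_def minus_eq r_neg)
  have "associator A w z y = \<zero>" if y: "y \<in> carrier A" for y
  proof -
    have "bruck_kleinfeld z y t w = \<zero>"
      using associatingD[OF wt] c y by (simp add: bruck_kleinfeld_def minus_eq)
    then have "bruck_kleinfeld t w z y = \<zero>"
      using bruck_kleinfeld_swap_pairs[of t w z y] c y by simp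
    then have "\<ominus> (associator A w z y \<otimes> t) = \<zero>"
      using associatingD(7)[OF t(1)] c y by (simp add: bruck_kleinfeld_def tw one minus_eq)
    then have "associator A w z y \<otimes> t = \<zero>"
      using c y by (metis associator_closed m_closed minus_minus minus_zero)
    moreover have "(associator A w z y \<otimes> t) \<otimes> w = associator A w z y"
      using associating_assoc(3)[OF wt, of "associator A w z y"] c y by (simp add: tw)
    ultimately show ?thesis using c y by simp
  qed
  then have "z \<in> associating w" using c by (simp add: associating_def)
  then show wz: "w \<in> associating z" using associating_sym c by simp
  have "z \<otimes> w = (w \<otimes> t) \<otimes> (z \<otimes> w)" using c tw by simp
  also have "\<dots> = w \<otimes> (t \<otimes> (z \<otimes> w))" using associating_assoc(6)[OF wt] c by simp
  also have "t \<otimes> (z \<otimes> w) = z" 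
    using associating_assoc(6)[OF t(1), of w] associating_assoc(1)[OF t(1), of w] c tw t(2) by simp
  finally show "z \<otimes> w = w \<otimes> z" .
qed

end

section \<open>The Cayley--Dickson process\<close>

sublocale nonassoc_algebra \<subseteq> N: nonassoc_ring A
  by unfold_locales (simp_all add: mult_closed one_closed one_left one_right distrib_left distrib_right)

lemma (in nonassoc_algebra) smult_minus_right:
  assumes "c \<in> carrier R" "x \<in> carrier A"
  shows "c \<odot>\<^bsub>A\<^esub> (\<ominus>\<^bsub>A\<^esub> x) = \<ominus>\<^bsub>A\<^esub> (c \<odot>\<^bsub>A\<^esub> x)"
proof -
  have "c \<odot>\<^bsub>A\<^esub> (\<ominus>\<^bsub>A\<^esub> x) \<oplus>\<^bsub>A\<^esub> c \<odot>\<^bsub>A\<^esub> x = \<zero>\<^bsub>A\<^esub>"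
    using assms by (simp add: smult_r_distr[symmetric] M.l_neg)
  then show ?thesis using assms by (simp add: M.minus_equality)
qed

lemmas (in nonassoc_algebra) nonassoc_algebra_simprules
  [algebra nonassoc_algebra "zero A" "add A" "a_inv A" "a_minus A" "one A" "mult A" "smult A"] =
  N.nonassoc_ring_simprules smult_closed smult_r_distr smult_mult_left smult_mult_right smult_minus_right

sublocale alternative_algebra \<subseteq> N: alternative_ring A
  by unfold_locales (simp_all add: left_alternative right_alternative)

text \<open>
  Algebras with a scalar involution. The trace is required to be scalar as well; since
  \<open>b + b\<^sup>* = (1 + b) (1 + b)\<^sup>* - 1 - b b\<^sup>*\<close>, this is part of the usual notion.
\<close>

locale involutive_algebra = nonassoc_algebra K B for K (structure) and B (structure) +
  fixes star
  assumes star_closed [simp, intro]: "x \<in> carrier B \<Longrightarrow> star x \<in> carrier B"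
    and star_add: "\<lbrakk>x \<in> carrier B; y \<in> carrier B\<rbrakk> \<Longrightarrow> star (x \<oplus>\<^bsub>B\<^esub> y) = star x \<oplus>\<^bsub>B\<^esub> star y"
    and star_smult: "\<lbrakk>c \<in> carrier K; x \<in> carrier B\<rbrakk> \<Longrightarrow> star (c \<odot>\<^bsub>B\<^esub> x) = c \<odot>\<^bsub>B\<^esub> star x"
    and star_mult: "\<lbrakk>x \<in> carrier B; y \<in> carrier B\<rbrakk> \<Longrightarrow> star (x \<otimes>\<^bsub>B\<^esub> y) = star y \<otimes>\<^bsub>B\<^esub> star x"
    and star_star [simp]: "x \<in> carrier B \<Longrightarrow> star (star x) = x"
    and trace_scalar: "x \<in> carrier B \<Longrightarrow> \<exists>c\<in>carrier K. x \<oplus>\<^bsub>B\<^esub> star x = c \<odot>\<^bsub>B\<^esub> \<one>\<^bsub>B\<^esub>"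
    and norm_scalar: "x \<in> carrier B \<Longrightarrow> \<exists>c\<in>carrier K. x \<otimes>\<^bsub>B\<^esub> star x = c \<odot>\<^bsub>B\<^esub> \<one>\<^bsub>B\<^esub>"
begin

lemma star_one [simp]: "star \<one>\<^bsub>B\<^esub> = \<one>\<^bsub>B\<^esub>"
  using star_mult[of "star \<one>\<^bsub>B\<^esub>" "\<one>\<^bsub>B\<^esub>"] by simp

lemma star_zero [simp]: "star \<zero>\<^bsub>B\<^esub> = \<zero>\<^bsub>B\<^esub>"
  using star_smult[of \<zero> "\<zero>\<^bsub>B\<^esub>"] by simp

lemma star_minus: "x \<in> carrier B \<Longrightarrow> star (\<ominus>\<^bsub>B\<^esub> x) = \<ominus>\<^bsub>B\<^esub> star x"
  using star_add[of "\<ominus>\<^bsub>B\<^esub> x" x] by (simp add: M.l_neg M.minus_equality)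

lemma smult_one_mult:
  "\<lbrakk>c \<in> carrier K; x \<in> carrier B\<rbrakk> \<Longrightarrow> (c \<odot>\<^bsub>B\<^esub> \<one>\<^bsub>B\<^esub>) \<otimes>\<^bsub>B\<^esub> x = c \<odot>\<^bsub>B\<^esub> x"
  "\<lbrakk>c \<in> carrier K; x \<in> carrier B\<rbrakk> \<Longrightarrow> x \<otimes>\<^bsub>B\<^esub> (c \<odot>\<^bsub>B\<^esub> \<one>\<^bsub>B\<^esub>) = c \<odot>\<^bsub>B\<^esub> x"
  by (simp_all add: smult_mult_left smult_mult_right)

end

lemma cayley_dickson_simps [simp]:
  "carrier (cayley_dickson B star \<mu>) = carrier B \<times> carrier B"
  "(a, b) \<otimes>\<^bsub>cayley_dickson B star \<mu>\<^esub> (c, d) =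
    (a \<otimes>\<^bsub>B\<^esub> c \<oplus>\<^bsub>B\<^esub> \<mu> \<odot>\<^bsub>B\<^esub> (d \<otimes>\<^bsub>B\<^esub> star b), star a \<otimes>\<^bsub>B\<^esub> d \<oplus>\<^bsub>B\<^esub> c \<otimes>\<^bsub>B\<^esub> b)"
  "\<one>\<^bsub>cayley_dickson B star \<mu>\<^esub> = (\<one>\<^bsub>B\<^esub>, \<zero>\<^bsub>B\<^esub>)"
  "\<zero>\<^bsub>cayley_dickson B star \<mu>\<^esub> = (\<zero>\<^bsub>B\<^esub>, \<zero>\<^bsub>B\<^esub>)"
  "(a, b) \<oplus>\<^bsub>cayley_dickson B star \<mu>\<^esub> (c, d) = (a \<oplus>\<^bsub>B\<^esub> c, b \<oplus>\<^bsub>B\<^esub> d)"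
  "r \<odot>\<^bsub>cayley_dickson B star \<mu>\<^esub> (a, b) = (r \<odot>\<^bsub>B\<^esub> a, r \<odot>\<^bsub>B\<^esub> b)"
  by (simp_all add: cayley_dickson_def)

lemma cd_star_simp [simp]: "cd_star B star (a, b) = (star a, \<ominus>\<^bsub>B\<^esub> b)"
  by (simp add: cd_star_def)

context involutive_algebra
begin

lemma cayley_dickson_nonassoc:
  assumes \<mu>: "\<mu> \<in> carrier K"
  shows "nonassoc_algebra K (cayley_dickson B star \<mu>)"
proof -
  let ?C = "cayley_dickson B star \<mu>"
  interpret C: abelian_group ?C
  proof (rule abelian_groupI)
    fix x assume "x \<in> carrier ?C"
    then show "\<exists>y\<in>carrier ?C. y \<oplus>\<^bsub>?C\<^esub> x = \<zero>\<^bsub>?C\<^esub>"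
      by (intro bexI[of _ "(\<ominus>\<^bsub>B\<^esub> fst x, \<ominus>\<^bsub>B\<^esub> snd x)"]) (auto simp: M.l_neg)
  qed (auto simp: M.a_ac)
  show ?thesis
  proof (intro nonassoc_algebra.intro module.intro nonassoc_algebra_axioms.intro module_axioms.intro)
    show "cring K" ..
    show "abelian_group ?C" ..
  qed (use \<mu> in \<open>auto simp: smult_l_distr smult_r_distr smult_assoc1 star_add star_mult star_smult
      N.l_distr N.r_distr M.a_ac smult_mult_left smult_mult_right\<close>,
      (simp_all add: R.m_comm flip: smult_assoc1)?)
qed

lemma cayley_dickson_minus:
  assumes \<mu>: "\<mu> \<in> carrier K" and "a \<in> carrier B" "b \<in> carrier B"
  shows "\<ominus>\<^bsub>cayley_dickson B star \<mu>\<^esub> (a, b) = (\<ominus>\<^bsub>B\<^esub> a, \<ominus>\<^bsub>B\<^esub> b)"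
proof -
  interpret C: nonassoc_algebra K "cayley_dickson B star \<mu>" by (rule cayley_dickson_nonassoc[OF \<mu>])
  show ?thesis using assms by (intro C.M.minus_equality) (auto simp: M.l_neg)
qed

text \<open>
  \<open>x\<close> commutes with its scalar trace \<open>x + x\<^sup>*\<close>, hence with \<open>x\<^sup>*\<close>.
\<close>

lemma trace_commute:
  assumes "x \<in> carrier B"
  shows "star x \<otimes>\<^bsub>B\<^esub> x = x \<otimes>\<^bsub>B\<^esub> star x"
proof -
  obtain c where c: "c \<in> carrier K" "x \<oplus>\<^bsub>B\<^esub> star x = c \<odot>\<^bsub>B\<^esub> \<one>\<^bsub>B\<^esub>" using trace_scalar assms by blast
  have "x \<otimes>\<^bsub>B\<^esub> x \<oplus>\<^bsub>B\<^esub> star x \<otimes>\<^bsub>B\<^esub> x = (x \<oplus>\<^bsub>B\<^esub> star x) \<otimes>\<^bsub>B\<^esub> x" using assms by (simp add: N.l_distr)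
  also have "\<dots> = x \<otimes>\<^bsub>B\<^esub> (x \<oplus>\<^bsub>B\<^esub> star x)" using c assms by (simp add: smult_one_mult)
  also have "\<dots> = x \<otimes>\<^bsub>B\<^esub> x \<oplus>\<^bsub>B\<^esub> x \<otimes>\<^bsub>B\<^esub> star x" using assms by (simp add: N.r_distr)
  finally show ?thesis using assms by simp
qed

lemma cayley_dickson_involutive:
  assumes \<mu>: "\<mu> \<in> carrier K"
  shows "involutive_algebra K (cayley_dickson B star \<mu>) (cd_star B star)"
proof -
  let ?C = "cayley_dickson B star \<mu>"
  interpret C: nonassoc_algebra K ?C by (rule cayley_dickson_nonassoc[OF \<mu>])
  show ?thesis
  proof unfold_locales
    fix x assume x: "x \<in> carrier ?C"
    then obtain a b where ab: "x = (a, b)" "a \<in> carrier B" "b \<in> carrier B" by auto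
    show "cd_star B star x \<in> carrier ?C" "cd_star B star (cd_star B star x) = x" using ab by simp_all
    obtain t where t: "t \<in> carrier K" "a \<oplus>\<^bsub>B\<^esub> star a = t \<odot>\<^bsub>B\<^esub> \<one>\<^bsub>B\<^esub>" using trace_scalar ab by blast
    obtain n where n: "n \<in> carrier K" "a \<otimes>\<^bsub>B\<^esub> star a = n \<odot>\<^bsub>B\<^esub> \<one>\<^bsub>B\<^esub>" using norm_scalar ab by blast
    obtain m where m: "m \<in> carrier K" "b \<otimes>\<^bsub>B\<^esub> star b = m \<odot>\<^bsub>B\<^esub> \<one>\<^bsub>B\<^esub>" using norm_scalar ab by blast
    show "\<exists>c\<in>carrier K. x \<oplus>\<^bsub>?C\<^esub> cd_star B star x = c \<odot>\<^bsub>?C\<^esub> \<one>\<^bsub>?C\<^esub>"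
      using t ab by (intro bexI[of _ t]) (simp_all add: M.r_neg)
    have "n \<odot>\<^bsub>B\<^esub> \<one>\<^bsub>B\<^esub> \<oplus>\<^bsub>B\<^esub> \<mu> \<odot>\<^bsub>B\<^esub> (\<ominus>\<^bsub>B\<^esub> b \<otimes>\<^bsub>B\<^esub> star b) = (n \<ominus> \<mu> \<otimes> m) \<odot>\<^bsub>B\<^esub> \<one>\<^bsub>B\<^esub>"
      using ab m n \<mu>
      by (simp add: N.l_minus smult_minus_right smult_l_distr smult_l_minus smult_assoc1 R.minus_eq)
    then show "\<exists>c\<in>carrier K. x \<otimes>\<^bsub>?C\<^esub> cd_star B star x = c \<odot>\<^bsub>?C\<^esub> \<one>\<^bsub>?C\<^esub>"
      using n m ab \<mu> by (intro bexI[of _ "n \<ominus> \<mu> \<otimes> m"]) (simp_all add: N.r_minus M.l_neg)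
    fix c assume "c \<in> carrier K"
    then show "cd_star B star (c \<odot>\<^bsub>?C\<^esub> x) = c \<odot>\<^bsub>?C\<^esub> cd_star B star x"
      using ab by (simp add: star_smult smult_minus_right)
  next
    fix x y assume "x \<in> carrier ?C" "y \<in> carrier ?C"
    then show "cd_star B star (x \<oplus>\<^bsub>?C\<^esub> y) = cd_star B star x \<oplus>\<^bsub>?C\<^esub> cd_star B star y"
        "cd_star B star (x \<otimes>\<^bsub>?C\<^esub> y) = cd_star B star y \<otimes>\<^bsub>?C\<^esub> cd_star B star x"
      using \<mu> by (auto simp: star_add M.minus_add star_mult star_smult star_minus N.l_minus N.r_minus M.a_comm)
  qed
qed

text \<open>
  The involution exchanges the two alternative laws.
\<close>

lemma alternative_if_left_alternative:
  assumes left: "\<And>x y. \<lbrakk>x \<in> carrier B; y \<in> carrier B\<rbrakk> \<Longrightarrow> (x \<otimes>\<^bsub>B\<^esub> x) \<otimes>\<^bsub>B\<^esub> y = x \<otimes>\<^bsub>B\<^esub> (x \<otimes>\<^bsub>B\<^esub> y)"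
  shows "alternative_algebra K B"
proof unfold_locales
  fix x y assume xy: "x \<in> carrier B" "y \<in> carrier B"
  show "associator B x x y = \<zero>\<^bsub>B\<^esub>"
    using left xy by (simp add: associator_def N.diff_eq_zero_iff)
  have "star ((y \<otimes>\<^bsub>B\<^esub> x) \<otimes>\<^bsub>B\<^esub> x) = star (y \<otimes>\<^bsub>B\<^esub> (x \<otimes>\<^bsub>B\<^esub> x))"
    using left xy by (simp add: star_mult)
  then have "(y \<otimes>\<^bsub>B\<^esub> x) \<otimes>\<^bsub>B\<^esub> x = y \<otimes>\<^bsub>B\<^esub> (x \<otimes>\<^bsub>B\<^esub> x)"
    using xy by (metis star_star mult_closed)
  then show "associator B y x x = \<zero>\<^bsub>B\<^esub>"
    using xy by (simp add: associator_def N.diff_eq_zero_iff)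
qed

lemma ring_if_assoc:
  assumes "\<And>x y z. \<lbrakk>x \<in> carrier B; y \<in> carrier B; z \<in> carrier B\<rbrakk> \<Longrightarrow> (x \<otimes>\<^bsub>B\<^esub> y) \<otimes>\<^bsub>B\<^esub> z = x \<otimes>\<^bsub>B\<^esub> (y \<otimes>\<^bsub>B\<^esub> z)"
  shows "ring B"
  by (rule ringI) (use assms in \<open>auto intro!: monoidI M.abelian_group_axioms simp: N.l_distr N.r_distr\<close>)

end

lemma (in involutive_algebra) cayley_dickson_assoc:
  assumes \<mu>: "\<mu> \<in> carrier K" and B: "cring B"
  shows "ring (cayley_dickson B star \<mu>)"
proof -
  interpret C: involutive_algebra K "cayley_dickson B star \<mu>" "cd_star B star"
    by (rule cayley_dickson_involutive[OF \<mu>])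
  interpret B: cring B by (rule B)
  define m where "m = \<mu> \<odot>\<^bsub>B\<^esub> \<one>\<^bsub>B\<^esub>"
  have m: "m \<in> carrier B" "star m = m" using \<mu> by (simp_all add: m_def star_smult)
  have \<mu>m: "\<mu> \<odot>\<^bsub>B\<^esub> x = m \<otimes>\<^bsub>B\<^esub> x" if "x \<in> carrier B" for x
    using \<mu> that by (simp add: m_def smult_one_mult)
  show ?thesis
  proof (rule C.ring_if_assoc)
    fix x y z assume "x \<in> carrier (cayley_dickson B star \<mu>)" "y \<in> carrier (cayley_dickson B star \<mu>)"
      "z \<in> carrier (cayley_dickson B star \<mu>)"
    then obtain a b c d e f where
      xyz: "x = (a, b)" "y = (c, d)" "z = (e, f)" and
      car: "a \<in> carrier B" "b \<in> carrier B" "c \<in> carrier B" "d \<in> carrier B" "e \<in> carrier B" "f \<in> carrier B"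
      by auto
    have s: "star a \<in> carrier B" "star b \<in> carrier B" "star c \<in> carrier B" "star d \<in> carrier B"
       using car by auto
    have 1: "(a \<otimes>\<^bsub>B\<^esub> c \<oplus>\<^bsub>B\<^esub> m \<otimes>\<^bsub>B\<^esub> (d \<otimes>\<^bsub>B\<^esub> star b)) \<otimes>\<^bsub>B\<^esub> e \<oplus>\<^bsub>B\<^esub> m \<otimes>\<^bsub>B\<^esub> (f \<otimes>\<^bsub>B\<^esub> (star d \<otimes>\<^bsub>B\<^esub> a \<oplus>\<^bsub>B\<^esub> star b \<otimes>\<^bsub>B\<^esub> star c))
       = a \<otimes>\<^bsub>B\<^esub> (c \<otimes>\<^bsub>B\<^esub> e \<oplus>\<^bsub>B\<^esub> m \<otimes>\<^bsub>B\<^esub> (f \<otimes>\<^bsub>B\<^esub> star d)) \<oplus>\<^bsub>B\<^esub> m \<otimes>\<^bsub>B\<^esub> ((star c \<otimes>\<^bsub>B\<^esub> f \<oplus>\<^bsub>B\<^esub> e \<otimes>\<^bsub>B\<^esub> d) \<otimes>\<^bsub>B\<^esub> star b)"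
      using car s m(1) by algebra
    have 2: "(star c \<otimes>\<^bsub>B\<^esub> star a \<oplus>\<^bsub>B\<^esub> (b \<otimes>\<^bsub>B\<^esub> star d) \<otimes>\<^bsub>B\<^esub> m) \<otimes>\<^bsub>B\<^esub> f \<oplus>\<^bsub>B\<^esub> e \<otimes>\<^bsub>B\<^esub> (star a \<otimes>\<^bsub>B\<^esub> d \<oplus>\<^bsub>B\<^esub> c \<otimes>\<^bsub>B\<^esub> b)
       = star a \<otimes>\<^bsub>B\<^esub> (star c \<otimes>\<^bsub>B\<^esub> f \<oplus>\<^bsub>B\<^esub> e \<otimes>\<^bsub>B\<^esub> d) \<oplus>\<^bsub>B\<^esub> (c \<otimes>\<^bsub>B\<^esub> e \<oplus>\<^bsub>B\<^esub> m \<otimes>\<^bsub>B\<^esub> (f \<otimes>\<^bsub>B\<^esub> star d)) \<otimes>\<^bsub>B\<^esub> b"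
      using car s m(1) by algebra
    show "(x \<otimes>\<^bsub>cayley_dickson B star \<mu>\<^esub> y) \<otimes>\<^bsub>cayley_dickson B star \<mu>\<^esub> z
        = x \<otimes>\<^bsub>cayley_dickson B star \<mu>\<^esub> (y \<otimes>\<^bsub>cayley_dickson B star \<mu>\<^esub> z)"
      using car m 1 2 by (simp add: xyz \<mu>m star_add star_mult)
  qed
qed

lemma (in involutive_algebra) cayley_dickson_comm:
  assumes \<mu>: "\<mu> \<in> carrier K" and B: "cring B" and star: "\<And>x. x \<in> carrier B \<Longrightarrow> star x = x"
  shows "cring (cayley_dickson B star \<mu>)"
proof -
  interpret B: cring B by (rule B)
  interpret C: ring "cayley_dickson B star \<mu>" by (rule cayley_dickson_assoc[OF \<mu> B])
  have "x \<otimes>\<^bsub>cayley_dickson B star \<mu>\<^esub> y = y \<otimes>\<^bsub>cayley_dickson B star \<mu>\<^esub> x"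
    if "x \<in> carrier (cayley_dickson B star \<mu>)" "y \<in> carrier (cayley_dickson B star \<mu>)" for x y
    using that by (auto simp: B.m_comm star M.a_comm)
  then show ?thesis by (intro cring.intro C.ring_axioms C.monoid_comm_monoidI)
qed

text \<open>
  As \<open>B\<close> is associative, the two sides of the left alternative law for \<open>(a, b)\<close> agree up to moving the
  trace of \<open>a\<close> and the norm of \<open>b\<close> past other factors, and these are scalars. The right law follows
  by the involution.
\<close>

lemma (in involutive_algebra) cayley_dickson_alternative:
  assumes \<mu>: "\<mu> \<in> carrier K" and B: "ring B"
  shows "alternative_algebra K (cayley_dickson B star \<mu>)"
proof -
  let ?C = "cayley_dickson B star \<mu>"
  interpret C: involutive_algebra K ?C "cd_star B star"
    by (rule cayley_dickson_involutive[OF \<mu>])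
  interpret B: ring B by (rule B)
  show ?thesis
  proof (rule C.alternative_if_left_alternative)
    fix x y assume "x \<in> carrier ?C" "y \<in> carrier ?C"
    then obtain a b c d where
      xy: "x = (a, b)" "y = (c, d)" and
      car: "a \<in> carrier B" "b \<in> carrier B" "c \<in> carrier B" "d \<in> carrier B"
      by auto
    note sc = car[THEN star_closed]
    obtain t where t: "t \<in> carrier K" "a \<oplus>\<^bsub>B\<^esub> star a = t \<odot>\<^bsub>B\<^esub> \<one>\<^bsub>B\<^esub>" using trace_scalar car by blast
    obtain n where n: "n \<in> carrier K" "b \<otimes>\<^bsub>B\<^esub> star b = n \<odot>\<^bsub>B\<^esub> \<one>\<^bsub>B\<^esub>" using norm_scalar car by blast
    have n': "star b \<otimes>\<^bsub>B\<^esub> b = n \<odot>\<^bsub>B\<^esub> \<one>\<^bsub>B\<^esub>" using trace_commute car n by simp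
    have tr: "a \<otimes>\<^bsub>B\<^esub> x \<oplus>\<^bsub>B\<^esub> star a \<otimes>\<^bsub>B\<^esub> x = t \<odot>\<^bsub>B\<^esub> x" 
        "star a \<otimes>\<^bsub>B\<^esub> x \<oplus>\<^bsub>B\<^esub> a \<otimes>\<^bsub>B\<^esub> x = t \<odot>\<^bsub>B\<^esub> x" if "x \<in> carrier B" for x
      using that t car smult_one_mult(1)[OF t(1), of x] N.l_distr[of a "star a" x]
      by (simp_all add: M.a_comm)
    have tr': "star b \<otimes>\<^bsub>B\<^esub> a \<oplus>\<^bsub>B\<^esub> star b \<otimes>\<^bsub>B\<^esub> star a = t \<odot>\<^bsub>B\<^esub> star b"
      using t car smult_one_mult(2)[OF t(1), of "star b"] N.r_distr[of a "star a" "star b"] by simp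
    have sq: "x \<otimes>\<^bsub>?C\<^esub> x = (a \<otimes>\<^bsub>B\<^esub> a \<oplus>\<^bsub>B\<^esub> (\<mu> \<otimes> n) \<odot>\<^bsub>B\<^esub> \<one>\<^bsub>B\<^esub>, t \<odot>\<^bsub>B\<^esub> b)"
      using car n t \<mu> tr(2)[of b] by (simp add: xy smult_assoc1)
    have "(x \<otimes>\<^bsub>?C\<^esub> x) \<otimes>\<^bsub>?C\<^esub> y
      = (a \<otimes>\<^bsub>B\<^esub> (a \<otimes>\<^bsub>B\<^esub> c) \<oplus>\<^bsub>B\<^esub> \<mu> \<odot>\<^bsub>B\<^esub> (n \<odot>\<^bsub>B\<^esub> c) \<oplus>\<^bsub>B\<^esub> \<mu> \<odot>\<^bsub>B\<^esub> (t \<odot>\<^bsub>B\<^esub> (d \<otimes>\<^bsub>B\<^esub> star b)),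
         star a \<otimes>\<^bsub>B\<^esub> (star a \<otimes>\<^bsub>B\<^esub> d) \<oplus>\<^bsub>B\<^esub> \<mu> \<odot>\<^bsub>B\<^esub> (n \<odot>\<^bsub>B\<^esub> d) \<oplus>\<^bsub>B\<^esub> t \<odot>\<^bsub>B\<^esub> (c \<otimes>\<^bsub>B\<^esub> b))"
      unfolding sq using car n(1) t(1) \<mu>
      by (simp add: xy star_add star_mult star_smult smult_mult_left smult_mult_right N.l_distr smult_assoc1 B.m_assoc)
    moreover have "x \<otimes>\<^bsub>?C\<^esub> (x \<otimes>\<^bsub>?C\<^esub> y) = 
      (a \<otimes>\<^bsub>B\<^esub> (a \<otimes>\<^bsub>B\<^esub> c) \<oplus>\<^bsub>B\<^esub> \<mu> \<odot>\<^bsub>B\<^esub> (n \<odot>\<^bsub>B\<^esub> c) \<oplus>\<^bsub>B\<^esub> \<mu> \<odot>\<^bsub>B\<^esub> (t \<odot>\<^bsub>B\<^esub> (d \<otimes>\<^bsub>B\<^esub> star b)),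
         star a \<otimes>\<^bsub>B\<^esub> (star a \<otimes>\<^bsub>B\<^esub> d) \<oplus>\<^bsub>B\<^esub> \<mu> \<odot>\<^bsub>B\<^esub> (n \<odot>\<^bsub>B\<^esub> d) \<oplus>\<^bsub>B\<^esub> t \<odot>\<^bsub>B\<^esub> (c \<otimes>\<^bsub>B\<^esub> b))"
    proof -
      have "x \<otimes>\<^bsub>?C\<^esub> (x \<otimes>\<^bsub>?C\<^esub> y) = 
        (a \<otimes>\<^bsub>B\<^esub> (a \<otimes>\<^bsub>B\<^esub> c) \<oplus>\<^bsub>B\<^esub> \<mu> \<odot>\<^bsub>B\<^esub> (c \<otimes>\<^bsub>B\<^esub> (b \<otimes>\<^bsub>B\<^esub> star b)) \<oplus>\<^bsub>B\<^esub> \<mu> \<odot>\<^bsub>B\<^esub> (a \<otimes>\<^bsub>B\<^esub> (d \<otimes>\<^bsub>B\<^esub> star b) \<oplus>\<^bsub>B\<^esub> star a \<otimes>\<^bsub>B\<^esub> (d \<otimes>\<^bsub>B\<^esub> star b)),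
         star a \<otimes>\<^bsub>B\<^esub> (star a \<otimes>\<^bsub>B\<^esub> d) \<oplus>\<^bsub>B\<^esub> \<mu> \<odot>\<^bsub>B\<^esub> (d \<otimes>\<^bsub>B\<^esub> (star b \<otimes>\<^bsub>B\<^esub> b)) \<oplus>\<^bsub>B\<^esub> (a \<otimes>\<^bsub>B\<^esub> (c \<otimes>\<^bsub>B\<^esub> b) \<oplus>\<^bsub>B\<^esub> star a \<otimes>\<^bsub>B\<^esub> (c \<otimes>\<^bsub>B\<^esub> b)))"
        using car \<mu>
        by (simp add: xy N.l_distr N.r_distr smult_r_distr smult_mult_left smult_mult_right B.m_assoc M.a_ac)
      then show ?thesis
        using car t(1) n(1) \<mu> by (simp add: tr n(2) n' smult_mult_right)
    qed
    ultimately show "(x \<otimes>\<^bsub>?C\<^esub> x) \<otimes>\<^bsub>?C\<^esub> y = x \<otimes>\<^bsub>?C\<^esub> (x \<otimes>\<^bsub>?C\<^esub> y)" by simp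
  qed
qed

lemma ring_as_algebra_simps [simp]:
  "carrier (ring_as_algebra K) = carrier K" "mult (ring_as_algebra K) = mult K"
  "one (ring_as_algebra K) = one K" "zero (ring_as_algebra K) = zero K"
  "add (ring_as_algebra K) = add K" "smult (ring_as_algebra K) = mult K"
  by (simp_all add: ring_as_algebra_def)

lemma ring_as_algebra_cring:
  fixes K (structure)
  assumes "cring K" shows "cring (ring_as_algebra K)"
proof -
  interpret cring K by fact
  show ?thesis
    by (rule cringI, rule abelian_groupI) 
      (auto intro!: comm_monoidI simp: a_ac m_ac l_distr r_distr intro: l_neg bexI[of _ "\<ominus> x" for x])
qed

lemma ring_as_algebra_involutive:
  fixes K (structure)
  assumes "cring K" shows "involutive_algebra K (ring_as_algebra K) (\<lambda>x. x)"
proof -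
  interpret K: cring K by fact
  interpret A: cring "ring_as_algebra K" by (rule ring_as_algebra_cring[OF assms])
  show ?thesis
    by (intro involutive_algebra.intro nonassoc_algebra.intro module.intro nonassoc_algebra_axioms.intro
        module_axioms.intro involutive_algebra_axioms.intro assms A.is_abelian_group)
      (auto simp: K.m_ac K.l_distr K.r_distr intro: bexI[of _ "x \<oplus> x" for x] bexI[of _ "x \<otimes> x" for x])
qed

lemma cd1_involutive:
  assumes "cring K" "\<mu>1 \<in> carrier K"
  shows "involutive_algebra K (cd1 K \<mu>1) (cd1_star K)" "cring (cd1 K \<mu>1)"
proof -
  interpret involutive_algebra K "ring_as_algebra K" "\<lambda>x. x"
    by (rule ring_as_algebra_involutive[OF assms(1)])
  show "involutive_algebra K (cd1 K \<mu>1) (cd1_star K)"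
    unfolding cd1_def cd1_star_def by (rule cayley_dickson_involutive[OF assms(2)])
  show "cring (cd1 K \<mu>1)"
    unfolding cd1_def by (rule cayley_dickson_comm[OF assms(2) ring_as_algebra_cring[OF assms(1)] HOL.refl])
qed

lemma cd2_involutive:
  assumes "cring K" "\<mu>1 \<in> carrier K" "\<mu>2 \<in> carrier K"
  shows "involutive_algebra K (cd2 K \<mu>1 \<mu>2) (cd2_star K \<mu>1)" "ring (cd2 K \<mu>1 \<mu>2)"
proof -
  interpret involutive_algebra K "cd1 K \<mu>1" "cd1_star K"
    by (rule cd1_involutive(1)[OF assms(1,2)])
  show "involutive_algebra K (cd2 K \<mu>1 \<mu>2) (cd2_star K \<mu>1)"
    unfolding cd2_def cd2_star_def by (rule cayley_dickson_involutive[OF assms(3)])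
  show "ring (cd2 K \<mu>1 \<mu>2)"
    unfolding cd2_def by (rule cayley_dickson_assoc[OF assms(3) cd1_involutive(2)[OF assms(1,2)]])
qed

lemma octonion_alternative:
  assumes "cring K" "\<mu>1 \<in> carrier K" "\<mu>2 \<in> carrier K" "\<mu>3 \<in> carrier K"
  shows "alternative_algebra K (octonion_algebra K \<mu>1 \<mu>2 \<mu>3)"
proof -
  interpret involutive_algebra K "cd2 K \<mu>1 \<mu>2" "cd2_star K \<mu>1"
    by (rule cd2_involutive(1)[OF assms(1-3)])
  show ?thesis
    unfolding octonion_algebra_def by (rule cayley_dickson_alternative[OF assms(4) cd2_involutive(2)[OF assms(1-3)]])
qed

context alternative_ring
begin

section \<open>Homomorphisms out of an octonion algebra\<close>

text \<open>
  The hypothesis that is propagated through the doublings: a multiplicative map whose traces are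
  central in \<open>A\<close>.
\<close>

definition star_hom :: "('s, 't) ring_scheme \<Rightarrow> ('s \<Rightarrow> 's) \<Rightarrow> ('s \<Rightarrow> 'a) \<Rightarrow> bool" where
  "star_hom B star \<phi> \<longleftrightarrow> \<phi> \<in> ring_hom B A \<and> (\<forall>x\<in>carrier B. \<phi> x \<oplus> \<phi> (star x) \<in> alg_center A)"

definition cd_lift :: "'a \<Rightarrow> ('s \<Rightarrow> 'a) \<Rightarrow> 's \<times> 's \<Rightarrow> 'a" where
  "cd_lift v \<phi> = (\<lambda>(a, b). \<phi> a \<oplus> v \<otimes> \<phi> b)"

lemma cd_lift_simp [simp]: "cd_lift v \<phi> (a, b) = \<phi> a \<oplus> v \<otimes> \<phi> b"
  by (simp add: cd_lift_def)

lemma ring_hom_zero_minus: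
  assumes B: "abelian_group B" and \<phi>: "\<phi> \<in> ring_hom B A"
  shows "\<phi> \<zero>\<^bsub>B\<^esub> = \<zero>" "x \<in> carrier B \<Longrightarrow> \<phi> (\<ominus>\<^bsub>B\<^esub> x) = \<ominus> \<phi> x"
proof -
  interpret B: abelian_group B by fact
  note c = ring_hom_closed[OF \<phi>]
  show z: "\<phi> \<zero>\<^bsub>B\<^esub> = \<zero>"
    using ring_hom_add[OF \<phi>, of "\<zero>\<^bsub>B\<^esub>" "\<zero>\<^bsub>B\<^esub>"] c by simp
  show "\<phi> (\<ominus>\<^bsub>B\<^esub> x) = \<ominus> \<phi> x" if "x \<in> carrier B"
    using ring_hom_add[OF \<phi>, of "\<ominus>\<^bsub>B\<^esub> x" x] that c z by (simp add: B.l_neg minus_equality)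
qed

text \<open>
  The rule \<open>a (v d) = v (a\<^sup>* d)\<close>: by the linearized left alternative law, \<open>a (v d) + v (a d)\<close> equals
  \<open>(a v + v a) d\<close>, where \<open>a v + v a\<close> is the central trace of \<open>a\<close> times \<open>v\<close>.
\<close>

lemma left_mult_twisted:
  assumes c: "a \<in> carrier A" "a' \<in> carrier A" "v \<in> carrier A" "d \<in> carrier A"
    and t: "a \<oplus> a' \<in> alg_center A" and va: "v \<otimes> a = a' \<otimes> v"
  shows "a \<otimes> (v \<otimes> d) = v \<otimes> (a' \<otimes> d)"
proof -
  have "a \<otimes> (v \<otimes> d) \<oplus> v \<otimes> (a \<otimes> d) = ((a \<oplus> a') \<otimes> v) \<otimes> d"
    using left_alternative_linearized[of a v d] c by (simp add: va l_distr)
  also have "\<dots> = v \<otimes> ((a \<oplus> a') \<otimes> d)"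
    using alg_center_assoc[OF t, of v d] c by simp
  also have "\<dots> = v \<otimes> (a' \<otimes> d) \<oplus> v \<otimes> (a \<otimes> d)"
    using c by (simp add: l_distr r_distr a_comm)
  finally show ?thesis using c by simp
qed

text \<open>
  The rule \<open>(v b) c = v (c b)\<close>, from the linearized right alternative law applied to \<open>b\<^sup>*\<close>, \<open>v\<close>, \<open>c\<close>. The
  hypothesis \<open>bc\<close> is the commutation rule of \<open>v\<close> with the product \<open>c b\<close>.
\<close>

lemma right_mult_twisted:
  assumes c: "b \<in> carrier A" "b' \<in> carrier A" "v \<in> carrier A" "c \<in> carrier A" "c' \<in> carrier A"
    and t: "c \<oplus> c' \<in> alg_center A" and vb: "v \<otimes> b = b' \<otimes> v" and vc: "v \<otimes> c = c' \<otimes> v"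
    and bc: "(b' \<otimes> c') \<otimes> v = v \<otimes> (c \<otimes> b)"
  shows "(v \<otimes> b) \<otimes> c = v \<otimes> (c \<otimes> b)"
proof -
  have "(b' \<otimes> v) \<otimes> c \<oplus> (b' \<otimes> c) \<otimes> v = b' \<otimes> ((c \<oplus> c') \<otimes> v)"
    using right_alternative_linearized[of v c b'] c by (simp add: vc l_distr a_comm)
  also have "\<dots> = (b' \<otimes> (c \<oplus> c')) \<otimes> v"
    using alg_center_assoc[OF t, of b' v] alg_center_comm[OF t, of b'] c by simp
  also have "\<dots> = (b' \<otimes> c') \<otimes> v \<oplus> (b' \<otimes> c) \<otimes> v"
    using c by (simp add: l_distr r_distr a_comm)
  finally show ?thesis using c by (simp add: vb bc)
qed

text \<open>
  The three mixed products of \<open>B \<oplus> vB\<close> are forced by \<open>v b = b\<^sup>* v\<close>: two by the preceding lemmas, and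
  \<open>(v b) (v d) = (v b) (d\<^sup>* v) = v ((b d\<^sup>*) v) = v\<^sup>2 (d b\<^sup>*)\<close> by the middle Moufang identity.
\<close>

lemma cd_lift_star_hom:
  assumes B: "involutive_algebra K B star" and \<phi>: "star_hom B star \<phi>" and \<mu>: "\<mu> \<in> carrier K"
    and v: "v \<in> carrier A"
    and vb: "\<And>b. b \<in> carrier B \<Longrightarrow> v \<otimes> \<phi> b = \<phi> (star b) \<otimes> v"
    and vv: "\<And>b. b \<in> carrier B \<Longrightarrow> \<phi> (\<mu> \<odot>\<^bsub>B\<^esub> b) = (v \<otimes> v) \<otimes> \<phi> b"
  shows "star_hom (cayley_dickson B star \<mu>) (cd_star B star) (cd_lift v \<phi>)"
proof -
  interpret B: involutive_algebra K B star by fact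
  have hom: "\<phi> \<in> ring_hom B A" and tr: "\<And>x. x \<in> carrier B \<Longrightarrow> \<phi> x \<oplus> \<phi> (star x) \<in> alg_center A"
    using \<phi> by (auto simp: star_hom_def)
  note [simp] = ring_hom_closed[OF hom] v
  have zm: "\<phi> \<zero>\<^bsub>B\<^esub> = \<zero>" "\<And>x. x \<in> carrier B \<Longrightarrow> \<phi> (\<ominus>\<^bsub>B\<^esub> x) = \<ominus> \<phi> x"
    using ring_hom_zero_minus[OF B.M.abelian_group_axioms hom] by auto
  have 1: "\<phi> a \<otimes> (v \<otimes> \<phi> d) = v \<otimes> \<phi> (star a \<otimes>\<^bsub>B\<^esub> d)" if "a \<in> carrier B" "d \<in> carrier B" for a d
    using left_mult_twisted[OF _ _ v _ tr[of a] vb[of a], of "\<phi> d"] that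
    by (simp add: ring_hom_mult[OF hom])
  have 2: "(v \<otimes> \<phi> b) \<otimes> \<phi> c = v \<otimes> \<phi> (c \<otimes>\<^bsub>B\<^esub> b)" if "b \<in> carrier B" "c \<in> carrier B" for b c
    using right_mult_twisted[OF _ _ v _ _ tr[of c] vb[of b] vb[of c]] vb[of "c \<otimes>\<^bsub>B\<^esub> b"] that
    by (simp add: ring_hom_mult[OF hom] B.star_mult)
  have 3: "(v \<otimes> \<phi> b) \<otimes> (v \<otimes> \<phi> d) = \<phi> (\<mu> \<odot>\<^bsub>B\<^esub> (d \<otimes>\<^bsub>B\<^esub> star b))" if "b \<in> carrier B" "d \<in> carrier B" for b d
  proof -
    have "(v \<otimes> \<phi> b) \<otimes> (v \<otimes> \<phi> d) = (v \<otimes> \<phi> b) \<otimes> (\<phi> (star d) \<otimes> v)" using vb that by simp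
    also have "\<dots> = v \<otimes> (\<phi> (b \<otimes>\<^bsub>B\<^esub> star d) \<otimes> v)"
      using middle_moufang[of v "\<phi> b" "\<phi> (star d)"] that by (simp add: ring_hom_mult[OF hom])
    also have "\<phi> (b \<otimes>\<^bsub>B\<^esub> star d) \<otimes> v = v \<otimes> \<phi> (d \<otimes>\<^bsub>B\<^esub> star b)"
      using vb[of "d \<otimes>\<^bsub>B\<^esub> star b"] that by (simp add: B.star_mult)
    also have "v \<otimes> (v \<otimes> \<phi> (d \<otimes>\<^bsub>B\<^esub> star b)) = \<phi> (\<mu> \<odot>\<^bsub>B\<^esub> (d \<otimes>\<^bsub>B\<^esub> star b))"
      using vv[of "d \<otimes>\<^bsub>B\<^esub> star b"] that by (simp add: left_alternative)
    finally show ?thesis .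
  qed
  have "cd_lift v \<phi> \<in> ring_hom (cayley_dickson B star \<mu>) A"
  proof (rule ring_hom_memI)
    fix x y assume "x \<in> carrier (cayley_dickson B star \<mu>)" "y \<in> carrier (cayley_dickson B star \<mu>)"
    then obtain a b c d where
      xy: "x = (a, b)" "y = (c, d)" and
      car: "a \<in> carrier B" "b \<in> carrier B" "c \<in> carrier B" "d \<in> carrier B"
      by auto
    show "cd_lift v \<phi> (x \<oplus>\<^bsub>cayley_dickson B star \<mu>\<^esub> y) = cd_lift v \<phi> x \<oplus> cd_lift v \<phi> y"
      using car by (simp add: xy ring_hom_add[OF hom] r_distr a_ac)
    have "(\<phi> a \<oplus> v \<otimes> \<phi> b) \<otimes> (\<phi> c \<oplus> v \<otimes> \<phi> d)
        = (\<phi> a \<otimes> \<phi> c \<oplus> (v \<otimes> \<phi> b) \<otimes> (v \<otimes> \<phi> d)) \<oplus> (\<phi> a \<otimes> (v \<otimes> \<phi> d) \<oplus> (v \<otimes> \<phi> b) \<otimes> \<phi> c)"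
      using car by (simp add: r_distr l_distr a_ac)
    also have "\<dots> = \<phi> (a \<otimes>\<^bsub>B\<^esub> c \<oplus>\<^bsub>B\<^esub> \<mu> \<odot>\<^bsub>B\<^esub> (d \<otimes>\<^bsub>B\<^esub> star b)) \<oplus> v \<otimes> \<phi> (star a \<otimes>\<^bsub>B\<^esub> d \<oplus>\<^bsub>B\<^esub> c \<otimes>\<^bsub>B\<^esub> b)"
      using car \<mu> by (simp only: 1 2 3) (simp add: ring_hom_add[OF hom] ring_hom_mult[OF hom] r_distr)
    finally show "cd_lift v \<phi> (x \<otimes>\<^bsub>cayley_dickson B star \<mu>\<^esub> y) = cd_lift v \<phi> x \<otimes> cd_lift v \<phi> y"
      by (simp add: xy)
  qed (auto simp: zm ring_hom_one[OF hom])
  moreover have "cd_lift v \<phi> x \<oplus> cd_lift v \<phi> (cd_star B star x) \<in> alg_center A"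
    if x: "x \<in> carrier (cayley_dickson B star \<mu>)" for x
  proof -
    obtain a b where ab: "x = (a, b)" "a \<in> carrier B" "b \<in> carrier B" using x by auto
    then have "cd_lift v \<phi> x \<oplus> cd_lift v \<phi> (cd_star B star x)
        = \<phi> a \<oplus> \<phi> (star a) \<oplus> (v \<otimes> \<phi> b \<oplus> \<ominus> (v \<otimes> \<phi> b))"
      by (simp add: zm r_minus a_ac)
    then show ?thesis using tr[of a] ab by (simp add: r_neg)
  qed
  ultimately show ?thesis by (simp add: star_hom_def)
qed

text \<open>
  The commutation rule \<open>v b = b\<^sup>* v\<close> has to be checked at each doubling. Since the coefficients are
  central, it reduces to \<open>v\<close> anticommuting with the products of distinct earlier generators; for
  \<open>v = c\<close> this includes \<open>b a\<close>, where the antiassociativity of the triple is used.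
\<close>

lemma octonion_lift:
  fixes K (structure)
  assumes K: "cring K" and \<mu>: "\<mu>1 \<in> carrier K" "\<mu>2 \<in> carrier K" "\<mu>3 \<in> carrier K"
    and abc: "cayley_triple a b c"
    and \<phi>: "\<phi> \<in> ring_hom K A" and center: "\<And>p. p \<in> carrier K \<Longrightarrow> \<phi> p \<in> alg_center A"
    and sq: "\<phi> \<mu>1 = a \<otimes>\<^bsub>A\<^esub> a" "\<phi> \<mu>2 = b \<otimes>\<^bsub>A\<^esub> b" "\<phi> \<mu>3 = c \<otimes>\<^bsub>A\<^esub> c"
  shows "cd_lift c (cd_lift b (cd_lift a \<phi>)) \<in> ring_hom (octonion_algebra K \<mu>1 \<mu>2 \<mu>3) A"
proof -
  note T = cayley_tripleD[OF abc]
  let ?\<phi>1 = "cd_lift a \<phi>" let ?\<phi>2 = "cd_lift b ?\<phi>1"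
  have K0: "involutive_algebra K (ring_as_algebra K) (\<lambda>x. x)" by (rule ring_as_algebra_involutive[OF K])
  interpret K: cring K by fact
  note [simp] = ring_hom_closed[OF \<phi>] T(1-3)
  note Z = alg_center_comm[OF center] alg_center_assoc[OF center]
  have minus: "\<phi> (\<ominus>\<^bsub>ring_as_algebra K\<^esub> x) = \<ominus>\<^bsub>A\<^esub> \<phi> x" if "x \<in> carrier K" for x
    using ring_hom_zero_minus(2)
      [OF involutive_algebra.axioms(1)[OF K0, THEN nonassoc_algebra.axioms(1), THEN module.axioms(2)], of \<phi> x]
      \<phi> that by (auto simp: ring_hom_def)
  have s0: "star_hom (ring_as_algebra K) (\<lambda>x. x) \<phi>"
    using \<phi> center by (auto simp: star_hom_def ring_hom_def intro!: alg_center_add)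
  have s1: "star_hom (cd1 K \<mu>1) (cd1_star K) ?\<phi>1"
    unfolding cd1_def cd1_star_def
    by (rule cd_lift_star_hom[OF K0 s0 \<mu>(1)]) (use \<mu> in \<open>auto simp: Z ring_hom_mult[OF \<phi>] sq\<close>)
  have comm1: "v \<otimes>\<^bsub>A\<^esub> ?\<phi>1 x = ?\<phi>1 (cd1_star K x) \<otimes>\<^bsub>A\<^esub> v"
    if v: "v \<in> carrier A" "v \<otimes>\<^bsub>A\<^esub> a = \<ominus>\<^bsub>A\<^esub> (a \<otimes>\<^bsub>A\<^esub> v)" and x0: "x \<in> carrier (cd1 K \<mu>1)" for v x
  proof -
    obtain p q where x: "x = (p, q)" "p \<in> carrier K" "q \<in> carrier K" using x0 by (auto simp: cd1_def)
    have "v \<otimes>\<^bsub>A\<^esub> ?\<phi>1 x = \<phi> p \<otimes>\<^bsub>A\<^esub> v \<oplus>\<^bsub>A\<^esub> \<phi> q \<otimes>\<^bsub>A\<^esub> (v \<otimes>\<^bsub>A\<^esub> a)"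
      using v x by (simp add: r_distr Z(1)[of p v] Z(1)[of q a] Z(3))
    also have "\<dots> = \<phi> p \<otimes>\<^bsub>A\<^esub> v \<oplus>\<^bsub>A\<^esub> (a \<otimes>\<^bsub>A\<^esub> \<ominus>\<^bsub>A\<^esub> \<phi> q) \<otimes>\<^bsub>A\<^esub> v"
      using v x by (simp add: v(2) r_minus l_minus Z(1)[of q a] Z(2))
    also have "\<dots> = ?\<phi>1 (cd1_star K x) \<otimes>\<^bsub>A\<^esub> v"
      using v x by (simp add: cd1_star_def minus l_distr)
    finally show ?thesis .
  qed
  have K1: "involutive_algebra K (cd1 K \<mu>1) (cd1_star K)" using cd1_involutive[OF K \<mu>(1)] by simp
  interpret K1: involutive_algebra K "cd1 K \<mu>1" "cd1_star K" by (rule K1)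
  have h1: "?\<phi>1 \<in> ring_hom (cd1 K \<mu>1) A" using s1 by (simp add: star_hom_def)
  have smult1: "?\<phi>1 (r \<odot>\<^bsub>cd1 K \<mu>1\<^esub> x) = \<phi> r \<otimes>\<^bsub>A\<^esub> ?\<phi>1 x" if "r \<in> carrier K" "x \<in> carrier (cd1 K \<mu>1)" for r x
    using that by (auto simp: cd1_def ring_hom_mult[OF \<phi>] r_distr Z(3))
  have s2: "star_hom (cd2 K \<mu>1 \<mu>2) (cd2_star K \<mu>1) ?\<phi>2"
    unfolding cd2_def cd2_star_def
    by (rule cd_lift_star_hom[OF K1 s1 \<mu>(2) T(2) comm1[OF T(2,8)]]) (simp_all only: smult1[OF \<mu>(2)] sq(2))
  have comm2: "c \<otimes>\<^bsub>A\<^esub> ?\<phi>2 x = ?\<phi>2 (cd2_star K \<mu>1 x) \<otimes>\<^bsub>A\<^esub> c"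
    if x0: "x \<in> carrier (cd2 K \<mu>1 \<mu>2)" for x
  proof -
    obtain p q where x: "x = (p, q)" "p \<in> carrier (cd1 K \<mu>1)" "q \<in> carrier (cd1 K \<mu>1)"
      using x0 by (auto simp: cd2_def)
    obtain q1 q2 where q: "q = (q1, q2)" "q1 \<in> carrier K" "q2 \<in> carrier K" using x by (auto simp: cd1_def)
    note [simp] = ring_hom_closed[OF h1]
    have cba: "c \<otimes>\<^bsub>A\<^esub> (b \<otimes>\<^bsub>A\<^esub> a) = \<ominus>\<^bsub>A\<^esub> ((b \<otimes>\<^bsub>A\<^esub> a) \<otimes>\<^bsub>A\<^esub> c)"
      using cayley_triple_products(2)[OF abc] by (simp add: T(8) r_minus l_minus)
    have bq: "b \<otimes>\<^bsub>A\<^esub> ?\<phi>1 q = \<phi> q1 \<otimes>\<^bsub>A\<^esub> b \<oplus>\<^bsub>A\<^esub> \<phi> q2 \<otimes>\<^bsub>A\<^esub> (b \<otimes>\<^bsub>A\<^esub> a)"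
      using q by (simp add: r_distr Z(1)[of q1 b] Z(1)[of q2 a] Z(3))
    have "c \<otimes>\<^bsub>A\<^esub> (b \<otimes>\<^bsub>A\<^esub> ?\<phi>1 q) = \<ominus>\<^bsub>A\<^esub> ((b \<otimes>\<^bsub>A\<^esub> ?\<phi>1 q) \<otimes>\<^bsub>A\<^esub> c)"
      unfolding bq using q by (simp add: r_distr l_distr Z(3)[of _ c] Z(2) T(10) cba r_minus minus_add)
    then show ?thesis
      using x comm1[OF T(3,9) x(2)]
      by (simp add: cd2_star_def r_distr l_distr r_minus l_minus ring_hom_zero_minus(2)[OF K1.M.abelian_group_axioms h1])
  qed
  have K2: "involutive_algebra K (cd2 K \<mu>1 \<mu>2) (cd2_star K \<mu>1)" using cd2_involutive[OF K \<mu>(1,2)] by simp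
  have h2: "?\<phi>2 \<in> ring_hom (cd2 K \<mu>1 \<mu>2) A" using s2 by (simp add: star_hom_def)
  have smult2: "?\<phi>2 (r \<odot>\<^bsub>cd2 K \<mu>1 \<mu>2\<^esub> x) = \<phi> r \<otimes>\<^bsub>A\<^esub> ?\<phi>2 x" if "r \<in> carrier K" "x \<in> carrier (cd2 K \<mu>1 \<mu>2)" for r x
    using that ring_hom_closed[OF h1] by (auto simp: cd2_def smult1 r_distr Z(3))
  have "star_hom (octonion_algebra K \<mu>1 \<mu>2 \<mu>3) (cd_star (cd2 K \<mu>1 \<mu>2) (cd2_star K \<mu>1)) (cd_lift c ?\<phi>2)"
    unfolding octonion_algebra_def
    by (rule cd_lift_star_hom[OF K2 s2 \<mu>(3) T(3) comm2]) (simp_all only: smult2[OF \<mu>(3)] sq(3))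
  then show ?thesis by (simp add: star_hom_def)
qed

end

section \<open>Polynomials in three variables\<close>

lemma (in UP_cring) UP_generated:
  assumes p: "p \<in> carrier P"
    and const: "\<And>c. c \<in> carrier R \<Longrightarrow> monom P c 0 \<in> M"
    and var: "monom P \<one> 1 \<in> M"
    and add: "\<And>x y. \<lbrakk>x \<in> carrier P; y \<in> carrier P; x \<in> M; y \<in> M\<rbrakk> \<Longrightarrow> x \<oplus>\<^bsub>P\<^esub> y \<in> M"
    and mult: "\<And>x y. \<lbrakk>x \<in> carrier P; y \<in> carrier P; x \<in> M; y \<in> M\<rbrakk> \<Longrightarrow> x \<otimes>\<^bsub>P\<^esub> y \<in> M"
  shows "p \<in> M"
proof -
  have pow: "monom P \<one> n \<in> M" for n
  proof (induction n)
    case 0 show ?case by (rule const) simp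
  next
    case (Suc n) then show ?case
      unfolding monom_one_Suc[of n] by (intro mult var) simp_all
  qed
  have mon: "monom P c n \<in> M" if "c \<in> carrier R" for c n
  proof -
    have "monom P c n = monom P c 0 \<otimes>\<^bsub>P\<^esub> monom P \<one> n"
      using that monom_mult[of c \<one> 0 n] by simp
    then show ?thesis using that by (simp add: mult const pow)
  qed
  have "(\<Oplus>\<^bsub>P\<^esub> i \<in> {..n}. monom P (coeff P p i) i) \<in> M" for n
  proof (induction n)
    case 0 show ?case using p by (simp add: mon Pi_def)
  next
    case (Suc n)
    then show ?case using p by (simp add: add mon Pi_def del: coeff_monom)
  qed
  then show ?thesis using up_repr[OF p] by metis
qed

lemma poly3_cring:
  assumes "cring R" shows "cring (poly3 R)"
  unfolding poly3_def by (intro UP_cring.UP_cring UP_cring.intro assms)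

lemma var3_closed [simp]:
  assumes "cring R" shows "var3 R i \<in> carrier (poly3 R)"
proof -
  interpret P1: UP_cring R "UP R" by (intro UP_cring.intro assms)
  interpret P2: UP_cring "UP R" "UP (UP R)" by unfold_locales 
  interpret P3: UP_cring "UP (UP R)" "UP (UP (UP R))" by unfold_locales
  show ?thesis by (cases i) (simp_all add: poly3_def)
qed

lemma const3_hom:
  assumes "cring R" shows "const3 R \<in> ring_hom R (poly3 R)"
proof -
  interpret P1: UP_cring R "UP R" by (intro UP_cring.intro assms)
  interpret P2: UP_cring "UP R" "UP (UP R)" by unfold_locales 
  interpret P3: UP_cring "UP (UP R)" "UP (UP (UP R))" by unfold_locales
  show ?thesis
    using ring_hom_trans[OF ring_hom_trans[OF P1.const_ring_hom P2.const_ring_hom] P3.const_ring_hom]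
    by (simp add: poly3_def const3_def[abs_def] o_def)
qed

lemma poly3_generated:
  fixes R (structure)
  assumes R: "cring R" and p: "p \<in> carrier (poly3 R)"
    and const: "\<And>c. c \<in> carrier R \<Longrightarrow> const3 R c \<in> M"
    and var: "\<And>i. var3 R i \<in> M"
    and add: "\<And>x y. \<lbrakk>x \<in> carrier (poly3 R); y \<in> carrier (poly3 R); x \<in> M; y \<in> M\<rbrakk> \<Longrightarrow> x \<oplus>\<^bsub>poly3 R\<^esub> y \<in> M"
    and mult: "\<And>x y. \<lbrakk>x \<in> carrier (poly3 R); y \<in> carrier (poly3 R); x \<in> M; y \<in> M\<rbrakk> \<Longrightarrow> x \<otimes>\<^bsub>poly3 R\<^esub> y \<in> M"
  shows "p \<in> M"
proof -
  interpret P1: UP_cring R "UP R" by (intro UP_cring.intro R)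
  interpret P2: UP_cring "UP R" "UP (UP R)" by unfold_locales 
  interpret P3: UP_cring "UP (UP R)" "UP (UP (UP R))" by unfold_locales
  note add = add[unfolded poly3_def] and mult = mult[unfolded poly3_def]
  have mm1: "monom (UP (UP R)) (x \<otimes>\<^bsub>UP R\<^esub> y) 0 = monom (UP (UP R)) x 0 \<otimes>\<^bsub>UP (UP R)\<^esub> monom (UP (UP R)) y 0"
    if "x \<in> carrier (UP R)" "y \<in> carrier (UP R)" for x y
    using P2.monom_mult[OF that, of 0 0] by simp
  have mm2: "monom (UP (UP (UP R))) (x \<otimes>\<^bsub>UP (UP R)\<^esub> y) 0 = monom (UP (UP (UP R))) x 0 \<otimes>\<^bsub>UP (UP (UP R))\<^esub> monom (UP (UP (UP R))) y 0"
    if "x \<in> carrier (UP (UP R))" "y \<in> carrier (UP (UP R))" for x y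
    using P3.monom_mult[OF that, of 0 0] by simp
  have 1: "q \<in> {q. monom (UP (UP (UP R))) (monom (UP (UP R)) q 0) 0 \<in> M}" if "q \<in> carrier (UP R)" for q
  proof (rule P1.UP_generated[OF that])
    show "monom (UP R) c 0 \<in> {q. monom (UP (UP (UP R))) (monom (UP (UP R)) q 0) 0 \<in> M}" if "c \<in> carrier R" for c
      using const[OF that] by (simp add: const3_def)
    show "monom (UP R) \<one> 1 \<in> {q. monom (UP (UP (UP R))) (monom (UP (UP R)) q 0) 0 \<in> M}"
      using var[of I1] by simp
  qed (simp_all only: mem_Collect_eq P2.monom_add P3.monom_add mm1 mm2 P2.monom_closed P3.monom_closed add mult)
  have 2: "q \<in> {q. monom (UP (UP (UP R))) q 0 \<in> M}" if "q \<in> carrier (UP (UP R))" for q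
  proof (rule P2.UP_generated[OF that])
    show "monom (UP (UP R)) c 0 \<in> {q. monom (UP (UP (UP R))) q 0 \<in> M}" if "c \<in> carrier (UP R)" for c
      using 1[OF that] by simp
    show "monom (UP (UP R)) \<one>\<^bsub>UP R\<^esub> 1 \<in> {q. monom (UP (UP (UP R))) q 0 \<in> M}"
      using var[of I2] by simp
  qed (simp_all only: mem_Collect_eq P3.monom_add mm2 P3.monom_closed add mult)
  show ?thesis
  proof (rule P3.UP_generated[OF p[unfolded poly3_def]])
    show "monom (UP (UP (UP R))) c 0 \<in> M" if "c \<in> carrier (UP (UP R))" for c
      using 2[OF that] by simp
    show "monom (UP (UP (UP R))) \<one>\<^bsub>UP (UP R)\<^esub> 1 \<in> M"
      using var[of I3] by simp
  qed (simp_all only: add mult)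
qed

definition regular :: "('k, 'm) ring_scheme \<Rightarrow> 'k set" where
  "regular K = {c \<in> carrier K. \<forall>x\<in>carrier K. c \<otimes>\<^bsub>K\<^esub> x = \<zero>\<^bsub>K\<^esub> \<longrightarrow> x = \<zero>\<^bsub>K\<^esub>}"

text \<open>
  Multiplication by a monomial shifts the coefficients and multiplies them by \<open>c\<close>.
\<close>

lemma (in UP_cring) monom_regular:
  assumes "c \<in> regular R" shows "monom P c n \<in> regular P"
proof -
  have c: "c \<in> carrier R" "\<And>x. \<lbrakk>x \<in> carrier R; c \<otimes> x = \<zero>\<rbrakk> \<Longrightarrow> x = \<zero>" using assms unfolding regular_def by blast+
  have "p = \<zero>\<^bsub>P\<^esub>" if p: "p \<in> carrier P" and z: "monom P c n \<otimes>\<^bsub>P\<^esub> p = \<zero>\<^bsub>P\<^esub>" for p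
  proof (rule up_eqI[OF _ p])
    fix m
    have "c \<otimes> coeff P p m = \<zero>"
      using coeff_monom_mult[OF c(1) p, of n m] by (simp add: z)
    then show "coeff P p m = coeff P \<zero>\<^bsub>P\<^esub> m" using c(2) p by simp
  qed simp
  then show ?thesis unfolding regular_def using monom_closed[OF c(1)] by blast
qed

lemma (in cring) regular_one: "\<one> \<in> regular R" by (simp add: regular_def)

lemma (in cring) regular_mult:
  assumes "a \<in> regular R" "b \<in> regular R" shows "a \<otimes> b \<in> regular R"
proof -
  have c: "a \<in> carrier R" "b \<in> carrier R" using assms by (simp_all add: regular_def)
  have "x = \<zero>" if x: "x \<in> carrier R" and z: "(a \<otimes> b) \<otimes> x = \<zero>" for x
  proof -
    have "a \<otimes> (b \<otimes> x) = \<zero>" using z c x by (simp add: m_assoc)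
    then have "b \<otimes> x = \<zero>" using assms(1) c x unfolding regular_def by blast
    then show "x = \<zero>" using assms(2) x unfolding regular_def by blast
  qed
  then show ?thesis unfolding regular_def using c by blast
qed

lemma var3_regular:
  assumes "cring R" shows "var3 R i \<in> regular (poly3 R)"
proof -
  interpret P1: UP_cring R "UP R" by (intro UP_cring.intro assms)
  interpret P2: UP_cring "UP R" "UP (UP R)" by unfold_locales 
  interpret P3: UP_cring "UP (UP R)" "UP (UP (UP R))" by unfold_locales
  show ?thesis
    by (cases i) (auto simp: poly3_def simp del: One_nat_def intro!: P1.monom_regular P2.monom_regular P3.monom_regular
        P1.R.regular_one cring.regular_one[OF P1.UP_cring] cring.regular_one[OF P2.UP_cring])
qed

lemma (in alternative_algebra) center_cring: "cring (A\<lparr>carrier := alg_center A\<rparr>)"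
  by (rule cringI, rule abelian_groupI)
    (auto intro!: comm_monoidI N.alg_center_add N.alg_center_mult N.alg_center_zero N.alg_center_one
      bexI[of _ "\<ominus>\<^bsub>A\<^esub> x" for x] N.alg_center_minus
      simp: M.a_ac N.alg_center_closed N.l_distr N.r_distr M.r_neg N.alg_center_assoc N.alg_center_comm)

lemma (in alternative_algebra) smult_one_center: "c \<in> carrier R \<Longrightarrow> c \<odot>\<^bsub>A\<^esub> \<one>\<^bsub>A\<^esub> \<in> alg_center A"
  by (rule N.alg_centerI) (simp_all add: smult_mult_left smult_mult_right)

text \<open>
  The center is a commutative ring, so the universal property of polynomials in one variable can be
  applied to the three adjunctions in turn.
\<close>

lemma (in alternative_algebra) poly3_eval:
  assumes z: "\<And>i. z i \<in> alg_center A"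
  obtains \<phi> where "\<phi> \<in> ring_hom (poly3 R) A" "\<And>p. p \<in> carrier (poly3 R) \<Longrightarrow> \<phi> p \<in> alg_center A"
    "\<And>c. c \<in> carrier R \<Longrightarrow> \<phi> (const3 R c) = c \<odot>\<^bsub>A\<^esub> \<one>\<^bsub>A\<^esub>" "\<And>i. \<phi> (var3 R i) = z i"
proof -
  let ?Z = "A\<lparr>carrier := alg_center A\<rparr>"
  interpret Z: cring ?Z by (rule center_cring)
  define h where "h = (\<lambda>c. c \<odot>\<^bsub>A\<^esub> \<one>\<^bsub>A\<^esub>)"
  have h: "h \<in> ring_hom R ?Z"
    by (rule ring_hom_memI)
      (auto simp: h_def smult_one_center smult_l_distr smult_assoc1 smult_mult_left)
  interpret P1: UP_pre_univ_prop R ?Z h "UP R"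
    by (intro UP_pre_univ_prop.intro ring_hom_cringI h UP_cring.intro R.cring_axioms Z.cring_axioms)
  define h1 where "h1 = eval R ?Z h (z I1)"
  have h1: "h1 \<in> ring_hom (UP R) ?Z" unfolding h1_def by (rule P1.eval_ring_hom) (simp add: z)
  interpret P2: UP_pre_univ_prop "UP R" ?Z h1 "UP (UP R)"
    by (intro UP_pre_univ_prop.intro ring_hom_cringI h1 UP_cring.intro P1.UP_cring Z.cring_axioms)
  define h2 where "h2 = eval (UP R) ?Z h1 (z I2)"
  have h2: "h2 \<in> ring_hom (UP (UP R)) ?Z" unfolding h2_def by (rule P2.eval_ring_hom) (simp add: z)
  interpret P3: UP_pre_univ_prop "UP (UP R)" ?Z h2 "UP (UP (UP R))"
    by (intro UP_pre_univ_prop.intro ring_hom_cringI h2 UP_cring.intro P2.UP_cring Z.cring_axioms)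
  define h3 where "h3 = eval (UP (UP R)) ?Z h2 (z I3)"
  have h3: "h3 \<in> ring_hom (poly3 R) ?Z" unfolding h3_def poly3_def by (rule P3.eval_ring_hom) (simp add: z)
  have e1: "h1 (monom (UP R) c 0) = h c" "h1 (monom (UP R) \<one> 1) = z I1" if "c \<in> carrier R" for c
    unfolding h1_def using that z by (simp_all add: P1.eval_const P1.eval_monom1 del: One_nat_def)
  have e2: "h2 (monom (UP (UP R)) c 0) = h1 c" "h2 (monom (UP (UP R)) \<one>\<^bsub>UP R\<^esub> 1) = z I2"
    if "c \<in> carrier (UP R)" for c
    unfolding h2_def using that z by (simp_all add: P2.eval_const P2.eval_monom1 del: One_nat_def)
  have e3: "h3 (monom (UP (UP (UP R))) c 0) = h2 c" "h3 (monom (UP (UP (UP R))) \<one>\<^bsub>UP (UP R)\<^esub> 1) = z I3"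
    if "c \<in> carrier (UP (UP R))" for c
    unfolding h3_def using that z by (simp_all add: P3.eval_const P3.eval_monom1 del: One_nat_def)
  note e1 = e1(1) e1(2)[OF R.one_closed] and e2 = e2(1) e2(2)[OF P1.UP_one_closed]
    and e3 = e3(1) e3(2)[OF P2.UP_one_closed]
  show ?thesis
  proof
    show "h3 \<in> ring_hom (poly3 R) A"
      using h3 N.alg_center_closed by (auto simp: ring_hom_def)
    show "h3 p \<in> alg_center A" if "p \<in> carrier (poly3 R)" for p
      using ring_hom_closed[OF h3 that] by simp
    show "h3 (const3 R c) = c \<odot>\<^bsub>A\<^esub> \<one>\<^bsub>A\<^esub>" if "c \<in> carrier R" for c
      using that by (simp add: const3_def e1 e2 e3) (simp add: h_def)
    show "h3 (var3 R i) = z i" for i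
      by (cases i) (simp_all add: e1 e2 e3 del: One_nat_def)
  qed
qed

section \<open>Octonion algebras and their generators\<close>

lemma (in nonassoc_algebra) alternative_algebraI:
  assumes "\<And>x y. \<lbrakk>x \<in> carrier A; y \<in> carrier A\<rbrakk> \<Longrightarrow> (x \<otimes>\<^bsub>A\<^esub> x) \<otimes>\<^bsub>A\<^esub> y = x \<otimes>\<^bsub>A\<^esub> (x \<otimes>\<^bsub>A\<^esub> y)"
    and "\<And>x y. \<lbrakk>x \<in> carrier A; y \<in> carrier A\<rbrakk> \<Longrightarrow> (y \<otimes>\<^bsub>A\<^esub> x) \<otimes>\<^bsub>A\<^esub> x = y \<otimes>\<^bsub>A\<^esub> (x \<otimes>\<^bsub>A\<^esub> x)"
  shows "alternative_algebra R A"
  by unfold_locales (simp_all add: associator_def assms N.diff_eq_zero_iff)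

definition restrict_scalars ::
  "('k \<Rightarrow> 'l) \<Rightarrow> ('l, 'a, 'n) module_scheme \<Rightarrow> ('k, 'a) module" where
  "restrict_scalars f A = \<lparr>carrier = carrier A, mult = mult A, one = one A, zero = zero A, add = add A,
     smult = (\<lambda>c x. f c \<odot>\<^bsub>A\<^esub> x)\<rparr>"

lemma restrict_scalars_alternative:
  assumes A: "alternative_algebra K A" and R: "cring R" and f: "f \<in> ring_hom R K"
  shows "alternative_algebra R (restrict_scalars f A)"
proof -
  interpret A: alternative_algebra K A by fact
  interpret R: cring R by fact
  let ?A = "restrict_scalars f A"
  note [simp] = restrict_scalars_def ring_hom_closed[OF f]
  interpret B: abelian_group ?A
    by (rule abelian_groupI) (auto simp: A.M.a_ac intro: bexI[of _ "\<ominus>\<^bsub>A\<^esub> x" for x] A.M.r_neg)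
  interpret B: nonassoc_algebra R ?A
    by unfold_locales (auto simp: A.smult_l_distr A.smult_r_distr A.smult_assoc1 ring_hom_add[OF f]
      ring_hom_mult[OF f] ring_hom_one[OF f] A.N.l_distr A.N.r_distr A.smult_mult_left A.smult_mult_right)
  show ?thesis
    by (rule B.alternative_algebraI) (simp_all add: A.N.left_alternative A.N.right_alternative)
qed

lemma cayley_D_restrict: "cayley_D R = restrict_scalars (const3 R) (octonion_poly3 R)"
  by (simp add: cayley_D_def restrict_scalars_def Let_def)

lemma cayley_D_simps:
  "carrier (cayley_D R) = carrier (octonion_poly3 R)" "mult (cayley_D R) = mult (octonion_poly3 R)"
  "one (cayley_D R) = one (octonion_poly3 R)" "zero (cayley_D R) = zero (octonion_poly3 R)"
  "add (cayley_D R) = add (octonion_poly3 R)"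
  "c \<odot>\<^bsub>cayley_D R\<^esub> x = const3 R c \<odot>\<^bsub>octonion_poly3 R\<^esub> x"
  by (simp_all add: cayley_D_restrict restrict_scalars_def)

lemma octonion_poly3_alternative:
  assumes "cring R" shows "alternative_algebra (poly3 R) (octonion_poly3 R)"
  unfolding octonion_poly3_def
  by (intro octonion_alternative poly3_cring var3_closed assms)

lemma cayley_D_alternative:
  assumes "cring R" shows "alternative_algebra R (cayley_D R)"
  unfolding cayley_D_restrict
  by (rule restrict_scalars_alternative[OF octonion_poly3_alternative[OF assms] assms const3_hom[OF assms]])

context involutive_algebra
begin

abbreviation "CD \<mu> \<equiv> cayley_dickson B star \<mu>"

lemma cayley_dickson_split:
  assumes "\<mu> \<in> carrier K" "a \<in> carrier B" "b \<in> carrier B"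
  shows "(a, b) = (a, \<zero>\<^bsub>B\<^esub>) \<oplus>\<^bsub>CD \<mu>\<^esub> (\<zero>\<^bsub>B\<^esub>, \<one>\<^bsub>B\<^esub>) \<otimes>\<^bsub>CD \<mu>\<^esub> (b, \<zero>\<^bsub>B\<^esub>)"
  using assms by simp

lemma cayley_dickson_embed_mult:
  assumes "\<mu> \<in> carrier K" "a \<in> carrier B" "b \<in> carrier B"
  shows "(a, \<zero>\<^bsub>B\<^esub>) \<otimes>\<^bsub>CD \<mu>\<^esub> (b, \<zero>\<^bsub>B\<^esub>) = (a \<otimes>\<^bsub>B\<^esub> b, \<zero>\<^bsub>B\<^esub>)"
  using assms by simp

lemma cayley_dickson_generator_square:
  assumes "\<mu> \<in> carrier K"
  shows "(\<zero>\<^bsub>B\<^esub>, \<one>\<^bsub>B\<^esub>) \<otimes>\<^bsub>CD \<mu>\<^esub> (\<zero>\<^bsub>B\<^esub>, \<one>\<^bsub>B\<^esub>) = (\<mu> \<odot>\<^bsub>B\<^esub> \<one>\<^bsub>B\<^esub>, \<zero>\<^bsub>B\<^esub>)"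
  using assms by simp

lemma cayley_dickson_generator_anticommute:
  assumes "\<mu> \<in> carrier K" "a \<in> carrier B" "star a = \<ominus>\<^bsub>B\<^esub> a"
  shows "(a, \<zero>\<^bsub>B\<^esub>) \<otimes>\<^bsub>CD \<mu>\<^esub> (\<zero>\<^bsub>B\<^esub>, \<one>\<^bsub>B\<^esub>)
    = \<ominus>\<^bsub>CD \<mu>\<^esub> ((\<zero>\<^bsub>B\<^esub>, \<one>\<^bsub>B\<^esub>) \<otimes>\<^bsub>CD \<mu>\<^esub> (a, \<zero>\<^bsub>B\<^esub>))"
  using assms by (simp add: cayley_dickson_minus)

lemma cayley_dickson_generator_antiassociate:
  assumes "\<mu> \<in> carrier K" "a \<in> carrier B" "b \<in> carrier B"
    "star a = \<ominus>\<^bsub>B\<^esub> a" "star b = \<ominus>\<^bsub>B\<^esub> b" "a \<otimes>\<^bsub>B\<^esub> b = \<ominus>\<^bsub>B\<^esub> (b \<otimes>\<^bsub>B\<^esub> a)"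
  shows "((a, \<zero>\<^bsub>B\<^esub>) \<otimes>\<^bsub>CD \<mu>\<^esub> (b, \<zero>\<^bsub>B\<^esub>)) \<otimes>\<^bsub>CD \<mu>\<^esub> (\<zero>\<^bsub>B\<^esub>, \<one>\<^bsub>B\<^esub>)
    = \<ominus>\<^bsub>CD \<mu>\<^esub> ((a, \<zero>\<^bsub>B\<^esub>) \<otimes>\<^bsub>CD \<mu>\<^esub>
        ((b, \<zero>\<^bsub>B\<^esub>) \<otimes>\<^bsub>CD \<mu>\<^esub> (\<zero>\<^bsub>B\<^esub>, \<one>\<^bsub>B\<^esub>)))"
proof -
  have "star (a \<otimes>\<^bsub>B\<^esub> b) = b \<otimes>\<^bsub>B\<^esub> a"
    using assms(2-5) by (simp add: star_mult N.l_minus N.r_minus)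
  moreover have "b \<otimes>\<^bsub>B\<^esub> a = \<ominus>\<^bsub>B\<^esub> (a \<otimes>\<^bsub>B\<^esub> b)" using assms(2,3,6) by simp
  ultimately show ?thesis
    using assms(1-5) by (simp add: cayley_dickson_minus N.l_minus N.r_minus)
qed

text \<open>
  Induction over the double. The map \<open>e\<close> is meant to be the embedding into the later stages of
  the process.
\<close>

lemma cayley_dickson_subset:
  assumes \<mu>: "\<mu> \<in> carrier K"
    and e: "\<And>x y. \<lbrakk>x \<in> carrier (CD \<mu>); y \<in> carrier (CD \<mu>); e x \<in> M; e y \<in> M\<rbrakk>
      \<Longrightarrow> e (x \<oplus>\<^bsub>CD \<mu>\<^esub> y) \<in> M \<and> e (x \<otimes>\<^bsub>CD \<mu>\<^esub> y) \<in> M"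
    and B: "\<And>b. b \<in> carrier B \<Longrightarrow> e (b, \<zero>\<^bsub>B\<^esub>) \<in> M"
    and v: "e (\<zero>\<^bsub>B\<^esub>, \<one>\<^bsub>B\<^esub>) \<in> M"
    and x: "x \<in> carrier (CD \<mu>)"
  shows "e x \<in> M"
proof -
  interpret C: nonassoc_algebra K "CD \<mu>" by (rule cayley_dickson_nonassoc[OF \<mu>])
  obtain a b where ab: "x = (a, b)" "a \<in> carrier B" "b \<in> carrier B" using x by auto
  have v': "(\<zero>\<^bsub>B\<^esub>, \<one>\<^bsub>B\<^esub>) \<in> carrier (CD \<mu>)" by simp
  have b': "(b, \<zero>\<^bsub>B\<^esub>) \<in> carrier (CD \<mu>)" "(a, \<zero>\<^bsub>B\<^esub>) \<in> carrier (CD \<mu>)"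
    using ab by simp_all
  have "e ((\<zero>\<^bsub>B\<^esub>, \<one>\<^bsub>B\<^esub>) \<otimes>\<^bsub>CD \<mu>\<^esub> (b, \<zero>\<^bsub>B\<^esub>)) \<in> M"
    using e[OF v' b'(1) v B[OF ab(3)]] by blast
  then have "e ((a, \<zero>\<^bsub>B\<^esub>) \<oplus>\<^bsub>CD \<mu>\<^esub> (\<zero>\<^bsub>B\<^esub>, \<one>\<^bsub>B\<^esub>) \<otimes>\<^bsub>CD \<mu>\<^esub> (b, \<zero>\<^bsub>B\<^esub>)) \<in> M"
    using e[OF b'(2) C.mult_closed[OF v' b'(1)] B[OF ab(2)]] by blast
  then show ?thesis
    unfolding ab(1) using cayley_dickson_split[OF \<mu> ab(2,3)] by metis
qed

end

text \<open>
  The parameters are a family indexed like the generators, so that statements about the three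
  generators can be uniform.
\<close>

locale octonion = cring K for K (structure) +
  fixes m :: "index3 \<Rightarrow> 'a"
  assumes param_closed [simp]: "m i \<in> carrier K"
begin

abbreviation "C1 \<equiv> cd1 K (m I1)"
abbreviation "C2 \<equiv> cd2 K (m I1) (m I2)"
abbreviation "Oct \<equiv> octonion_algebra K (m I1) (m I2) (m I3)"
abbreviation "gen \<equiv> basic_generator K"

sublocale O: alternative_algebra K Oct
  by (intro octonion_alternative cring_axioms param_closed)
sublocale B0: involutive_algebra K "ring_as_algebra K" "\<lambda>x. x"
  by (rule ring_as_algebra_involutive[OF cring_axioms])
sublocale B1: involutive_algebra K "C1" "cd1_star K"
  by (rule cd1_involutive(1)[OF cring_axioms param_closed])
sublocale B2: involutive_algebra K "C2" "cd2_star K (m I1)"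
  by (rule cd2_involutive(1)[OF cring_axioms param_closed param_closed])

lemma Oct_eq: "Oct = cayley_dickson (C2) (cd2_star K (m I1)) (m I3)"
  by (simp add: octonion_algebra_def)

lemma C1_ops: "carrier (C1) = carrier K \<times> carrier K"
  "\<zero>\<^bsub>C1\<^esub> = (\<zero>, \<zero>)" "\<one>\<^bsub>C1\<^esub> = (\<one>, \<zero>)"
  by (simp_all add: cd1_def)

lemma C2_ops: "carrier (C2) = carrier (C1) \<times> carrier (C1)"
  "\<zero>\<^bsub>C2\<^esub> = (\<zero>\<^bsub>C1\<^esub>, \<zero>\<^bsub>C1\<^esub>)"
  "\<one>\<^bsub>C2\<^esub> = (\<one>\<^bsub>C1\<^esub>, \<zero>\<^bsub>C1\<^esub>)"
  by (simp_all add: cd2_def)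

lemma Oct_ops: "carrier Oct = carrier (C2) \<times> carrier (C2)"
  "\<zero>\<^bsub>Oct\<^esub> = (\<zero>\<^bsub>C2\<^esub>, \<zero>\<^bsub>C2\<^esub>)"
  "\<one>\<^bsub>Oct\<^esub> = (\<one>\<^bsub>C2\<^esub>, \<zero>\<^bsub>C2\<^esub>)"
  by (simp_all add: Oct_eq)

text \<open>
  The embeddings of each stage into the next one, and the new generator of the first two stages.
\<close>

definition e1 where "e1 p = (p, \<zero>)"
definition e2 where "e2 x = (x, \<zero>\<^bsub>C1\<^esub>)"
definition e3 where "e3 x = (x, \<zero>\<^bsub>C2\<^esub>)"
definition g1 where "g1 = (\<zero>, \<one>)"
definition g2 where "g2 = (\<zero>\<^bsub>C1\<^esub>, \<one>\<^bsub>C1\<^esub>)"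

lemma gen_eq: "gen I1 = e3 (e2 g1)" "gen I2 = e3 g2"
  "gen I3 = (\<zero>\<^bsub>C2\<^esub>, \<one>\<^bsub>C2\<^esub>)"
  by (simp_all add: e3_def e2_def g1_def g2_def C1_ops C2_ops)

lemma g_closed: "g1 \<in> carrier (C1)" "g2 \<in> carrier (C2)"
  "e2 g1 \<in> carrier (C2)"
  by (simp_all add: g1_def g2_def e2_def C1_ops C2_ops)

lemma gen_closed [simp]: "gen i \<in> carrier Oct"
  by (cases i) (simp_all add: C1_ops C2_ops Oct_ops)

lemma gen_triple: "O.N.cayley_triple (gen I1) (gen I2) (gen I3)"
proof -
  have star1: "cd1_star K g1 = \<ominus>\<^bsub>C1\<^esub> g1"
    using B0.cayley_dickson_minus[OF param_closed, of "\<zero>" "\<one>" I1]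
      B0.N.minus_zero
    by (simp add: g1_def cd1_star_def cd1_def)
  have minus2: "\<ominus>\<^bsub>C2\<^esub> (a, b) = (\<ominus>\<^bsub>C1\<^esub> a, \<ominus>\<^bsub>C1\<^esub> b)"
    if "a \<in> carrier (C1)" "b \<in> carrier (C1)" for a b
    using B1.cayley_dickson_minus[OF param_closed that, of I2] by (simp add: cd2_def)
  have star2: "cd2_star K (m I1) (e2 g1) = \<ominus>\<^bsub>C2\<^esub> e2 g1"
    using g_closed(1) by (simp add: e2_def cd2_star_def star1 minus2)
  have star2': "cd2_star K (m I1) g2 = \<ominus>\<^bsub>C2\<^esub> g2"
    by (simp add: g2_def cd2_star_def minus2)
  have anti: "e2 g1 \<otimes>\<^bsub>C2\<^esub> g2 = \<ominus>\<^bsub>C2\<^esub> (g2 \<otimes>\<^bsub>C2\<^esub> e2 g1)"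
    unfolding e2_def g2_def cd2_def
    by (rule B1.cayley_dickson_generator_anticommute[OF param_closed g_closed(1) star1])
  have "gen I1 \<otimes>\<^bsub>Oct\<^esub> gen I2 = \<ominus>\<^bsub>Oct\<^esub> (gen I2 \<otimes>\<^bsub>Oct\<^esub> gen I1)"
    unfolding gen_eq e3_def Oct_eq using g_closed
    by (simp add: B2.cayley_dickson_embed_mult anti B2.cayley_dickson_minus del: cayley_dickson_simps)
  moreover have "gen I1 \<otimes>\<^bsub>Oct\<^esub> gen I3 = \<ominus>\<^bsub>Oct\<^esub> (gen I3 \<otimes>\<^bsub>Oct\<^esub> gen I1)"
    unfolding gen_eq e3_def Oct_eq
    by (rule B2.cayley_dickson_generator_anticommute[OF param_closed g_closed(3) star2])
  moreover have "gen I2 \<otimes>\<^bsub>Oct\<^esub> gen I3 = \<ominus>\<^bsub>Oct\<^esub> (gen I3 \<otimes>\<^bsub>Oct\<^esub> gen I2)"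
    unfolding gen_eq e3_def Oct_eq
    by (rule B2.cayley_dickson_generator_anticommute[OF param_closed g_closed(2) star2'])
  moreover have "(gen I1 \<otimes>\<^bsub>Oct\<^esub> gen I2) \<otimes>\<^bsub>Oct\<^esub> gen I3 = \<ominus>\<^bsub>Oct\<^esub> (gen I1 \<otimes>\<^bsub>Oct\<^esub> (gen I2 \<otimes>\<^bsub>Oct\<^esub> gen I3))"
    unfolding gen_eq e3_def Oct_eq
    by (rule B2.cayley_dickson_generator_antiassociate[OF param_closed g_closed(3,2) star2 star2' anti])
  ultimately show ?thesis by (simp only: O.N.cayley_triple_def gen_closed simp_thms)
qed

lemma smult_one_Oct: "p \<in> carrier K \<Longrightarrow> p \<odot>\<^bsub>Oct\<^esub> \<one>\<^bsub>Oct\<^esub> = e3 (e2 (e1 p))"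
  by (simp add: e3_def e2_def e1_def octonion_algebra_def cd2_def cd1_def)

lemma gen_square: "gen i \<otimes>\<^bsub>Oct\<^esub> gen i = m i \<odot>\<^bsub>Oct\<^esub> \<one>\<^bsub>Oct\<^esub>"
proof -
  have 1: "g1 \<otimes>\<^bsub>C1\<^esub> g1 = e1 (m I1)"
    using B0.cayley_dickson_generator_square[OF param_closed, of I1] by (simp add: g1_def e1_def cd1_def)
  have 2: "g2 \<otimes>\<^bsub>C2\<^esub> g2 = e2 (m I2 \<odot>\<^bsub>C1\<^esub> \<one>\<^bsub>C1\<^esub>)"
    using B1.cayley_dickson_generator_square[OF param_closed, of I2] by (simp add: g2_def e2_def cd2_def)
  have emb2: "e2 x \<otimes>\<^bsub>C2\<^esub> e2 y = e2 (x \<otimes>\<^bsub>C1\<^esub> y)"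
    if "x \<in> carrier (C1)" "y \<in> carrier (C1)" for x y
    unfolding e2_def cd2_def by (rule B1.cayley_dickson_embed_mult[OF param_closed that])
  have 3: "e3 x \<otimes>\<^bsub>Oct\<^esub> e3 y = e3 (x \<otimes>\<^bsub>C2\<^esub> y)"
    if "x \<in> carrier (C2)" "y \<in> carrier (C2)" for x y
    unfolding e3_def Oct_eq by (rule B2.cayley_dickson_embed_mult[OF param_closed that])
  show ?thesis
  proof (cases i)
    case I1
    then show ?thesis
      by (simp only: gen_eq 3 emb2 1 g_closed smult_one_Oct param_closed)
  next
    case I2
    have "m I2 \<odot>\<^bsub>C1\<^esub> \<one>\<^bsub>C1\<^esub> = e1 (m I2)" by (simp add: cd1_def e1_def)
    then show ?thesis
      by (simp only: I2 gen_eq 3 2 g_closed smult_one_Oct param_closed)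
  next
    case I3
    have "m I3 \<odot>\<^bsub>C2\<^esub> \<one>\<^bsub>C2\<^esub> = e2 (e1 (m I3))"
      by (simp add: cd1_def cd2_def e1_def e2_def)
    moreover have "gen I3 \<otimes>\<^bsub>Oct\<^esub> gen I3 = e3 (m I3 \<odot>\<^bsub>C2\<^esub> \<one>\<^bsub>C2\<^esub>)"
      unfolding gen_eq e3_def Oct_eq by (rule B2.cayley_dickson_generator_square[OF param_closed])
    ultimately show ?thesis by (simp only: I3 smult_one_Oct param_closed)
  qed
qed

lemma Oct_generated:
  assumes add: "\<And>x y. \<lbrakk>x \<in> M; y \<in> M\<rbrakk> \<Longrightarrow> x \<oplus>\<^bsub>Oct\<^esub> y \<in> M \<and> x \<otimes>\<^bsub>Oct\<^esub> y \<in> M"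
    and scal: "\<And>p. p \<in> carrier K \<Longrightarrow> p \<odot>\<^bsub>Oct\<^esub> \<one>\<^bsub>Oct\<^esub> \<in> M"
    and gen: "\<And>i. gen i \<in> M" and x: "x \<in> carrier Oct"
  shows "x \<in> M"
proof -
  have add3: "e3 (x \<oplus>\<^bsub>C2\<^esub> y) = e3 x \<oplus>\<^bsub>Oct\<^esub> e3 y" 
    "e3 (x \<otimes>\<^bsub>C2\<^esub> y) = e3 x \<otimes>\<^bsub>Oct\<^esub> e3 y"
    if "x \<in> carrier (C2)" "y \<in> carrier (C2)" for x y
    using that by (simp_all add: e3_def Oct_eq)
  have add2: "e2 (x \<oplus>\<^bsub>C1\<^esub> y) = e2 x \<oplus>\<^bsub>C2\<^esub> e2 y" 
    "e2 (x \<otimes>\<^bsub>C1\<^esub> y) = e2 x \<otimes>\<^bsub>C2\<^esub> e2 y"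
    if "x \<in> carrier (C1)" "y \<in> carrier (C1)" for x y
    using that by (simp_all add: e2_def cd2_def)
  have e2c: "e2 x \<in> carrier (C2)" if "x \<in> carrier (C1)" for x
    using that by (simp add: e2_def C2_ops)
  have 1: "e3 (e2 x) \<in> M" if "x \<in> carrier (C1)" for x
    using that unfolding cd1_def
  proof (rule B0.cayley_dickson_subset[OF param_closed, where e="\<lambda>x. e3 (e2 x)", rotated 3], fold cd1_def)
    fix x y assume "x \<in> carrier (C1)" "y \<in> carrier (C1)" "e3 (e2 x) \<in> M" "e3 (e2 y) \<in> M"
    then show "e3 (e2 (x \<oplus>\<^bsub>C1\<^esub> y)) \<in> M \<and> e3 (e2 (x \<otimes>\<^bsub>C1\<^esub> y)) \<in> M"
      by (simp add: add2 add3 e2c add)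
  next
    show "e3 (e2 (p, \<zero>\<^bsub>ring_as_algebra K\<^esub>)) \<in> M" if "p \<in> carrier (ring_as_algebra K)" for p
      using scal[of p] smult_one_Oct[of p] that by (simp add: e1_def)
    show "e3 (e2 (\<zero>\<^bsub>ring_as_algebra K\<^esub>, \<one>\<^bsub>ring_as_algebra K\<^esub>)) \<in> M"
      using gen[of I1] by (simp add: gen_eq g1_def del: basic_generator.simps)
  qed
  have 2: "e3 x \<in> M" if "x \<in> carrier (C2)" for x
    using that unfolding cd2_def
  proof (rule B1.cayley_dickson_subset[OF param_closed, where e="\<lambda>x. e3 x", rotated 3], fold cd2_def)
    fix x y assume "x \<in> carrier (C2)" "y \<in> carrier (C2)" "e3 x \<in> M" "e3 y \<in> M"
    then show "e3 (x \<oplus>\<^bsub>C2\<^esub> y) \<in> M \<and> e3 (x \<otimes>\<^bsub>C2\<^esub> y) \<in> M"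
      by (simp add: add3 add)
  next
    show "e3 (p, \<zero>\<^bsub>C1\<^esub>) \<in> M" if "p \<in> carrier (C1)" for p
      using 1[OF that] by (simp add: e2_def)
    show "e3 (\<zero>\<^bsub>C1\<^esub>, \<one>\<^bsub>C1\<^esub>) \<in> M"
      using gen[of I2] by (simp add: gen_eq g2_def del: basic_generator.simps)
  qed
  show ?thesis
    using x unfolding Oct_eq
  proof (rule B2.cayley_dickson_subset[OF param_closed, where e="\<lambda>x. x", rotated 3], fold Oct_eq)
    fix x y assume "x \<in> carrier Oct" "y \<in> carrier Oct" "x \<in> M" "y \<in> M"
    then show "x \<oplus>\<^bsub>Oct\<^esub> y \<in> M \<and> x \<otimes>\<^bsub>Oct\<^esub> y \<in> M" by (simp add: add)
  next
    show "(p, \<zero>\<^bsub>C2\<^esub>) \<in> M" if "p \<in> carrier (C2)" for p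
      using 2[OF that] by (simp add: e3_def)
    show "(\<zero>\<^bsub>C2\<^esub>, \<one>\<^bsub>C2\<^esub>) \<in> M"
      using gen[of I3] by (simp add: gen_eq del: basic_generator.simps)
  qed
qed

lemma regular_smult:
  assumes "p \<in> regular K" "x \<in> carrier Oct" "p \<odot>\<^bsub>Oct\<^esub> x = \<zero>\<^bsub>Oct\<^esub>"
  shows "x = \<zero>\<^bsub>Oct\<^esub>"
proof -
  have p: "\<And>y. \<lbrakk>y \<in> carrier K; p \<otimes> y = \<zero>\<rbrakk> \<Longrightarrow> y = \<zero>" using assms(1) unfolding regular_def by blast
  obtain x1 x2 x3 x4 x5 x6 x7 x8 where x: "x = (((x1,x2),(x3,x4)),((x5,x6),(x7,x8)))"
    by (metis surj_pair)
  show ?thesis using assms(2,3) unfolding x C1_ops C2_ops Oct_ops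
    by (auto simp: octonion_algebra_def cd2_def cd1_def intro: p)
qed

end

declare var3.simps [simp del]

section \<open>The algebra of the Cayley torus\<close>

lemma octonion_poly3: "cring R \<Longrightarrow> octonion (poly3 R) (var3 R)"
  by (intro octonion.intro octonion_axioms.intro poly3_cring) simp_all

lemma alg_homD:
  assumes "h \<in> alg_hom R A B"
  shows "h \<in> ring_hom A B" "\<And>c x. \<lbrakk>c \<in> carrier R; x \<in> carrier A\<rbrakk> \<Longrightarrow> h (c \<odot>\<^bsub>A\<^esub> x) = c \<odot>\<^bsub>B\<^esub> h x"
    "\<And>x. x \<in> carrier A \<Longrightarrow> h x \<in> carrier B"
    "\<And>x y. \<lbrakk>x \<in> carrier A; y \<in> carrier A\<rbrakk> \<Longrightarrow> h (x \<oplus>\<^bsub>A\<^esub> y) = h x \<oplus>\<^bsub>B\<^esub> h y"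
    "\<And>x y. \<lbrakk>x \<in> carrier A; y \<in> carrier A\<rbrakk> \<Longrightarrow> h (x \<otimes>\<^bsub>A\<^esub> y) = h x \<otimes>\<^bsub>B\<^esub> h y"
    "h \<one>\<^bsub>A\<^esub> = \<one>\<^bsub>B\<^esub>"
  using assms unfolding alg_hom_def by (auto simp: ring_hom_def)

lemma alg_homI:
  assumes "h \<in> ring_hom A B" "\<And>c x. \<lbrakk>c \<in> carrier R; x \<in> carrier A\<rbrakk> \<Longrightarrow> h (c \<odot>\<^bsub>A\<^esub> x) = c \<odot>\<^bsub>B\<^esub> h x"
  shows "h \<in> alg_hom R A B"
  using assms unfolding alg_hom_def by auto

lemma alg_hom_compose:
  assumes "f \<in> alg_hom R A B" "g \<in> alg_hom R B C"
  shows "(\<lambda>x. g (f x)) \<in> alg_hom R A C"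
  using alg_homD[OF assms(1)] alg_homD[OF assms(2)]
  by (intro alg_homI ring_hom_memI) simp_all

text \<open>
  The universal property of \<open>D\<close>. Linearity over \<open>R\<close> comes for free from multiplicativity, since
  \<open>c x = (c 1) x\<close> and the evaluation sends the constant \<open>c\<close> to \<open>c 1\<close>.
\<close>

lemma (in alternative_algebra) cayley_D_hom:
  assumes abc: "N.cayley_triple (a I1) (a I2) (a I3)"
    and sq: "\<And>i. a i \<otimes>\<^bsub>A\<^esub> a i \<in> alg_center A"
  obtains h where "h \<in> alg_hom R (cayley_D R) A" "\<And>i. h (v_gen R i) = a i"
proof -
  interpret K: octonion "poly3 R" "var3 R" by (rule octonion_poly3) unfold_locales
  obtain \<phi> where \<phi>: "\<phi> \<in> ring_hom (poly3 R) A" "\<And>p. p \<in> carrier (poly3 R) \<Longrightarrow> \<phi> p \<in> alg_center A"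
    "\<And>c. c \<in> carrier R \<Longrightarrow> \<phi> (const3 R c) = c \<odot>\<^bsub>A\<^esub> \<one>\<^bsub>A\<^esub>" "\<And>i. \<phi> (var3 R i) = a i \<otimes>\<^bsub>A\<^esub> a i"
    using poly3_eval[of "\<lambda>i. a i \<otimes>\<^bsub>A\<^esub> a i"] sq by blast
  define h where "h = N.cd_lift (a I3) (N.cd_lift (a I2) (N.cd_lift (a I1) \<phi>))"
  have h: "h \<in> ring_hom (octonion_poly3 R) A"
    unfolding h_def octonion_poly3_def
    by (rule N.octonion_lift[OF _ _ _ _ abc \<phi>(1,2)]) (simp_all add: \<phi>(4) K.is_cring)
  have \<phi>0: "\<phi> \<zero>\<^bsub>poly3 R\<^esub> = \<zero>\<^bsub>A\<^esub>" "\<phi> \<one>\<^bsub>poly3 R\<^esub> = \<one>\<^bsub>A\<^esub>"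
    using N.ring_hom_zero_minus(1)[OF K.is_abelian_group \<phi>(1)] ring_hom_one[OF \<phi>(1)] by auto
  note a = N.cayley_tripleD(1-3)[OF abc]
  have h_scal: "h (p \<odot>\<^bsub>octonion_poly3 R\<^esub> \<one>\<^bsub>octonion_poly3 R\<^esub>) = \<phi> p" if "p \<in> carrier (poly3 R)" for p
    using that a ring_hom_closed[OF \<phi>(1)] unfolding octonion_poly3_def K.smult_one_Oct[OF that]
    by (simp add: h_def K.e1_def K.e2_def K.e3_def K.C1_ops K.C2_ops \<phi>0)
  show ?thesis
  proof (rule that)
    show "h (v_gen R i) = a i" for i
      using a by (cases i) (simp_all add: v_gen_def h_def \<phi>0)
    show "h \<in> alg_hom R (cayley_D R) A"
    proof (rule alg_homI)
      show "h \<in> ring_hom (cayley_D R) A" using h by (simp add: ring_hom_def cayley_D_simps)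
      fix c x assume c: "c \<in> carrier R" and "x \<in> carrier (cayley_D R)"
      then have x: "x \<in> carrier (octonion_poly3 R)" by (simp add: cayley_D_simps)
      have p: "const3 R c \<in> carrier (poly3 R)" using ring_hom_closed[OF const3_hom[OF R.is_cring] c] .
      interpret O: alternative_algebra "poly3 R" "octonion_poly3 R"
        by (rule octonion_poly3_alternative[OF R.is_cring])
      have "const3 R c \<odot>\<^bsub>octonion_poly3 R\<^esub> x
        = (const3 R c \<odot>\<^bsub>octonion_poly3 R\<^esub> \<one>\<^bsub>octonion_poly3 R\<^esub>) \<otimes>\<^bsub>octonion_poly3 R\<^esub> x"
        using p x by (simp add: O.smult_mult_left)
      then show "h (c \<odot>\<^bsub>cayley_D R\<^esub> x) = c \<odot>\<^bsub>A\<^esub> h x"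
        using p x c ring_hom_closed[OF h x]
        by (simp add: cayley_D_simps ring_hom_mult[OF h] h_scal \<phi>(3) smult_mult_left)
    qed
  qed
qed

text \<open>
  The polynomials \<open>p\<close> with \<open>p 1\<close> in the subalgebra \<open>B\<close> include the constants and \<open>z\<^sub>i = v\<^sub>i\<^sup>2\<close>, hence
  all polynomials.
\<close>

lemma cayley_D_generated:
  assumes R: "cring R" and B: "unital_subalgebra R (cayley_D R) B" and v: "\<And>i. v_gen R i \<in> B"
  shows "carrier (cayley_D R) = B"
proof
  interpret K: octonion "poly3 R" "var3 R" by (rule octonion_poly3[OF R])
  interpret O: alternative_algebra "poly3 R" "octonion_poly3 R"
    by (rule octonion_poly3_alternative[OF R])
  show "B \<subseteq> carrier (cayley_D R)" using B by (simp add: unital_subalgebra_def)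
  have add: "x \<oplus>\<^bsub>octonion_poly3 R\<^esub> y \<in> B \<and> x \<otimes>\<^bsub>octonion_poly3 R\<^esub> y \<in> B" if "x \<in> B" "y \<in> B" for x y
    using B that by (simp add: unital_subalgebra_def cayley_D_simps)
  have scal: "p \<in> {p. p \<odot>\<^bsub>octonion_poly3 R\<^esub> \<one>\<^bsub>octonion_poly3 R\<^esub> \<in> B}" if "p \<in> carrier (poly3 R)" for p
  proof (rule poly3_generated[OF R that])
    show "const3 R c \<in> {p. p \<odot>\<^bsub>octonion_poly3 R\<^esub> \<one>\<^bsub>octonion_poly3 R\<^esub> \<in> B}" if "c \<in> carrier R" for c
      using B that by (simp add: unital_subalgebra_def cayley_D_simps)
    show "var3 R i \<in> {p. p \<odot>\<^bsub>octonion_poly3 R\<^esub> \<one>\<^bsub>octonion_poly3 R\<^esub> \<in> B}" for i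
      using add[OF v v, of i i] K.gen_square[of i] by (simp add: octonion_poly3_def v_gen_def)
  next
    fix x y assume xy: "x \<in> carrier (poly3 R)" "y \<in> carrier (poly3 R)"
      "x \<in> {p. p \<odot>\<^bsub>octonion_poly3 R\<^esub> \<one>\<^bsub>octonion_poly3 R\<^esub> \<in> B}"
      "y \<in> {p. p \<odot>\<^bsub>octonion_poly3 R\<^esub> \<one>\<^bsub>octonion_poly3 R\<^esub> \<in> B}"
    then have "(x \<odot>\<^bsub>octonion_poly3 R\<^esub> \<one>\<^bsub>octonion_poly3 R\<^esub>) \<oplus>\<^bsub>octonion_poly3 R\<^esub> (y \<odot>\<^bsub>octonion_poly3 R\<^esub> \<one>\<^bsub>octonion_poly3 R\<^esub>) \<in> B"
      "(x \<odot>\<^bsub>octonion_poly3 R\<^esub> \<one>\<^bsub>octonion_poly3 R\<^esub>) \<otimes>\<^bsub>octonion_poly3 R\<^esub> (y \<odot>\<^bsub>octonion_poly3 R\<^esub> \<one>\<^bsub>octonion_poly3 R\<^esub>) \<in> B"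
      using add by auto
    then show "x \<oplus>\<^bsub>poly3 R\<^esub> y \<in> {p. p \<odot>\<^bsub>octonion_poly3 R\<^esub> \<one>\<^bsub>octonion_poly3 R\<^esub> \<in> B}"
      "x \<otimes>\<^bsub>poly3 R\<^esub> y \<in> {p. p \<odot>\<^bsub>octonion_poly3 R\<^esub> \<one>\<^bsub>octonion_poly3 R\<^esub> \<in> B}"
      using xy(1,2) by (simp_all add: O.smult_l_distr O.smult_assoc1 O.smult_mult_left)
  qed
  show "carrier (cayley_D R) \<subseteq> B"
  proof
    fix x assume "x \<in> carrier (cayley_D R)"
    then show "x \<in> B"
      using K.Oct_generated[of B x] add scal v
      by (simp add: cayley_D_simps octonion_poly3_def v_gen_def del: basic_generator.simps)
  qed
qed

definition monomial3 :: "('k, 'm) ring_scheme \<Rightarrow> nat \<Rightarrow> nat \<Rightarrow> nat \<Rightarrow> 'k poly3" where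
  "monomial3 R p q r = var3 R I1 [^]\<^bsub>poly3 R\<^esub> p \<otimes>\<^bsub>poly3 R\<^esub> var3 R I2 [^]\<^bsub>poly3 R\<^esub> q
      \<otimes>\<^bsub>poly3 R\<^esub> var3 R I3 [^]\<^bsub>poly3 R\<^esub> r"

lemma cayley_S_eq:
  "cayley_S R = {monomial3 R p q r \<odot>\<^bsub>octonion_poly3 R\<^esub> \<one>\<^bsub>octonion_poly3 R\<^esub> | p q r. True}"
  by (simp only: cayley_S_def monomial3_def)

lemma monomial3_subset:
  assumes R: "cring R" and "\<one>\<^bsub>poly3 R\<^esub> \<in> M" "\<And>i. var3 R i \<in> M"
    and "\<And>x y. \<lbrakk>x \<in> M; y \<in> M; x \<in> carrier (poly3 R); y \<in> carrier (poly3 R)\<rbrakk> \<Longrightarrow> x \<otimes>\<^bsub>poly3 R\<^esub> y \<in> M"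
  shows "monomial3 R p q r \<in> M"
proof -
  interpret K: cring "poly3 R" by (rule poly3_cring[OF R])
  have "var3 R i [^]\<^bsub>poly3 R\<^esub> n \<in> M" for i and n :: nat
    by (induction n) (use assms in auto)
  then show ?thesis unfolding monomial3_def using assms(4) R by simp
qed

lemma monomial3_mult:
  assumes R: "cring R"
  shows "monomial3 R p q r \<otimes>\<^bsub>poly3 R\<^esub> monomial3 R p' q' r' = monomial3 R (p + p') (q + q') (r + r')"
    "monomial3 R p q r \<in> carrier (poly3 R)"
proof -
  interpret K: cring "poly3 R" by (rule poly3_cring[OF R])
  show "monomial3 R p q r \<otimes>\<^bsub>poly3 R\<^esub> monomial3 R p' q' r' = monomial3 R (p + p') (q + q') (r + r')"
    unfolding monomial3_def using R by (simp add: K.nat_pow_mult[symmetric] K.m_ac)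
  show "monomial3 R p q r \<in> carrier (poly3 R)"
    unfolding monomial3_def using R by simp
qed

locale central_denominators = alternative_algebra R A
  for R :: "('k, 'm) ring_scheme" (structure) and A :: "('k, 'a, 'n) module_scheme" (structure) +
  fixes S
  assumes S_submonoid: "submonoid S A" and S_center: "S \<subseteq> alg_center A"
    and S_regular: "S \<inter> zero_divisors A = {}"

lemma cayley_S_denominators:
  assumes R: "cring R" shows "central_denominators R (cayley_D R) (cayley_S R)"
proof -
  interpret K: octonion "poly3 R" "var3 R" by (rule octonion_poly3[OF R])
  interpret O: alternative_algebra "poly3 R" "octonion_poly3 R"
    by (rule octonion_poly3_alternative[OF R])
  interpret D: alternative_algebra R "cayley_D R" by (rule cayley_D_alternative[OF R])
  let ?e = "\<lambda>p. p \<odot>\<^bsub>octonion_poly3 R\<^esub> \<one>\<^bsub>octonion_poly3 R\<^esub>"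
  have mon: "s \<in> cayley_S R \<longleftrightarrow> (\<exists>p q r. s = ?e (monomial3 R p q r))" for s
    by (auto simp: cayley_S_eq)
  have c: "?e (monomial3 R p q r) \<in> carrier (cayley_D R)" for p q r
    using monomial3_mult(2)[OF R, of p q r] by (simp add: cayley_D_simps)
  have e_mult: "?e p \<otimes>\<^bsub>octonion_poly3 R\<^esub> x = p \<odot>\<^bsub>octonion_poly3 R\<^esub> x"
    "x \<otimes>\<^bsub>octonion_poly3 R\<^esub> ?e p = p \<odot>\<^bsub>octonion_poly3 R\<^esub> x"
    if "p \<in> carrier (poly3 R)" "x \<in> carrier (octonion_poly3 R)" for p x
    using that by (simp_all add: O.smult_mult_left O.smult_mult_right)
  show ?thesis
  proof (intro central_denominators.intro central_denominators_axioms.intro D.alternative_algebra_axioms)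
    show "submonoid (cayley_S R) (cayley_D R)"
    proof
      show "cayley_S R \<subseteq> carrier (cayley_D R)" using c by (auto simp: mon)
      show "\<one>\<^bsub>cayley_D R\<^esub> \<in> cayley_S R"
        unfolding mon by (rule exI[of _ 0])+ (simp add: monomial3_def cayley_D_simps)
      fix x y assume "x \<in> cayley_S R" "y \<in> cayley_S R"
      then obtain p q r p' q' r' where xy: "x = ?e (monomial3 R p q r)" "y = ?e (monomial3 R p' q' r')"
        by (auto simp: mon)
      have "x \<otimes>\<^bsub>cayley_D R\<^esub> y = ?e (monomial3 R p q r \<otimes>\<^bsub>poly3 R\<^esub> monomial3 R p' q' r')"
        using monomial3_mult(2)[OF R] by (simp add: xy cayley_D_simps e_mult(1) O.smult_assoc1)
      then show "x \<otimes>\<^bsub>cayley_D R\<^esub> y \<in> cayley_S R"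
        using monomial3_mult(1)[OF R] by (auto simp: mon)
    qed
    show "cayley_S R \<subseteq> alg_center (cayley_D R)"
    proof
      fix s assume "s \<in> cayley_S R"
      then obtain p q r where s: "s = ?e (monomial3 R p q r)" by (auto simp: mon)
      show "s \<in> alg_center (cayley_D R)"
        unfolding s using monomial3_mult(2)[OF R]
        by (intro D.N.alg_centerI c) (simp_all add: cayley_D_simps e_mult O.smult_mult_left)
    qed
    have "x = \<zero>\<^bsub>octonion_poly3 R\<^esub>"
      if "p \<in> regular (poly3 R)" "x \<in> carrier (octonion_poly3 R)" "p \<odot>\<^bsub>octonion_poly3 R\<^esub> x = \<zero>\<^bsub>octonion_poly3 R\<^esub>" for p x
      using K.regular_smult[OF that(1)] that(2,3) by (simp add: octonion_poly3_def)
    moreover have "monomial3 R p q r \<in> regular (poly3 R)" for p q r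
      by (rule monomial3_subset[OF R K.regular_one var3_regular[OF R] K.regular_mult])
    ultimately show "cayley_S R \<inter> zero_divisors (cayley_D R) = {}"
      using e_mult monomial3_mult(2)[OF R]
      by (fastforce simp: mon zero_divisors_def cayley_D_simps)
  qed
qed

lemma z_elem_square:
  assumes R: "cring R" shows "z_elem R i = v_gen R i \<otimes>\<^bsub>cayley_D R\<^esub> v_gen R i"
proof -
  interpret K: octonion "poly3 R" "var3 R" by (rule octonion_poly3[OF R])
  show ?thesis
    using K.gen_square[of i] by (simp add: z_elem_def v_gen_def octonion_poly3_def cayley_D_simps)
qed

lemma v_gen_triple:
  assumes R: "cring R" 
  shows "alternative_ring.cayley_triple (cayley_D R) (v_gen R I1) (v_gen R I2) (v_gen R I3)"
    "v_gen R i \<in> carrier (cayley_D R)"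
proof -
  interpret K: octonion "poly3 R" "var3 R" by (rule octonion_poly3[OF R])
  interpret D: alternative_algebra R "cayley_D R" by (rule cayley_D_alternative[OF R])
  interpret O: alternative_algebra "poly3 R" "octonion_poly3 R"
    by (rule octonion_poly3_alternative[OF R])
  have inv: "\<ominus>\<^bsub>octonion_poly3 R\<^esub> x = \<ominus>\<^bsub>cayley_D R\<^esub> x" if "x \<in> carrier (octonion_poly3 R)" for x
    using D.M.minus_equality[of "\<ominus>\<^bsub>octonion_poly3 R\<^esub> x" x] that by (simp add: cayley_D_simps O.M.l_neg)
  have "O.N.cayley_triple (v_gen R I1) (v_gen R I2) (v_gen R I3)"
    using K.gen_triple unfolding octonion_poly3_def v_gen_def .
  then show "D.N.cayley_triple (v_gen R I1) (v_gen R I2) (v_gen R I3)"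
    unfolding D.N.cayley_triple_def O.N.cayley_triple_def cayley_D_simps by (metis inv O.mult_closed)
  show "v_gen R i \<in> carrier (cayley_D R)"
    using K.gen_closed[of i] unfolding cayley_D_simps octonion_poly3_def v_gen_def .
qed

lemma cayley_S_subset:
  assumes R: "cring R" and "\<one>\<^bsub>cayley_D R\<^esub> \<in> M" "\<And>i. z_elem R i \<in> M"
    and mult: "\<And>x y. \<lbrakk>x \<in> M; y \<in> M; x \<in> carrier (cayley_D R); y \<in> carrier (cayley_D R)\<rbrakk> \<Longrightarrow> x \<otimes>\<^bsub>cayley_D R\<^esub> y \<in> M"
  shows "cayley_S R \<subseteq> M"
proof -
  interpret K: octonion "poly3 R" "var3 R" by (rule octonion_poly3[OF R])
  interpret O: alternative_algebra "poly3 R" "octonion_poly3 R"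
    by (rule octonion_poly3_alternative[OF R])
  let ?e = "\<lambda>p. p \<odot>\<^bsub>octonion_poly3 R\<^esub> \<one>\<^bsub>octonion_poly3 R\<^esub>"
  have "monomial3 R p q r \<in> {m. ?e m \<in> M}" for p q r
  proof (rule monomial3_subset[OF R])
    show "\<one>\<^bsub>poly3 R\<^esub> \<in> {m. ?e m \<in> M}" using assms(2) by (simp add: cayley_D_simps)
    show "var3 R i \<in> {m. ?e m \<in> M}" for i using assms(3)[of i] by (simp add: z_elem_def)
    fix x y assume "x \<in> {m. ?e m \<in> M}" "y \<in> {m. ?e m \<in> M}" "x \<in> carrier (poly3 R)" "y \<in> carrier (poly3 R)"
    then show "x \<otimes>\<^bsub>poly3 R\<^esub> y \<in> {m. ?e m \<in> M}"
      using mult[of "?e x" "?e y"] by (simp add: cayley_D_simps O.smult_assoc1 O.smult_mult_left)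
  qed
  then show ?thesis by (auto simp: cayley_S_eq)
qed

text \<open>
  The shape in which \<open>S\<close> is the image of \<open>T\<close>. Powers in \<open>D\<close> are bracketed to the left; the right
  alternative law collects two factors \<open>v\<^sub>i\<close> into \<open>z\<^sub>i\<close>.
\<close>

lemma cayley_S_powers:
  assumes R: "cring R"
  shows "cayley_S R = {(v_gen R I1 [^]\<^bsub>cayley_D R\<^esub> p \<otimes>\<^bsub>cayley_D R\<^esub> v_gen R I2 [^]\<^bsub>cayley_D R\<^esub> q)
      \<otimes>\<^bsub>cayley_D R\<^esub> v_gen R I3 [^]\<^bsub>cayley_D R\<^esub> r | (p::nat) (q::nat) (r::nat). even p \<and> even q \<and> even r}"
proof -
  interpret K: octonion "poly3 R" "var3 R" by (rule octonion_poly3[OF R])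
  interpret O: alternative_algebra "poly3 R" "octonion_poly3 R"
    by (rule octonion_poly3_alternative[OF R])
  interpret D: alternative_algebra R "cayley_D R" by (rule cayley_D_alternative[OF R])
  let ?e = "\<lambda>p. p \<odot>\<^bsub>octonion_poly3 R\<^esub> \<one>\<^bsub>octonion_poly3 R\<^esub>"
  have e_mult: "?e p \<otimes>\<^bsub>cayley_D R\<^esub> ?e q = ?e (p \<otimes>\<^bsub>poly3 R\<^esub> q)"
    if "p \<in> carrier (poly3 R)" "q \<in> carrier (poly3 R)" for p q
    using that by (simp add: cayley_D_simps O.smult_mult_left O.smult_assoc1)
  have pow: "v_gen R i [^]\<^bsub>cayley_D R\<^esub> (2 * n) = ?e (var3 R i [^]\<^bsub>poly3 R\<^esub> n)" for i and n :: nat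
  proof (induction n)
    case 0 show ?case by (simp add: nat_pow_def cayley_D_simps)
  next
    case (Suc n)
    have c: "?e (var3 R i [^]\<^bsub>poly3 R\<^esub> n) \<in> carrier (cayley_D R)" using R by (simp add: cayley_D_simps)
    have "v_gen R i [^]\<^bsub>cayley_D R\<^esub> (2 * Suc n)
      = (v_gen R i [^]\<^bsub>cayley_D R\<^esub> (2 * n) \<otimes>\<^bsub>cayley_D R\<^esub> v_gen R i) \<otimes>\<^bsub>cayley_D R\<^esub> v_gen R i"
      by (simp add: nat_pow_def)
    also have "\<dots> = ?e (var3 R i [^]\<^bsub>poly3 R\<^esub> n) \<otimes>\<^bsub>cayley_D R\<^esub> ?e (var3 R i)"
      unfolding Suc using v_gen_triple(2)[OF R] z_elem_square[OF R, of i] c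
      by (simp add: D.N.right_alternative z_elem_def)
    also have "\<dots> = ?e (var3 R i [^]\<^bsub>poly3 R\<^esub> Suc n)" using R by (simp add: e_mult)
    finally show ?case .
  qed
  have eq: "(v_gen R I1 [^]\<^bsub>cayley_D R\<^esub> (2 * p) \<otimes>\<^bsub>cayley_D R\<^esub> v_gen R I2 [^]\<^bsub>cayley_D R\<^esub> (2 * q))
      \<otimes>\<^bsub>cayley_D R\<^esub> v_gen R I3 [^]\<^bsub>cayley_D R\<^esub> (2 * r) = ?e (monomial3 R p q r)" for p q r :: nat
    unfolding pow monomial3_def using R by (simp add: e_mult)
  show ?thesis
  proof (intro Set.set_eqI iffI)
    fix s assume "s \<in> cayley_S R"
    then obtain p q r where s: "s = ?e (monomial3 R p q r)" by (auto simp: cayley_S_eq)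
    show "s \<in> {(v_gen R I1 [^]\<^bsub>cayley_D R\<^esub> p \<otimes>\<^bsub>cayley_D R\<^esub> v_gen R I2 [^]\<^bsub>cayley_D R\<^esub> q)
      \<otimes>\<^bsub>cayley_D R\<^esub> v_gen R I3 [^]\<^bsub>cayley_D R\<^esub> r | (p::nat) (q::nat) (r::nat). even p \<and> even q \<and> even r}"
      unfolding s eq[symmetric] by (intro CollectI exI conjI, rule HOL.refl) (rule dvd_triv_left)+
  next
    fix s assume "s \<in> {(v_gen R I1 [^]\<^bsub>cayley_D R\<^esub> p \<otimes>\<^bsub>cayley_D R\<^esub> v_gen R I2 [^]\<^bsub>cayley_D R\<^esub> q)
      \<otimes>\<^bsub>cayley_D R\<^esub> v_gen R I3 [^]\<^bsub>cayley_D R\<^esub> r | (p::nat) (q::nat) (r::nat). even p \<and> even q \<and> even r}"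
    then obtain p q r :: nat where s: "s = (v_gen R I1 [^]\<^bsub>cayley_D R\<^esub> p \<otimes>\<^bsub>cayley_D R\<^esub> v_gen R I2 [^]\<^bsub>cayley_D R\<^esub> q)
      \<otimes>\<^bsub>cayley_D R\<^esub> v_gen R I3 [^]\<^bsub>cayley_D R\<^esub> r" and "even p" "even q" "even r"
      by blast
    then obtain p' q' r' where "p = 2 * p'" "q = 2 * q'" "r = 2 * r'" by (elim evenE)
    then have "s = ?e (monomial3 R p' q' r')" using s eq by (simp only:)
    then show "s \<in> cayley_S R" by (auto simp: cayley_S_eq)
  qed
qed

section \<open>Central localization\<close>

text \<open>
  The operations on equivalence classes are unions over all representatives.
\<close>

lemma UN_const_eq: "\<lbrakk>X \<noteq> {}; \<And>x. x \<in> X \<Longrightarrow> f x = c\<rbrakk> \<Longrightarrow> (\<Union>x\<in>X. f x) = c"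
  by auto

context central_denominators
begin

lemma S_closed [simp, intro]: "s \<in> S \<Longrightarrow> s \<in> carrier A"
  using submonoid.mem_carrier[OF S_submonoid] .

lemma S_mult [simp, intro]: "\<lbrakk>s \<in> S; t \<in> S\<rbrakk> \<Longrightarrow> s \<otimes>\<^bsub>A\<^esub> t \<in> S"
  using submonoid.m_closed[OF S_submonoid] .

lemma S_one [simp, intro]: "\<one>\<^bsub>A\<^esub> \<in> S"
  using submonoid.one_closed[OF S_submonoid] .

lemma S_central: "s \<in> S \<Longrightarrow> s \<in> alg_center A" using S_center by auto

lemma S_assoc:
  assumes "s \<in> S" "x \<in> carrier A" "y \<in> carrier A"
  shows "(s \<otimes>\<^bsub>A\<^esub> x) \<otimes>\<^bsub>A\<^esub> y = s \<otimes>\<^bsub>A\<^esub> (x \<otimes>\<^bsub>A\<^esub> y)" "x \<otimes>\<^bsub>A\<^esub> (s \<otimes>\<^bsub>A\<^esub> y) = s \<otimes>\<^bsub>A\<^esub> (x \<otimes>\<^bsub>A\<^esub> y)"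
  using N.alg_center_assoc[OF S_central[OF assms(1)] assms(2,3)] by auto

lemma S_comm: "\<lbrakk>s \<in> S; x \<in> carrier A\<rbrakk> \<Longrightarrow> x \<otimes>\<^bsub>A\<^esub> s = s \<otimes>\<^bsub>A\<^esub> x"
  using N.alg_center_comm[OF S_central] .

lemma S_cancel:
  assumes s: "s \<in> S" "x \<in> carrier A" "y \<in> carrier A" "s \<otimes>\<^bsub>A\<^esub> x = s \<otimes>\<^bsub>A\<^esub> y"
  shows "x = y"
proof -
  have "s \<otimes>\<^bsub>A\<^esub> (x \<ominus>\<^bsub>A\<^esub> y) = \<zero>\<^bsub>A\<^esub>"
    using s by (simp add: M.minus_eq N.r_distr N.r_minus M.r_neg)
  moreover have "s \<notin> zero_divisors A" using s(1) S_regular by auto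
  ultimately have "x \<ominus>\<^bsub>A\<^esub> y = \<zero>\<^bsub>A\<^esub>" using s(1-3) by (auto simp: zero_divisors_def)
  then show ?thesis using s by (simp add: N.diff_eq_zero_iff)
qed

abbreviation "fr \<equiv> frac A S"
abbreviation "L \<equiv> central_localization A S"

lemma frac_rel_iff: "((a, s), (b, t)) \<in> frac_rel A S \<longleftrightarrow>
  a \<in> carrier A \<and> b \<in> carrier A \<and> s \<in> S \<and> t \<in> S \<and> t \<otimes>\<^bsub>A\<^esub> a = s \<otimes>\<^bsub>A\<^esub> b"
  by (simp add: frac_rel_def)

lemma frac_rel_equiv: "equiv (carrier A \<times> S) (frac_rel A S)"
proof (rule equivI)
  show "frac_rel A S \<subseteq> (carrier A \<times> S) \<times> (carrier A \<times> S)" by (auto simp: frac_rel_def)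
  show "refl_on (carrier A \<times> S) (frac_rel A S)" by (rule refl_onI) (auto simp: frac_rel_def)
  show "sym (frac_rel A S)" by (rule symI) (auto simp: frac_rel_def)
  show "trans (frac_rel A S)"
  proof (rule transI)
    fix x y z assume xy: "(x, y) \<in> frac_rel A S" and yz: "(y, z) \<in> frac_rel A S"
    obtain a s b t c u where xyz: "x = (a, s)" "y = (b, t)" "z = (c, u)" by (metis surj_pair)
    have c: "a \<in> carrier A" "b \<in> carrier A" "c \<in> carrier A" "s \<in> S" "t \<in> S" "u \<in> S"
      and 1: "t \<otimes>\<^bsub>A\<^esub> a = s \<otimes>\<^bsub>A\<^esub> b" and 2: "u \<otimes>\<^bsub>A\<^esub> b = t \<otimes>\<^bsub>A\<^esub> c"
      using xy yz by (auto simp: xyz frac_rel_iff)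
    have "t \<otimes>\<^bsub>A\<^esub> (u \<otimes>\<^bsub>A\<^esub> a) = u \<otimes>\<^bsub>A\<^esub> (t \<otimes>\<^bsub>A\<^esub> a)" using c by (simp add: S_assoc(2))
    also have "\<dots> = s \<otimes>\<^bsub>A\<^esub> (u \<otimes>\<^bsub>A\<^esub> b)" unfolding 1 using c by (simp add: S_assoc(2))
    also have "\<dots> = t \<otimes>\<^bsub>A\<^esub> (s \<otimes>\<^bsub>A\<^esub> c)" unfolding 2 using c by (simp add: S_assoc(2))
    finally have "u \<otimes>\<^bsub>A\<^esub> a = s \<otimes>\<^bsub>A\<^esub> c" using S_cancel[OF c(5)] c by simp
    then show "(x, z) \<in> frac_rel A S" using c by (simp add: xyz frac_rel_iff)
  qed
qed

lemma frac_eq_iff: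
  assumes "a \<in> carrier A" "b \<in> carrier A" "s \<in> S" "t \<in> S"
  shows "fr a s = fr b t \<longleftrightarrow> t \<otimes>\<^bsub>A\<^esub> a = s \<otimes>\<^bsub>A\<^esub> b"
  using eq_equiv_class_iff[OF frac_rel_equiv, of "(a, s)" "(b, t)"] assms
  by (simp add: frac_def frac_rel_iff)

lemma frac_mem_iff: "(b, t) \<in> fr a s \<longleftrightarrow> ((a, s), (b, t)) \<in> frac_rel A S"
  by (simp add: frac_def)

lemma frac_nonempty: "\<lbrakk>a \<in> carrier A; s \<in> S\<rbrakk> \<Longrightarrow> fr a s \<noteq> {}"
  using frac_mem_iff[of a s a s] by (auto simp: frac_rel_iff)

lemma carrier_L: "carrier L = {fr a s | a s. a \<in> carrier A \<and> s \<in> S}"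
  by (auto simp: central_localization_def quotient_def frac_def)

lemma frac_closed [simp, intro]: "\<lbrakk>a \<in> carrier A; s \<in> S\<rbrakk> \<Longrightarrow> fr a s \<in> carrier L"
  by (auto simp: carrier_L)

lemma frac_cases:
  assumes "X \<in> carrier L" obtains a s where "a \<in> carrier A" "s \<in> S" "X = fr a s"
  using assms by (auto simp: carrier_L)

lemma frac_scale: "\<lbrakk>a \<in> carrier A; s \<in> S; t \<in> S\<rbrakk> \<Longrightarrow> fr (t \<otimes>\<^bsub>A\<^esub> a) (t \<otimes>\<^bsub>A\<^esub> s) = fr a s"
  by (simp add: frac_eq_iff S_assoc)

lemma frac_mult:
  assumes c: "a \<in> carrier A" "b \<in> carrier A" "s \<in> S" "t \<in> S"
  shows "fr a s \<otimes>\<^bsub>L\<^esub> fr b t = fr (a \<otimes>\<^bsub>A\<^esub> b) (s \<otimes>\<^bsub>A\<^esub> t)"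
proof -
  have "(\<Union>(b', t')\<in>fr b t. fr (a' \<otimes>\<^bsub>A\<^esub> b') (s' \<otimes>\<^bsub>A\<^esub> t')) = fr (a \<otimes>\<^bsub>A\<^esub> b) (s \<otimes>\<^bsub>A\<^esub> t)"
    if x: "(a', s') \<in> fr a s" for a' s'
  proof (rule UN_const_eq[OF frac_nonempty[OF c(2,4)]], clarify)
    fix b' t' assume y: "(b', t') \<in> fr b t"
    have d: "a' \<in> carrier A" "b' \<in> carrier A" "s' \<in> S" "t' \<in> S"
      and e: "s' \<otimes>\<^bsub>A\<^esub> a = s \<otimes>\<^bsub>A\<^esub> a'" "t' \<otimes>\<^bsub>A\<^esub> b = t \<otimes>\<^bsub>A\<^esub> b'"
      using x y by (auto simp: frac_mem_iff frac_rel_iff)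
    have *: "(u \<otimes>\<^bsub>A\<^esub> v) \<otimes>\<^bsub>A\<^esub> (x \<otimes>\<^bsub>A\<^esub> y) = (u \<otimes>\<^bsub>A\<^esub> x) \<otimes>\<^bsub>A\<^esub> (v \<otimes>\<^bsub>A\<^esub> y)"
      if "u \<in> S" "v \<in> S" "x \<in> carrier A" "y \<in> carrier A" for u v x y
      using that by (simp add: S_assoc)
    show "fr (a' \<otimes>\<^bsub>A\<^esub> b') (s' \<otimes>\<^bsub>A\<^esub> t') = fr (a \<otimes>\<^bsub>A\<^esub> b) (s \<otimes>\<^bsub>A\<^esub> t)"
      using c d by (simp add: frac_eq_iff * e)
  qed
  then show ?thesis
    unfolding central_localization_def
    by (simp, intro UN_const_eq[OF frac_nonempty[OF c(1,3)]], auto simp: split_beta)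
qed

lemma frac_add_general:
  assumes c: "a \<in> carrier A" "b \<in> carrier A" "s \<in> S" "t \<in> S"
  shows "fr a s \<oplus>\<^bsub>L\<^esub> fr b t = fr (t \<otimes>\<^bsub>A\<^esub> a \<oplus>\<^bsub>A\<^esub> s \<otimes>\<^bsub>A\<^esub> b) (s \<otimes>\<^bsub>A\<^esub> t)"
proof -
  have "(\<Union>(b', t')\<in>fr b t. fr (t' \<otimes>\<^bsub>A\<^esub> a' \<oplus>\<^bsub>A\<^esub> s' \<otimes>\<^bsub>A\<^esub> b') (s' \<otimes>\<^bsub>A\<^esub> t'))
      = fr (t \<otimes>\<^bsub>A\<^esub> a \<oplus>\<^bsub>A\<^esub> s \<otimes>\<^bsub>A\<^esub> b) (s \<otimes>\<^bsub>A\<^esub> t)"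
    if x: "(a', s') \<in> fr a s" for a' s'
  proof (rule UN_const_eq[OF frac_nonempty[OF c(2,4)]], clarify)
    fix b' t' assume y: "(b', t') \<in> fr b t"
    have d: "a' \<in> carrier A" "b' \<in> carrier A" "s' \<in> S" "t' \<in> S"
      and e: "s' \<otimes>\<^bsub>A\<^esub> a = s \<otimes>\<^bsub>A\<^esub> a'" "t' \<otimes>\<^bsub>A\<^esub> b = t \<otimes>\<^bsub>A\<^esub> b'"
      using x y by (auto simp: frac_mem_iff frac_rel_iff)
    have 1: "(s \<otimes>\<^bsub>A\<^esub> t) \<otimes>\<^bsub>A\<^esub> (t' \<otimes>\<^bsub>A\<^esub> a') = (s' \<otimes>\<^bsub>A\<^esub> t') \<otimes>\<^bsub>A\<^esub> (t \<otimes>\<^bsub>A\<^esub> a)"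
    proof -
      have "(s \<otimes>\<^bsub>A\<^esub> t) \<otimes>\<^bsub>A\<^esub> (t' \<otimes>\<^bsub>A\<^esub> a') = (t \<otimes>\<^bsub>A\<^esub> t') \<otimes>\<^bsub>A\<^esub> (s \<otimes>\<^bsub>A\<^esub> a')" using c d by (simp add: S_assoc)
      also have "\<dots> = (t \<otimes>\<^bsub>A\<^esub> t') \<otimes>\<^bsub>A\<^esub> (s' \<otimes>\<^bsub>A\<^esub> a)" by (simp only: e)
      also have "\<dots> = (s' \<otimes>\<^bsub>A\<^esub> t') \<otimes>\<^bsub>A\<^esub> (t \<otimes>\<^bsub>A\<^esub> a)" using c d by (simp add: S_assoc)
      finally show ?thesis .
    qed
    have 2: "(s \<otimes>\<^bsub>A\<^esub> t) \<otimes>\<^bsub>A\<^esub> (s' \<otimes>\<^bsub>A\<^esub> b') = (s' \<otimes>\<^bsub>A\<^esub> t') \<otimes>\<^bsub>A\<^esub> (s \<otimes>\<^bsub>A\<^esub> b)"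
    proof -
      have "(s \<otimes>\<^bsub>A\<^esub> t) \<otimes>\<^bsub>A\<^esub> (s' \<otimes>\<^bsub>A\<^esub> b') = (s \<otimes>\<^bsub>A\<^esub> s') \<otimes>\<^bsub>A\<^esub> (t \<otimes>\<^bsub>A\<^esub> b')" using c d by (simp add: S_assoc)
      also have "\<dots> = (s \<otimes>\<^bsub>A\<^esub> s') \<otimes>\<^bsub>A\<^esub> (t' \<otimes>\<^bsub>A\<^esub> b)" by (simp only: e)
      also have "\<dots> = (s' \<otimes>\<^bsub>A\<^esub> t') \<otimes>\<^bsub>A\<^esub> (s \<otimes>\<^bsub>A\<^esub> b)" using c d by (simp add: S_assoc)
      finally show ?thesis .
    qed
    show "fr (t' \<otimes>\<^bsub>A\<^esub> a' \<oplus>\<^bsub>A\<^esub> s' \<otimes>\<^bsub>A\<^esub> b') (s' \<otimes>\<^bsub>A\<^esub> t') = fr (t \<otimes>\<^bsub>A\<^esub> a \<oplus>\<^bsub>A\<^esub> s \<otimes>\<^bsub>A\<^esub> b) (s \<otimes>\<^bsub>A\<^esub> t)"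
      using c d by (simp add: frac_eq_iff N.r_distr 1 2)
  qed
  then show ?thesis
    unfolding central_localization_def
    by (simp, intro UN_const_eq[OF frac_nonempty[OF c(1,3)]], auto simp: split_beta)
qed

lemma frac_add:
  assumes c: "a \<in> carrier A" "b \<in> carrier A" "s \<in> S"
  shows "fr a s \<oplus>\<^bsub>L\<^esub> fr b s = fr (a \<oplus>\<^bsub>A\<^esub> b) s"
  using frac_add_general[OF c(1,2,3,3)] frac_scale[of "a \<oplus>\<^bsub>A\<^esub> b" s s] c by (simp add: N.r_distr)

lemma frac_smult:
  assumes c: "c \<in> carrier R" "a \<in> carrier A" "s \<in> S"
  shows "c \<odot>\<^bsub>L\<^esub> fr a s = fr (c \<odot>\<^bsub>A\<^esub> a) s"
proof -
  have "fr (c \<odot>\<^bsub>A\<^esub> a') s' = fr (c \<odot>\<^bsub>A\<^esub> a) s" if x: "(a', s') \<in> fr a s" for a' s'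
  proof -
    have d: "a' \<in> carrier A" "s' \<in> S" and e: "s' \<otimes>\<^bsub>A\<^esub> a = s \<otimes>\<^bsub>A\<^esub> a'"
      using x by (auto simp: frac_mem_iff frac_rel_iff)
    show ?thesis using c d by (simp add: frac_eq_iff smult_mult_right e)
  qed
  then show ?thesis
    unfolding central_localization_def
    by (simp, intro UN_const_eq[OF frac_nonempty[OF c(2,3)]], auto simp: split_beta)
qed

lemma L_one: "\<one>\<^bsub>L\<^esub> = fr \<one>\<^bsub>A\<^esub> \<one>\<^bsub>A\<^esub>" and L_zero: "\<zero>\<^bsub>L\<^esub> = fr \<zero>\<^bsub>A\<^esub> \<one>\<^bsub>A\<^esub>"
  by (simp_all add: central_localization_def)

lemma frac_zero: "s \<in> S \<Longrightarrow> fr \<zero>\<^bsub>A\<^esub> s = \<zero>\<^bsub>L\<^esub>"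
  by (simp add: L_zero frac_eq_iff)

text \<open>
  With common denominators the axioms of an algebra for fractions become those for numerators.
\<close>

lemma common_denominator2:
  assumes "X \<in> carrier L" "Y \<in> carrier L"
  obtains a b s where "a \<in> carrier A" "b \<in> carrier A" "s \<in> S" "X = fr a s" "Y = fr b s"
proof -
  obtain a s b t where 1: "a \<in> carrier A" "s \<in> S" "X = fr a s" and 2: "b \<in> carrier A" "t \<in> S" "Y = fr b t"
    using frac_cases assms by metis
  have "X = fr (t \<otimes>\<^bsub>A\<^esub> a) (s \<otimes>\<^bsub>A\<^esub> t)" using 1 2 by (simp add: frac_eq_iff S_assoc)
  moreover have "Y = fr (s \<otimes>\<^bsub>A\<^esub> b) (s \<otimes>\<^bsub>A\<^esub> t)" using 1 2 by (simp add: frac_scale)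
  ultimately show ?thesis using that[of "t \<otimes>\<^bsub>A\<^esub> a" "s \<otimes>\<^bsub>A\<^esub> b" "s \<otimes>\<^bsub>A\<^esub> t"] 1 2 by simp
qed

lemma common_denominator3:
  assumes "X \<in> carrier L" "Y \<in> carrier L" "Z \<in> carrier L"
  obtains a b c s where "a \<in> carrier A" "b \<in> carrier A" "c \<in> carrier A" "s \<in> S"
    "X = fr a s" "Y = fr b s" "Z = fr c s"
proof -
  obtain a b s where 1: "a \<in> carrier A" "b \<in> carrier A" "s \<in> S" "X = fr a s" "Y = fr b s"
    using common_denominator2 assms by metis
  obtain c t where 2: "c \<in> carrier A" "t \<in> S" "Z = fr c t" using frac_cases assms by metis
  have "X = fr (t \<otimes>\<^bsub>A\<^esub> a) (s \<otimes>\<^bsub>A\<^esub> t)" "Y = fr (t \<otimes>\<^bsub>A\<^esub> b) (s \<otimes>\<^bsub>A\<^esub> t)" using 1 2 by (simp_all add: frac_eq_iff S_assoc)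
  moreover have "Z = fr (s \<otimes>\<^bsub>A\<^esub> c) (s \<otimes>\<^bsub>A\<^esub> t)" using 1 2 by (simp add: frac_scale)
  ultimately show ?thesis
    using that[of "t \<otimes>\<^bsub>A\<^esub> a" "t \<otimes>\<^bsub>A\<^esub> b" "s \<otimes>\<^bsub>A\<^esub> c" "s \<otimes>\<^bsub>A\<^esub> t"] 1 2 by simp
qed

lemma localization_alternative: "alternative_algebra R L"
proof -
  interpret L: abelian_group L
  proof (rule abelian_groupI)
    fix X assume X: "X \<in> carrier L"
    then obtain a s where a: "a \<in> carrier A" "s \<in> S" "X = fr a s" by (rule frac_cases)
    show "\<exists>Y\<in>carrier L. Y \<oplus>\<^bsub>L\<^esub> X = \<zero>\<^bsub>L\<^esub>"
      using a by (intro bexI[of _ "fr (\<ominus>\<^bsub>A\<^esub> a) s"]) (simp_all add: frac_add M.l_neg frac_zero)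
    show "\<zero>\<^bsub>L\<^esub> \<oplus>\<^bsub>L\<^esub> X = X"
      using a frac_add[of "\<zero>\<^bsub>A\<^esub>" a s] by (simp add: frac_zero)
    fix Y assume Y: "Y \<in> carrier L"
    obtain a b s where ab: "a \<in> carrier A" "b \<in> carrier A" "s \<in> S" "X = fr a s" "Y = fr b s"
      using common_denominator2[OF X Y] .
    show "X \<oplus>\<^bsub>L\<^esub> Y \<in> carrier L" "X \<oplus>\<^bsub>L\<^esub> Y = Y \<oplus>\<^bsub>L\<^esub> X"
      using ab by (simp_all add: frac_add M.a_comm)
    fix Z assume Z: "Z \<in> carrier L"
    obtain a b c s where "a \<in> carrier A" "b \<in> carrier A" "c \<in> carrier A" "s \<in> S"
      "X = fr a s" "Y = fr b s" "Z = fr c s"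
      using common_denominator3[OF X Y Z] .
    then show "(X \<oplus>\<^bsub>L\<^esub> Y) \<oplus>\<^bsub>L\<^esub> Z = X \<oplus>\<^bsub>L\<^esub> (Y \<oplus>\<^bsub>L\<^esub> Z)"
      by (simp add: frac_add M.a_assoc)
  qed (simp add: L_zero)
  interpret L: nonassoc_algebra R L
  proof unfold_locales
    fix c X assume c: "c \<in> carrier R" and X: "X \<in> carrier L"
    obtain a s where a: "a \<in> carrier A" "s \<in> S" "X = fr a s" using frac_cases[OF X] .
    show "c \<odot>\<^bsub>L\<^esub> X \<in> carrier L" using a c by (simp add: frac_smult)
    fix d assume d: "d \<in> carrier R"
    show "(c \<oplus> d) \<odot>\<^bsub>L\<^esub> X = c \<odot>\<^bsub>L\<^esub> X \<oplus>\<^bsub>L\<^esub> d \<odot>\<^bsub>L\<^esub> X" "(c \<otimes> d) \<odot>\<^bsub>L\<^esub> X = c \<odot>\<^bsub>L\<^esub> (d \<odot>\<^bsub>L\<^esub> X)"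
      using a c d by (simp_all add: frac_smult frac_add smult_l_distr smult_assoc1)
  next
    fix X assume X: "X \<in> carrier L"
    obtain a s where a: "a \<in> carrier A" "s \<in> S" "X = fr a s" using frac_cases[OF X] .
    show "\<one> \<odot>\<^bsub>L\<^esub> X = X" "\<one>\<^bsub>L\<^esub> \<otimes>\<^bsub>L\<^esub> X = X" "X \<otimes>\<^bsub>L\<^esub> \<one>\<^bsub>L\<^esub> = X"
      using a by (simp_all add: frac_smult frac_mult L_one)
  next
    fix c X Y assume c: "c \<in> carrier R" and X: "X \<in> carrier L" and Y: "Y \<in> carrier L"
    obtain a b s where ab: "a \<in> carrier A" "b \<in> carrier A" "s \<in> S" "X = fr a s" "Y = fr b s"
      using common_denominator2[OF X Y] .
    show "c \<odot>\<^bsub>L\<^esub> (X \<oplus>\<^bsub>L\<^esub> Y) = c \<odot>\<^bsub>L\<^esub> X \<oplus>\<^bsub>L\<^esub> c \<odot>\<^bsub>L\<^esub> Y" "(c \<odot>\<^bsub>L\<^esub> X) \<otimes>\<^bsub>L\<^esub> Y = c \<odot>\<^bsub>L\<^esub> (X \<otimes>\<^bsub>L\<^esub> Y)"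
      "X \<otimes>\<^bsub>L\<^esub> (c \<odot>\<^bsub>L\<^esub> Y) = c \<odot>\<^bsub>L\<^esub> (X \<otimes>\<^bsub>L\<^esub> Y)"
      using ab c by (simp_all add: frac_smult frac_add frac_mult smult_r_distr smult_mult_left smult_mult_right)
  next
    fix X Y assume X: "X \<in> carrier L" and Y: "Y \<in> carrier L"
    obtain a b s where ab: "a \<in> carrier A" "b \<in> carrier A" "s \<in> S" "X = fr a s" "Y = fr b s"
      using common_denominator2[OF X Y] .
    show "X \<otimes>\<^bsub>L\<^esub> Y \<in> carrier L" using ab by (simp add: frac_mult)
  next
    fix X Y Z assume X: "X \<in> carrier L" and Y: "Y \<in> carrier L" and Z: "Z \<in> carrier L"
    obtain a b c s where "a \<in> carrier A" "b \<in> carrier A" "c \<in> carrier A" "s \<in> S"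
      "X = fr a s" "Y = fr b s" "Z = fr c s"
      using common_denominator3[OF X Y Z] .
    then show "X \<otimes>\<^bsub>L\<^esub> (Y \<oplus>\<^bsub>L\<^esub> Z) = X \<otimes>\<^bsub>L\<^esub> Y \<oplus>\<^bsub>L\<^esub> X \<otimes>\<^bsub>L\<^esub> Z"
      "(X \<oplus>\<^bsub>L\<^esub> Y) \<otimes>\<^bsub>L\<^esub> Z = X \<otimes>\<^bsub>L\<^esub> Z \<oplus>\<^bsub>L\<^esub> Y \<otimes>\<^bsub>L\<^esub> Z"
      by (simp_all add: frac_mult frac_add N.l_distr N.r_distr)
  qed (simp add: L_one)
  show ?thesis
  proof (rule L.alternative_algebraI)
    fix X Y assume X: "X \<in> carrier L" and Y: "Y \<in> carrier L"
    obtain a b s where ab: "a \<in> carrier A" "b \<in> carrier A" "s \<in> S" "X = fr a s" "Y = fr b s"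
      using common_denominator2[OF X Y] .
    show "(X \<otimes>\<^bsub>L\<^esub> X) \<otimes>\<^bsub>L\<^esub> Y = X \<otimes>\<^bsub>L\<^esub> (X \<otimes>\<^bsub>L\<^esub> Y)" "(Y \<otimes>\<^bsub>L\<^esub> X) \<otimes>\<^bsub>L\<^esub> X = Y \<otimes>\<^bsub>L\<^esub> (X \<otimes>\<^bsub>L\<^esub> X)"
      using ab by (simp_all add: frac_mult N.left_alternative N.right_alternative)
  qed
qed

lemma frac_hom: "(\<lambda>a. fr a \<one>\<^bsub>A\<^esub>) \<in> alg_hom R A L"
  by (intro alg_homI ring_hom_memI) (simp_all add: frac_mult frac_add frac_smult L_one)

text \<open>
  The image of \<open>a / s\<close> is the unique solution \<open>x\<close> of \<open>g s x = g a\<close>, so that no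
  inverse of \<open>g s\<close> has to be chosen. Each homomorphism property is the observation that the expected element
  solves the equation.
\<close>

lemma localization_hom:
  assumes B: "alternative_algebra R B" and g: "g \<in> alg_hom R A B"
    and units: "\<And>s. s \<in> S \<Longrightarrow> g s \<in> alternative_ring.central_units B"
  obtains h where "h \<in> alg_hom R L B"
    "\<And>a s. \<lbrakk>a \<in> carrier A; s \<in> S\<rbrakk> \<Longrightarrow> g s \<otimes>\<^bsub>B\<^esub> h (fr a s) = g a"
proof -
  interpret B: alternative_algebra R B by fact
  note gh = alg_homD[OF g]
  define P where "P X x \<longleftrightarrow> x \<in> carrier B \<and> (\<forall>(a, s)\<in>X. g s \<otimes>\<^bsub>B\<^esub> x = g a)" for X x
  define h where "h X = (THE x. P X x)" for X
  have gc: "g s \<in> alg_center B" if "s \<in> S" for s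
    using units[OF that] by (simp add: B.N.central_units_def)
  have h_eq: "h (fr a s) = x"
    if c: "a \<in> carrier A" "s \<in> S" and x: "x \<in> carrier B" "g s \<otimes>\<^bsub>B\<^esub> x = g a" for a s x
    unfolding h_def
  proof (rule the_equality)
    have "g s' \<otimes>\<^bsub>B\<^esub> x = g a'" if y: "(a', s') \<in> fr a s" for a' s'
    proof -
      have d: "a' \<in> carrier A" "s' \<in> S" and e: "s' \<otimes>\<^bsub>A\<^esub> a = s \<otimes>\<^bsub>A\<^esub> a'"
        using y by (auto simp: frac_mem_iff frac_rel_iff)
      have "g s \<otimes>\<^bsub>B\<^esub> (g s' \<otimes>\<^bsub>B\<^esub> x) = g s' \<otimes>\<^bsub>B\<^esub> (g s \<otimes>\<^bsub>B\<^esub> x)"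
        using B.N.alg_center_assoc(2)[OF gc[OF c(2)], of "g s'" x] x d gh(3) by simp
      also have "\<dots> = g s \<otimes>\<^bsub>B\<^esub> g a'"
        using c d e by (simp add: x(2) flip: gh(5))
      finally show ?thesis
        using B.N.central_units_cancel[OF units[OF c(2)]] x d gh(3) by simp
    qed
    then show "P (fr a s) x" using x by (auto simp: P_def)
    fix y assume "P (fr a s) y"
    moreover have "(a, s) \<in> fr a s" using c by (simp add: frac_mem_iff frac_rel_iff)
    ultimately have "y \<in> carrier B" "g s \<otimes>\<^bsub>B\<^esub> y = g a" by (auto simp: P_def)
    then show "y = x" using B.N.central_units_cancel[OF units[OF c(2)]] x by simp
  qed
  have h: "h (fr a s) \<in> carrier B" "g s \<otimes>\<^bsub>B\<^esub> h (fr a s) = g a" if as: "a \<in> carrier A" "s \<in> S" for a s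
  proof -
    obtain x where x: "x \<in> carrier B" "g s \<otimes>\<^bsub>B\<^esub> x = g a"
      using B.N.central_units_solve[OF units[OF as(2)] gh(3)[OF as(1)]] .
    then show "h (fr a s) \<in> carrier B" "g s \<otimes>\<^bsub>B\<^esub> h (fr a s) = g a"
      using h_eq[OF as x] x by simp_all
  qed
  have hom: "h \<in> alg_hom R L B"
  proof (intro alg_homI ring_hom_memI)
    fix X assume X: "X \<in> carrier L"
    then obtain a s where a: "a \<in> carrier A" "s \<in> S" "X = fr a s" by (rule frac_cases)
    show "h X \<in> carrier B" using a h by simp
    fix Y assume Y: "Y \<in> carrier L"
    obtain a b s where ab: "a \<in> carrier A" "b \<in> carrier A" "s \<in> S" "X = fr a s" "Y = fr b s"
      using common_denominator2[OF X Y] .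
    note ha = h[OF ab(1,3)] and hb = h[OF ab(2,3)] and s = gc[OF ab(3)] B.N.alg_center_closed[OF gc[OF ab(3)]]
    have "h (fr (a \<oplus>\<^bsub>A\<^esub> b) s) = h (fr a s) \<oplus>\<^bsub>B\<^esub> h (fr b s)"
      using ab ha hb s by (intro h_eq) (simp_all add: B.N.r_distr gh(4))
    then show "h (X \<oplus>\<^bsub>L\<^esub> Y) = h X \<oplus>\<^bsub>B\<^esub> h Y" using ab by (simp add: frac_add)
    have "(g s \<otimes>\<^bsub>B\<^esub> g s) \<otimes>\<^bsub>B\<^esub> (h (fr a s) \<otimes>\<^bsub>B\<^esub> h (fr b s))
        = (g s \<otimes>\<^bsub>B\<^esub> h (fr a s)) \<otimes>\<^bsub>B\<^esub> (g s \<otimes>\<^bsub>B\<^esub> h (fr b s))"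
      using ha(1) hb(1) s B.N.alg_center_assoc(1)[OF s, of "h (fr a s) \<otimes>\<^bsub>B\<^esub> h (fr b s)"]
        B.N.alg_center_assoc(1)[OF s(1) ha(1), of "g s \<otimes>\<^bsub>B\<^esub> h (fr b s)"]
        B.N.alg_center_assoc(2)[OF s(1) ha(1) hb(1)]
      by (simp del: ha(2) hb(2))
    then have "h (fr (a \<otimes>\<^bsub>A\<^esub> b) (s \<otimes>\<^bsub>A\<^esub> s)) = h (fr a s) \<otimes>\<^bsub>B\<^esub> h (fr b s)"
      using ab ha hb s by (intro h_eq) (simp_all add: gh(5))
    then show "h (X \<otimes>\<^bsub>L\<^esub> Y) = h X \<otimes>\<^bsub>B\<^esub> h Y" using ab by (simp add: frac_mult)
  next
    show "h \<one>\<^bsub>L\<^esub> = \<one>\<^bsub>B\<^esub>" unfolding L_one by (intro h_eq) (simp_all add: gh(6))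
    fix c X assume c: "c \<in> carrier R" and X: "X \<in> carrier L"
    then obtain a s where a: "a \<in> carrier A" "s \<in> S" "X = fr a s" using frac_cases by blast
    have "h (fr (c \<odot>\<^bsub>A\<^esub> a) s) = c \<odot>\<^bsub>B\<^esub> h (fr a s)"
      using a c h[OF a(1,2)] gh(3)[OF S_closed[OF a(2)]] by (intro h_eq) (simp_all add: gh(2) B.smult_mult_right)
    then show "h (c \<odot>\<^bsub>L\<^esub> X) = c \<odot>\<^bsub>B\<^esub> h X" using a c by (simp add: frac_smult)
  qed
  show ?thesis using that[OF hom h(2)] .
qed

end

text \<open>
  A bijective homomorphism that matches the denominators maps each fraction, as a set of pairs, onto
  a fraction.
\<close>

lemma localization_transport:
  assumes A: "central_denominators R A S" and B: "central_denominators R B T"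
    and f: "f \<in> alg_iso R A B" and ST: "f ` S = T"
  obtains h where "h \<in> alg_iso R (central_localization A S) (central_localization B T)"
    "\<And>a s. \<lbrakk>a \<in> carrier A; s \<in> S\<rbrakk> \<Longrightarrow> h (frac A S a s) = frac B T (f a) (f s)"
proof -
  interpret A: central_denominators R A S by fact
  interpret B: central_denominators R B T by fact
  have hom: "f \<in> alg_hom R A B" and bij: "bij_betw f (carrier A) (carrier B)"
    using f by (auto simp: alg_iso_def)
  note fh = alg_homD[OF hom]
  have fS: "f s \<in> T" if "s \<in> S" for s using that ST by auto
  have inj: "f x = f y \<longleftrightarrow> x = y" if "x \<in> carrier A" "y \<in> carrier A" for x y
    using bij that by (auto simp: bij_betw_def inj_on_def)
  define h where "h X = map_prod f f ` X" for X
  have eq: "f t \<otimes>\<^bsub>B\<^esub> f a = f s \<otimes>\<^bsub>B\<^esub> f b \<longleftrightarrow> t \<otimes>\<^bsub>A\<^esub> a = s \<otimes>\<^bsub>A\<^esub> b"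
    if "a \<in> carrier A" "b \<in> carrier A" "s \<in> S" "t \<in> S" for a b s t
    using that inj[of "t \<otimes>\<^bsub>A\<^esub> a" "s \<otimes>\<^bsub>A\<^esub> b"] by (simp add: fh(5))
  have h: "h (frac A S a s) = frac B T (f a) (f s)" if c: "a \<in> carrier A" "s \<in> S" for a s
  proof (intro Set.set_eqI iffI)
    fix y assume "y \<in> h (frac A S a s)"
    then obtain b t where "y = (f b, f t)" "(b, t) \<in> frac A S a s" by (auto simp: h_def)
    then show "y \<in> frac B T (f a) (f s)"
      using c fh(3) fS eq by (auto simp: A.frac_mem_iff B.frac_mem_iff A.frac_rel_iff B.frac_rel_iff)
  next
    fix y assume y: "y \<in> frac B T (f a) (f s)"
    obtain b' t' where y': "y = (b', t')" by (cases y)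
    have m: "b' \<in> carrier B" "t' \<in> T" "t' \<otimes>\<^bsub>B\<^esub> f a = f s \<otimes>\<^bsub>B\<^esub> b'"
      using y by (auto simp: y' B.frac_mem_iff B.frac_rel_iff)
    obtain b where b: "b \<in> carrier A" "b' = f b" using m(1) bij by (auto simp: bij_betw_def)
    obtain t where t: "t \<in> S" "t' = f t" using m(2) ST by auto
    have "(b, t) \<in> frac A S a s"
      using m(3) c b t eq by (simp add: A.frac_mem_iff A.frac_rel_iff)
    then show "y \<in> h (frac A S a s)" unfolding h_def y' b(2) t(2) by force
  qed
  have "h \<in> alg_hom R (central_localization A S) (central_localization B T)"
  proof (intro alg_homI ring_hom_memI)
    fix X assume X: "X \<in> carrier A.L"
    then obtain a s where a: "a \<in> carrier A" "s \<in> S" "X = A.fr a s" by (rule A.frac_cases)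
    show "h X \<in> carrier B.L" using a fh fS by (simp add: h)
    fix Y assume Y: "Y \<in> carrier A.L"
    obtain a b s where "a \<in> carrier A" "b \<in> carrier A" "s \<in> S" "X = A.fr a s" "Y = A.fr b s"
      using A.common_denominator2[OF X Y] .
    then show "h (X \<oplus>\<^bsub>A.L\<^esub> Y) = h X \<oplus>\<^bsub>B.L\<^esub> h Y" "h (X \<otimes>\<^bsub>A.L\<^esub> Y) = h X \<otimes>\<^bsub>B.L\<^esub> h Y"
      using fh fS by (simp_all add: h A.frac_add B.frac_add A.frac_mult B.frac_mult)
  next
    show "h \<one>\<^bsub>A.L\<^esub> = \<one>\<^bsub>B.L\<^esub>" by (simp add: A.L_one B.L_one h fh)
    fix c X assume "c \<in> carrier R" and X: "X \<in> carrier A.L"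
    moreover obtain a s where "a \<in> carrier A" "s \<in> S" "X = A.fr a s" using A.frac_cases[OF X] .
    ultimately show "h (c \<odot>\<^bsub>A.L\<^esub> X) = c \<odot>\<^bsub>B.L\<^esub> h X"
      using fh fS by (simp add: h A.frac_smult B.frac_smult)
  qed
  moreover have "bij_betw h (carrier A.L) (carrier B.L)"
    unfolding bij_betw_def
  proof
    show "inj_on h (carrier A.L)"
    proof (rule inj_onI)
      fix X Y assume X: "X \<in> carrier A.L" and Y: "Y \<in> carrier A.L" and XY: "h X = h Y"
      obtain a b s where ab: "a \<in> carrier A" "b \<in> carrier A" "s \<in> S" "X = A.fr a s" "Y = A.fr b s"
        using A.common_denominator2[OF X Y] .
      then have "f s \<otimes>\<^bsub>B\<^esub> f a = f s \<otimes>\<^bsub>B\<^esub> f b"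
        using XY fh(3) fS by (simp add: h B.frac_eq_iff)
      then show "X = Y" using eq[OF ab(1,2,3,3)] ab by (simp add: A.frac_eq_iff)
    qed
    show "h ` carrier A.L = carrier B.L"
    proof
      show "h ` carrier A.L \<subseteq> carrier B.L"
        using h fh fS by (auto elim!: A.frac_cases)
      show "carrier B.L \<subseteq> h ` carrier A.L"
      proof
        fix Y assume "Y \<in> carrier B.L"
        then obtain b t where Y: "b \<in> carrier B" "t \<in> T" "Y = B.fr b t" by (rule B.frac_cases)
        obtain a where a: "a \<in> carrier A" "b = f a" using Y bij by (auto simp: bij_betw_def)
        obtain s where s: "s \<in> S" "t = f s" using Y ST by auto
        show "Y \<in> h ` carrier A.L"
          using h[OF a(1) s(1)] a s Y by (metis A.frac_closed image_eqI)
      qed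
    qed
  qed
  ultimately show ?thesis using that h by (simp add: alg_iso_def)
qed

section \<open>Generating sets\<close>

lemma (in alternative_algebra) alg_hom_zero:
  assumes "alternative_algebra R B" "f \<in> alg_hom R A B"
  shows "f \<zero>\<^bsub>A\<^esub> = \<zero>\<^bsub>B\<^esub>" "x \<in> carrier A \<Longrightarrow> f (\<ominus>\<^bsub>A\<^esub> x) = \<ominus>\<^bsub>B\<^esub> f x"
proof -
  interpret B: alternative_algebra R B by fact
  show "f \<zero>\<^bsub>A\<^esub> = \<zero>\<^bsub>B\<^esub>" "x \<in> carrier A \<Longrightarrow> f (\<ominus>\<^bsub>A\<^esub> x) = \<ominus>\<^bsub>B\<^esub> f x"
    using B.N.ring_hom_zero_minus[OF M.abelian_group_axioms alg_homD(1)[OF assms(2)]] by auto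
qed

lemma (in alternative_algebra) alg_hom_cayley_triple:
  assumes B: "alternative_algebra R B" and f: "f \<in> alg_hom R A B" and abc: "N.cayley_triple a b c"
  shows "alternative_ring.cayley_triple B (f a) (f b) (f c)"
proof -
  interpret B: alternative_algebra R B by fact
  note T = N.cayley_tripleD[OF abc] and h = alg_homD[OF f] and m = alg_hom_zero(2)[OF B f]
  have "f a \<otimes>\<^bsub>B\<^esub> f b = \<ominus>\<^bsub>B\<^esub> (f b \<otimes>\<^bsub>B\<^esub> f a)" "f a \<otimes>\<^bsub>B\<^esub> f c = \<ominus>\<^bsub>B\<^esub> (f c \<otimes>\<^bsub>B\<^esub> f a)"
    "f b \<otimes>\<^bsub>B\<^esub> f c = \<ominus>\<^bsub>B\<^esub> (f c \<otimes>\<^bsub>B\<^esub> f b)"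
    using T(1-3) by (metis T(4) h(5) m mult_closed, metis T(5) h(5) m mult_closed, metis T(6) h(5) m mult_closed)
  moreover have "(f a \<otimes>\<^bsub>B\<^esub> f b) \<otimes>\<^bsub>B\<^esub> f c = \<ominus>\<^bsub>B\<^esub> (f a \<otimes>\<^bsub>B\<^esub> (f b \<otimes>\<^bsub>B\<^esub> f c))"
    using T(1-3) by (metis T(7) h(5) m mult_closed)
  ultimately show ?thesis unfolding B.N.cayley_triple_def using T(1-3) h(3) by blast
qed

definition generates :: "('k, 'm) ring_scheme \<Rightarrow> ('k, 'a, 'n) module_scheme \<Rightarrow> 'a set \<Rightarrow> bool" where
  "generates R A X \<longleftrightarrow> X \<subseteq> carrier A \<and> (\<forall>M. unital_subalgebra R A M \<longrightarrow> X \<subseteq> M \<longrightarrow> carrier A \<subseteq> M)"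

lemma generatesD: "\<lbrakk>generates R A X; unital_subalgebra R A M; X \<subseteq> M\<rbrakk> \<Longrightarrow> carrier A \<subseteq> M"
  unfolding generates_def by blast

lemma generates_generated_subalgebra:
  "\<lbrakk>X \<subseteq> carrier A; carrier A = generated_subalgebra R A X\<rbrakk> \<Longrightarrow> generates R A X"
  unfolding generates_def generated_subalgebra_def by blast

lemma (in alternative_algebra) hom_eq_on_generators:
  assumes B: "alternative_algebra R B" and f: "f \<in> alg_hom R A B" and g: "g \<in> alg_hom R A B"
    and X: "generates R A X" and eq: "\<And>x. x \<in> X \<Longrightarrow> f x = g x" and x: "x \<in> carrier A"
  shows "f x = g x"
proof -
  have "unital_subalgebra R A {x \<in> carrier A. f x = g x}"
    using alg_homD[OF f] alg_homD[OF g] alg_hom_zero(1)[OF B f] alg_hom_zero(1)[OF B g]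
    by (auto simp: unital_subalgebra_def)
  then have "carrier A \<subseteq> {x \<in> carrier A. f x = g x}"
    using generatesD[OF X] eq X by (auto simp: generates_def)
  then show ?thesis using x by auto
qed

lemma (in alternative_algebra) hom_onto_generators:
  assumes B: "alternative_algebra R B" and f: "f \<in> alg_hom R A B"
    and X: "generates R B X" and X': "X \<subseteq> f ` carrier A"
  shows "f ` carrier A = carrier B"
proof
  interpret B: alternative_algebra R B by fact
  note h = alg_homD[OF f]
  show "f ` carrier A \<subseteq> carrier B" using h(3) by auto
  have "unital_subalgebra R B (f ` carrier A)"
    unfolding unital_subalgebra_def
  proof (intro conjI ballI)
    show "f ` carrier A \<subseteq> carrier B" using h(3) by auto
    show "\<zero>\<^bsub>B\<^esub> \<in> f ` carrier A" by (rule image_eqI[of _ _ "\<zero>\<^bsub>A\<^esub>"]) (simp_all add: alg_hom_zero(1)[OF B f])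
    show "\<one>\<^bsub>B\<^esub> \<in> f ` carrier A" by (rule image_eqI[of _ _ "\<one>\<^bsub>A\<^esub>"]) (simp_all add: h(6))
  next
    fix x y assume "x \<in> f ` carrier A" "y \<in> f ` carrier A"
    then obtain a b where "x = f a" "y = f b" "a \<in> carrier A" "b \<in> carrier A" by auto
    then show "x \<oplus>\<^bsub>B\<^esub> y \<in> f ` carrier A" "x \<otimes>\<^bsub>B\<^esub> y \<in> f ` carrier A"
      by (auto simp flip: h(4,5))
  next
    fix c x assume "c \<in> carrier R" "x \<in> f ` carrier A"
    then show "c \<odot>\<^bsub>B\<^esub> x \<in> f ` carrier A" by (auto simp flip: h(2))
  qed
  then show "carrier B \<subseteq> f ` carrier A" using generatesD[OF X] X' by blast
qed

text \<open>
  A generator is assumed to associate with \<open>z\<close> and arbitrary elements of the algebra, rather than with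
  \<open>z\<close> and the other generators, since in this form the property passes to products.
\<close>

lemma (in alternative_algebra) central_if_central_on_generators:
  assumes z: "z \<in> carrier A" and X: "generates R A X"
    and c: "\<And>x. x \<in> X \<Longrightarrow> z \<otimes>\<^bsub>A\<^esub> x = x \<otimes>\<^bsub>A\<^esub> z \<and> x \<in> N.associating z"
  shows "z \<in> alg_center A"
proof -
  let ?M = "{x \<in> carrier A. z \<otimes>\<^bsub>A\<^esub> x = x \<otimes>\<^bsub>A\<^esub> z \<and> x \<in> N.associating z}"
  have "unital_subalgebra R A ?M"
    unfolding unital_subalgebra_def
  proof (intro conjI ballI)
    show "?M \<subseteq> carrier A" by auto
    show "\<zero>\<^bsub>A\<^esub> \<in> ?M" using z by (simp add: N.associating_def associator_def M.minus_eq)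
    show "\<one>\<^bsub>A\<^esub> \<in> ?M" using z by (simp add: N.associating_def associator_def M.minus_eq M.r_neg)
  next
    fix x y assume x: "x \<in> ?M" and y: "y \<in> ?M"
    show "x \<oplus>\<^bsub>A\<^esub> y \<in> ?M" using x y z
      by (simp add: N.r_distr N.l_distr N.associating_def N.associator_add)
    have "z \<otimes>\<^bsub>A\<^esub> (x \<otimes>\<^bsub>A\<^esub> y) = (z \<otimes>\<^bsub>A\<^esub> x) \<otimes>\<^bsub>A\<^esub> y" using x y z N.associating_assoc(1)[of x z y] by simp
    also have "\<dots> = (x \<otimes>\<^bsub>A\<^esub> z) \<otimes>\<^bsub>A\<^esub> y" using x by simp
    also have "\<dots> = x \<otimes>\<^bsub>A\<^esub> (z \<otimes>\<^bsub>A\<^esub> y)" using x y z N.associating_assoc(6)[of x z y] by simp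
    also have "\<dots> = x \<otimes>\<^bsub>A\<^esub> (y \<otimes>\<^bsub>A\<^esub> z)" using y by simp
    also have "\<dots> = (x \<otimes>\<^bsub>A\<^esub> y) \<otimes>\<^bsub>A\<^esub> z" using x y z N.associating_assoc(2)[of x z y] by simp
    finally show "x \<otimes>\<^bsub>A\<^esub> y \<in> ?M" using x y z by (simp add: N.associating_mult)
  next
    fix c x assume c: "c \<in> carrier R" and x: "x \<in> ?M"
    have "associator A z (c \<odot>\<^bsub>A\<^esub> x) y = c \<odot>\<^bsub>A\<^esub> associator A z x y" if "y \<in> carrier A" for y
      unfolding associator_def using c x z that
      by (simp add: M.minus_eq smult_mult_left smult_mult_right smult_r_distr smult_minus_right)
    then show "c \<odot>\<^bsub>A\<^esub> x \<in> ?M"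
      using c x z by (simp add: smult_mult_left smult_mult_right N.associating_def)
  qed
  moreover have "X \<subseteq> ?M" using c X by (auto simp: generates_def)
  ultimately have "carrier A \<subseteq> ?M" using generatesD[OF X] by blast
  then show ?thesis using z by (auto simp: N.alg_center_iff)
qed

lemma (in alternative_algebra) cayley_triple_square_central_on_triple:
  assumes "N.cayley_triple (a I1) (a I2) (a I3)"
  shows "(a i \<otimes>\<^bsub>A\<^esub> a i) \<otimes>\<^bsub>A\<^esub> a j = a j \<otimes>\<^bsub>A\<^esub> (a i \<otimes>\<^bsub>A\<^esub> a i)" "a j \<in> N.associating (a i \<otimes>\<^bsub>A\<^esub> a i)"
    "a i \<in> carrier A"
proof -
  note T = N.cayley_tripleD[OF assms]
  have c: "a k \<in> carrier A" for k using T(1-3) by (cases k) auto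
  show "a i \<in> carrier A" by (rule c)
  have anti: "a i \<otimes>\<^bsub>A\<^esub> a j = \<ominus>\<^bsub>A\<^esub> (a j \<otimes>\<^bsub>A\<^esub> a i)" if "i \<noteq> j"
    using that T(4-6,8-10) by (cases i; cases j) blast+
  show "(a i \<otimes>\<^bsub>A\<^esub> a i) \<otimes>\<^bsub>A\<^esub> a j = a j \<otimes>\<^bsub>A\<^esub> (a i \<otimes>\<^bsub>A\<^esub> a i)"
    using N.square_commute[OF anti c c] N.left_alternative[OF c c, of i i] c by (cases "i = j") auto
  show "a j \<in> N.associating (a i \<otimes>\<^bsub>A\<^esub> a i)"
  proof (cases "i = j")
    case True
    have "a i \<otimes>\<^bsub>A\<^esub> a i \<in> N.associating (a i)"
      using N.associating_mult[OF c N.self_associating[OF c] N.self_associating[OF c]] .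
    then show ?thesis using N.associating_sym[of "a i \<otimes>\<^bsub>A\<^esub> a i" "a i"] c True by simp
  next
    case False
    then show ?thesis using N.square_associating[OF anti c c] by simp
  qed
qed

section \<open>Presented algebras\<close>

lemma alg_terms_simps [simp]:
  "TGen x \<in> alg_terms R" "TZero \<in> alg_terms R" "TOne \<in> alg_terms R"
  "TNeg s \<in> alg_terms R \<longleftrightarrow> s \<in> alg_terms R"
  "TAdd s t \<in> alg_terms R \<longleftrightarrow> s \<in> alg_terms R \<and> t \<in> alg_terms R"
  "TMul s t \<in> alg_terms R \<longleftrightarrow> s \<in> alg_terms R \<and> t \<in> alg_terms R"
  "TScal c s \<in> alg_terms R \<longleftrightarrow> c \<in> carrier R \<and> s \<in> alg_terms R"
  by (auto simp: alg_terms_def)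

locale presentation = cring R for R :: "('k, 'm) ring_scheme" (structure) +
  fixes rels :: "(('k, 'x) alg_term \<times> ('k, 'x) alg_term) set"
begin

abbreviation "P \<equiv> presented_algebra R rels"
abbreviation "cl \<equiv> term_class R rels"

lemma alt_cong_terms: "(s, t) \<in> alt_cong R rels \<Longrightarrow> s \<in> alg_terms R \<and> t \<in> alg_terms R"
  by (induction rule: alt_cong.induct) auto

lemma alt_cong_equiv: "equiv (alg_terms R) (alt_cong R rels)"
proof (rule equivI)
  show "alt_cong R rels \<subseteq> alg_terms R \<times> alg_terms R" using alt_cong_terms by auto
  show "refl_on (alg_terms R) (alt_cong R rels)" by (rule refl_onI) (rule alt_cong.refl)
  show "sym (alt_cong R rels)" by (rule symI) (rule alt_cong.sym)
  show "trans (alt_cong R rels)" by (rule transI) (rule alt_cong.trans)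
qed

lemma cl_eq_iff: "\<lbrakk>s \<in> alg_terms R; t \<in> alg_terms R\<rbrakk> \<Longrightarrow> cl s = cl t \<longleftrightarrow> (s, t) \<in> alt_cong R rels"
  using eq_equiv_class_iff[OF alt_cong_equiv] by (simp add: term_class_def)

lemma cl_eqI: "(s, t) \<in> alt_cong R rels \<Longrightarrow> cl s = cl t"
  using cl_eq_iff alt_cong_terms by blast

lemma cl_mem: "t \<in> cl s \<longleftrightarrow> (s, t) \<in> alt_cong R rels" by (simp add: term_class_def)

lemma cl_nonempty: "s \<in> alg_terms R \<Longrightarrow> cl s \<noteq> {}"
  using cl_mem alt_cong.refl by blast

lemma carrier_P: "carrier P = cl ` alg_terms R"
  by (auto simp: presented_algebra_def quotient_def term_class_def)

lemma P_ops:
  "\<lbrakk>s \<in> alg_terms R; t \<in> alg_terms R\<rbrakk> \<Longrightarrow> cl s \<otimes>\<^bsub>P\<^esub> cl t = cl (TMul s t)"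
  "\<lbrakk>s \<in> alg_terms R; t \<in> alg_terms R\<rbrakk> \<Longrightarrow> cl s \<oplus>\<^bsub>P\<^esub> cl t = cl (TAdd s t)"
  "\<lbrakk>c \<in> carrier R; s \<in> alg_terms R\<rbrakk> \<Longrightarrow> c \<odot>\<^bsub>P\<^esub> cl s = cl (TScal c s)"
  "\<one>\<^bsub>P\<^esub> = cl TOne" "\<zero>\<^bsub>P\<^esub> = cl TZero"
proof -
  have 1: "cl (TMul s' t') = cl (TMul s t)" "cl (TAdd s' t') = cl (TAdd s t)"
    if "s' \<in> cl s" "t' \<in> cl t" for s s' t t'
    using that by (auto simp only: cl_mem intro!: cl_eqI alt_cong.mul alt_cong.add intro: alt_cong.sym)
  have 2: "cl (TScal c s') = cl (TScal c s)" if "c \<in> carrier R" "s' \<in> cl s" for c s s'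
    using that by (auto simp only: cl_mem intro!: cl_eqI alt_cong.scal intro: alt_cong.sym)
  show "cl s \<otimes>\<^bsub>P\<^esub> cl t = cl (TMul s t)" "cl s \<oplus>\<^bsub>P\<^esub> cl t = cl (TAdd s t)"
    if "s \<in> alg_terms R" "t \<in> alg_terms R"
    unfolding presented_algebra_def monoid.simps ring.simps
    by (rule UN_const_eq[OF cl_nonempty[OF that(1)] UN_const_eq[OF cl_nonempty[OF that(2)]]], erule (1) 1)+
  show "c \<odot>\<^bsub>P\<^esub> cl s = cl (TScal c s)" if "c \<in> carrier R" "s \<in> alg_terms R"
    unfolding presented_algebra_def module.simps
    by (rule UN_const_eq[OF cl_nonempty[OF that(2)] 2[OF that(1)]])
qed (simp_all add: presented_algebra_def)

lemma P_alternative: "alternative_algebra R P"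
proof -
  note cl =
    alt_cong.add_assoc[THEN cl_eqI] alt_cong.add_zero[THEN cl_eqI]
    alt_cong.scal_add_left[THEN cl_eqI] alt_cong.scal_add_right[THEN cl_eqI] alt_cong.scal_scal[THEN cl_eqI]
    alt_cong.scal_one[THEN cl_eqI] alt_cong.mul_one_left[THEN cl_eqI] alt_cong.mul_one_right[THEN cl_eqI]
    alt_cong.mul_add_left[THEN cl_eqI] alt_cong.mul_add_right[THEN cl_eqI]
    alt_cong.scal_mul_left[THEN cl_eqI] alt_cong.scal_mul_right[THEN cl_eqI]
    alt_cong.left_alternative[THEN cl_eqI] alt_cong.right_alternative[THEN cl_eqI]
  have neg: "cl (TNeg s) \<oplus>\<^bsub>P\<^esub> cl s = \<zero>\<^bsub>P\<^esub>" if "s \<in> alg_terms R" for s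
    using that cl_eqI[OF alt_cong.add_neg] by (simp add: P_ops)
  interpret P: abelian_group P
  proof (rule abelian_groupI)
    fix X assume "X \<in> carrier P"
    then obtain s where "s \<in> alg_terms R" "X = cl s" by (auto simp: carrier_P)
    then show "\<exists>Y\<in>carrier P. Y \<oplus>\<^bsub>P\<^esub> X = \<zero>\<^bsub>P\<^esub>"
      using neg[of s] by (intro bexI[of _ "cl (TNeg s)"]) (auto simp: carrier_P)
  next
    fix X Y assume "X \<in> carrier P" "Y \<in> carrier P"
    then show "X \<oplus>\<^bsub>P\<^esub> Y = Y \<oplus>\<^bsub>P\<^esub> X"
      using alt_cong.add_comm[THEN cl_eqI] by (auto simp only: carrier_P P_ops image_iff)
  qed (auto simp: carrier_P P_ops cl)
  interpret P: nonassoc_algebra R P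
    by unfold_locales (auto simp: carrier_P P_ops cl)
  show ?thesis
    by (rule P.alternative_algebraI) (auto simp: carrier_P P_ops cl)
qed

sublocale P: alternative_algebra R P by (rule P_alternative)

lemma P_neg: "s \<in> alg_terms R \<Longrightarrow> \<ominus>\<^bsub>P\<^esub> cl s = cl (TNeg s)"
  using cl_eqI[OF alt_cong.add_neg]
  by (intro P.M.minus_equality) (auto simp: carrier_P P_ops)

lemma P_generated: "generates R P (range (\<lambda>x. cl (TGen x)))"
  unfolding generates_def
proof (intro conjI allI impI)
  show "range (\<lambda>x. cl (TGen x)) \<subseteq> carrier P" by (auto simp: carrier_P)
  fix M assume M: "unital_subalgebra R P M" and gens: "range (\<lambda>x. cl (TGen x)) \<subseteq> M"
  have "cl s \<in> M" if "s \<in> alg_terms R" for s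
    using that
  proof (induction s)
    case (TNeg s)
    have "cl (TNeg s) = (\<ominus> \<one>) \<odot>\<^bsub>P\<^esub> cl s"
      using TNeg P.smult_l_minus[of \<one> "cl s"] by (simp add: P_neg carrier_P)
    then show ?case using TNeg M by (simp add: unital_subalgebra_def)
  next
    case (TAdd s t)
    then have "cl s \<oplus>\<^bsub>P\<^esub> cl t \<in> M" using M by (simp add: unital_subalgebra_def)
    then show ?case using TAdd.prems by (simp add: P_ops)
  next
    case (TMul s t)
    then have "cl s \<otimes>\<^bsub>P\<^esub> cl t \<in> M" using M by (simp add: unital_subalgebra_def)
    then show ?case using TMul.prems by (simp add: P_ops)
  next
    case (TScal c s)
    then have "c \<odot>\<^bsub>P\<^esub> cl s \<in> M" using M by (simp add: unital_subalgebra_def)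
    then show ?case using TScal.prems by (simp add: P_ops)
  qed (use M gens in \<open>auto simp: unital_subalgebra_def P_ops\<close>)
  then show "carrier P \<subseteq> M" by (auto simp: carrier_P)
qed

end

primrec term_eval :: "('k, 'a, 'n) module_scheme \<Rightarrow> ('x \<Rightarrow> 'a) \<Rightarrow> ('k, 'x) alg_term \<Rightarrow> 'a" where
  "term_eval B e (TGen x) = e x"
| "term_eval B e TZero = \<zero>\<^bsub>B\<^esub>"
| "term_eval B e TOne = \<one>\<^bsub>B\<^esub>"
| "term_eval B e (TNeg s) = \<ominus>\<^bsub>B\<^esub> term_eval B e s"
| "term_eval B e (TAdd s t) = term_eval B e s \<oplus>\<^bsub>B\<^esub> term_eval B e t"
| "term_eval B e (TMul s t) = term_eval B e s \<otimes>\<^bsub>B\<^esub> term_eval B e t"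
| "term_eval B e (TScal c s) = c \<odot>\<^bsub>B\<^esub> term_eval B e s"

lemma (in presentation) presented_algebra_hom:
  assumes B: "alternative_algebra R B" and e: "\<And>x. e x \<in> carrier B"
    and rels: "\<And>s t. (s, t) \<in> rels \<Longrightarrow> term_eval B e s = term_eval B e t"
  obtains h where "h \<in> alg_hom R P B" "\<And>x. h (cl (TGen x)) = e x"
proof -
  interpret B: alternative_algebra R B by fact
  have closed [simp]: "term_eval B e s \<in> carrier B" if "s \<in> alg_terms R" for s
    using that by (induction s) (simp_all add: e)
  have sound: "term_eval B e s = term_eval B e t" if "(s, t) \<in> alt_cong R rels" for s t
    using that
    by (induction rule: alt_cong.induct)
      (simp_all add: B.M.a_assoc B.M.a_comm[of "term_eval B e s" "term_eval B e t" for s t] B.M.l_neg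
        B.smult_l_distr B.smult_r_distr B.smult_assoc1 B.N.l_distr B.N.r_distr B.smult_mult_left B.smult_mult_right
        B.N.left_alternative B.N.right_alternative rels)
  define h where "h X = term_eval B e (SOME s. s \<in> X)" for X
  have h: "h (cl s) = term_eval B e s" if s: "s \<in> alg_terms R" for s
  proof -
    have "(SOME t. t \<in> cl s) \<in> cl s" using cl_nonempty[OF s] by (simp add: some_in_eq)
    then show ?thesis using sound by (simp add: h_def cl_mem)
  qed
  show ?thesis
  proof (rule that)
    show "h \<in> alg_hom R P B"
      by (intro alg_homI ring_hom_memI) (auto simp: carrier_P P_ops h)
    show "h (cl (TGen x)) = e x" for x by (simp add: h)
  qed
qed

section \<open>Cayley polynomials\<close>

lemma (in alternative_algebra) two_torsion_free:
  assumes two: "\<one> \<oplus> \<one> \<in> Units R" and q: "q \<in> carrier A" "q \<oplus>\<^bsub>A\<^esub> q = \<zero>\<^bsub>A\<^esub>"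
  shows "q = \<zero>\<^bsub>A\<^esub>"
proof -
  obtain u where u: "u \<in> carrier R" "u \<otimes> (\<one> \<oplus> \<one>) = \<one>" using two by (auto simp: Units_def)
  have "q = (u \<otimes> (\<one> \<oplus> \<one>)) \<odot>\<^bsub>A\<^esub> q" using q u by simp
  also have "\<dots> = u \<odot>\<^bsub>A\<^esub> (q \<oplus>\<^bsub>A\<^esub> q)"
    using q(1) u(1) by (simp only: smult_assoc1 smult_l_distr smult_one R.one_closed R.a_closed)
  also have "\<dots> = \<zero>\<^bsub>A\<^esub>" using q u by simp
  finally show ?thesis .
qed

lemma alg_hom_pow:
  assumes f: "f \<in> alg_hom R A B" and x: "x \<in> carrier A"
    and cl: "\<And>x y. \<lbrakk>x \<in> carrier A; y \<in> carrier A\<rbrakk> \<Longrightarrow> x \<otimes>\<^bsub>A\<^esub> y \<in> carrier A" and "\<one>\<^bsub>A\<^esub> \<in> carrier A"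
  shows "x [^]\<^bsub>A\<^esub> (n::nat) \<in> carrier A \<and> f (x [^]\<^bsub>A\<^esub> n) = f x [^]\<^bsub>B\<^esub> n"
  by (induction n) (use assms in \<open>simp_all add: nat_pow_def alg_homD(5,6)[OF f]\<close>)

lemma (in alternative_algebra) term_eval_cayley_rels:
  assumes abc: "N.cayley_triple (a I1) (a I2) (a I3)"
    and e: "\<And>i. term_eval A e (t i) = a i" and "(l, r) \<in> cayley_rels t"
  shows "term_eval A e l = term_eval A e r"
proof -
  note T = N.cayley_tripleD(7-10)[OF abc]
  consider "l = TMul (t I2) (t I1)" "r = TNeg (TMul (t I1) (t I2))"
    | "l = TMul (t I3) (t I1)" "r = TNeg (TMul (t I1) (t I3))"
    | "l = TMul (t I3) (t I2)" "r = TNeg (TMul (t I2) (t I3))"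
    | "l = TMul (TMul (t I1) (t I2)) (t I3)" "r = TNeg (TMul (t I1) (TMul (t I2) (t I3)))"
    using assms(3) by (auto simp: cayley_rels_def)
  then show ?thesis by cases (simp_all only: term_eval.simps e T)
qed

lemma (in presentation) cayley_rels_triple:
  assumes rels: "cayley_rels t \<subseteq> rels" and t: "\<And>i. t i \<in> alg_terms R"
  shows "P.N.cayley_triple (cl (t I1)) (cl (t I2)) (cl (t I3))"
proof -
  have rel: "cl l = cl r" if "(l, r) \<in> cayley_rels t" for l r
  proof -
    have "(l, r) \<in> rels" using that rels by auto
    moreover have "l \<in> alg_terms R" "r \<in> alg_terms R" using that t by (auto simp: cayley_rels_def)
    ultimately show ?thesis by (intro cl_eqI alt_cong.relation)
  qed
  have c: "cl (t i) \<in> carrier P" for i using t by (simp add: carrier_P)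
  have "cl (t I2) \<otimes>\<^bsub>P\<^esub> cl (t I1) = \<ominus>\<^bsub>P\<^esub> (cl (t I1) \<otimes>\<^bsub>P\<^esub> cl (t I2))"
    "cl (t I3) \<otimes>\<^bsub>P\<^esub> cl (t I1) = \<ominus>\<^bsub>P\<^esub> (cl (t I1) \<otimes>\<^bsub>P\<^esub> cl (t I3))"
    "cl (t I3) \<otimes>\<^bsub>P\<^esub> cl (t I2) = \<ominus>\<^bsub>P\<^esub> (cl (t I2) \<otimes>\<^bsub>P\<^esub> cl (t I3))"
    "(cl (t I1) \<otimes>\<^bsub>P\<^esub> cl (t I2)) \<otimes>\<^bsub>P\<^esub> cl (t I3) = \<ominus>\<^bsub>P\<^esub> (cl (t I1) \<otimes>\<^bsub>P\<^esub> (cl (t I2) \<otimes>\<^bsub>P\<^esub> cl (t I3)))"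
    using t by (simp_all add: P_ops P_neg rel cayley_rels_def)
  then show ?thesis
    unfolding P.N.cayley_triple_def using c by (simp add: P.mult_closed)
qed

lemma denominators_transport:
  assumes A: "alternative_algebra R A" and f: "f \<in> alg_iso R A B" and T: "T \<subseteq> carrier A"
    and B: "central_denominators R B (f ` T)"
  shows "central_denominators R A T"
proof -
  interpret A: alternative_algebra R A by fact
  interpret B: central_denominators R B "f ` T" by fact
  have hom: "f \<in> alg_hom R A B" and inj: "inj_on f (carrier A)" and onto: "f ` carrier A = carrier B"
    using f by (auto simp: alg_iso_def bij_betw_def)
  note h = alg_homD[OF hom]
  have inj: "x = y" if "f x = f y" "x \<in> carrier A" "y \<in> carrier A" for x y
    using inj that by (auto simp: inj_on_def)
  have mem: "x \<in> T" if "f x \<in> f ` T" "x \<in> carrier A" for x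
    using that inj T by blast
  show ?thesis
  proof (intro central_denominators.intro central_denominators_axioms.intro A)
    show "submonoid T A"
    proof
      show "\<one>\<^bsub>A\<^esub> \<in> T" using B.S_one h(6) by (intro mem) auto
      show "x \<otimes>\<^bsub>A\<^esub> y \<in> T" if "x \<in> T" "y \<in> T" for x y
      proof (rule mem)
        have "x \<in> carrier A" "y \<in> carrier A" using that T by auto
        then show "f (x \<otimes>\<^bsub>A\<^esub> y) \<in> f ` T" "x \<otimes>\<^bsub>A\<^esub> y \<in> carrier A"
          using B.S_mult[of "f x" "f y"] that by (simp_all add: h(5))
      qed
    qed (rule T)
    show "T \<subseteq> alg_center A"
    proof
      fix z assume z: "z \<in> T"
      then have zA: "z \<in> carrier A" using T by auto
      have fz: "f z \<in> f ` T" using z by auto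
      show "z \<in> alg_center A"
      proof (rule A.N.alg_centerI[OF zA])
        fix x assume x: "x \<in> carrier A"
        show "x \<otimes>\<^bsub>A\<^esub> z = z \<otimes>\<^bsub>A\<^esub> x"
          using B.S_comm[OF fz, of "f x"] x zA by (intro inj) (simp_all add: h(3,5))
        fix y assume y: "y \<in> carrier A"
        show "(z \<otimes>\<^bsub>A\<^esub> x) \<otimes>\<^bsub>A\<^esub> y = z \<otimes>\<^bsub>A\<^esub> (x \<otimes>\<^bsub>A\<^esub> y)"
          using B.S_assoc(1)[OF fz, of "f x" "f y"] x y zA by (intro inj) (simp_all add: h(3,5))
      qed
    qed
    then have comm: "x \<otimes>\<^bsub>A\<^esub> z = z \<otimes>\<^bsub>A\<^esub> x" if "z \<in> T" "x \<in> carrier A" for x z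
      using that A.N.alg_center_comm by auto
    have "x = \<zero>\<^bsub>A\<^esub>" if z: "z \<in> T" and x: "x \<in> carrier A" and zx: "z \<otimes>\<^bsub>A\<^esub> x = \<zero>\<^bsub>A\<^esub>" for x z
    proof (rule inj)
      have zA: "z \<in> carrier A" using z T by auto
      have "f z \<otimes>\<^bsub>B\<^esub> f x = f z \<otimes>\<^bsub>B\<^esub> f \<zero>\<^bsub>A\<^esub>"
        using zA x zx h(3)[OF zA] A.alg_hom_zero(1)[OF B.alternative_algebra_axioms hom] by (simp flip: h(5))
      then show "f x = f \<zero>\<^bsub>A\<^esub>"
        using B.S_cancel[of "f z" "f x" "f \<zero>\<^bsub>A\<^esub>"] z x h(3) by simp
    qed (use x in simp_all)
    then show "T \<inter> zero_divisors A = {}"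
      using comm unfolding zero_divisors_def by fastforce
  qed
qed

lemma (in alternative_algebra) cayley_triple_square_central:
  assumes abc: "N.cayley_triple (a I1) (a I2) (a I3)" and gen: "generates R A (range a)"
  shows "a i \<otimes>\<^bsub>A\<^esub> a i \<in> alg_center A"
  using cayley_triple_square_central_on_triple[OF abc]
  by (intro central_if_central_on_generators[OF _ gen]) auto

lemma v_gen_generates:
  assumes "cring R" shows "generates R (cayley_D R) (range (v_gen R))"
  unfolding generates_def using cayley_D_generated[OF assms] v_gen_triple(2)[OF assms] by blast

lemma z_elem_in_cayley_S:
  assumes R: "cring R" shows "z_elem R i \<in> cayley_S R"
proof -
  interpret K: cring "poly3 R" by (rule poly3_cring[OF R])
  have "monomial3 R 1 0 0 = var3 R I1" "monomial3 R 0 1 0 = var3 R I2" "monomial3 R 0 0 1 = var3 R I3"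
    using R by (simp_all add: monomial3_def)
  moreover have "monomial3 R p q r \<odot>\<^bsub>octonion_poly3 R\<^esub> \<one>\<^bsub>octonion_poly3 R\<^esub> \<in> cayley_S R" for p q r
    unfolding cayley_S_eq by blast
  ultimately show ?thesis unfolding z_elem_def by (cases i) metis+
qed

text \<open>
  Both algebras have generators with the Cayley relations, and both are universal for them, so the
  homomorphisms in the two directions are inverse to each other: the composites fix the generators.
\<close>

lemma cayley_poly_iso:
  assumes R: "cring R"
  obtains f where "f \<in> alg_iso R (cayley_poly R) (cayley_D R)" "\<And>i. f (t_gen R i) = v_gen R i"
proof -
  interpret P: presentation R "cayley_rels TGen" by (intro presentation.intro R)
  interpret D: alternative_algebra R "cayley_D R" by (rule cayley_D_alternative[OF R])
  have P: "cayley_poly R = P.P" by (simp add: cayley_poly_def)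
  have t: "t_gen R i = P.cl (TGen i)" for i by (simp add: t_gen_def)
  have rels: "term_eval (cayley_D R) (v_gen R) l = term_eval (cayley_D R) (v_gen R) r"
    if "(l, r) \<in> cayley_rels TGen" for l r
    by (rule D.term_eval_cayley_rels[OF v_gen_triple(1)[OF R] _ that]) simp
  obtain f where f: "f \<in> alg_hom R P.P (cayley_D R)" and "\<And>i. f (P.cl (TGen i)) = v_gen R i"
    using P.presented_algebra_hom[OF D.alternative_algebra_axioms v_gen_triple(2)[OF R] rels] by blast
  then have ft: "\<And>i. f (t_gen R i) = v_gen R i" by (simp add: t)
  have triple: "P.P.N.cayley_triple (t_gen R I1) (t_gen R I2) (t_gen R I3)"
    unfolding t by (rule P.cayley_rels_triple) simp_all
  have gen: "generates R P.P (range (t_gen R))"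
    using P.P_generated by (simp add: t[abs_def])
  obtain g where g: "g \<in> alg_hom R (cayley_D R) P.P" and gv: "\<And>i. g (v_gen R i) = t_gen R i"
    using P.P.cayley_D_hom[OF triple P.P.cayley_triple_square_central[OF triple gen]] by blast
  have gf: "g (f x) = x" if "x \<in> carrier P.P" for x
    by (rule P.P.hom_eq_on_generators[OF P.P_alternative alg_hom_compose[OF f g] _ gen _ that])
      (auto simp: ft gv alg_hom_def ring_hom_def)
  have fg: "f (g x) = x" if "x \<in> carrier (cayley_D R)" for x
    by (rule D.hom_eq_on_generators[OF D.alternative_algebra_axioms alg_hom_compose[OF g f] _ v_gen_generates[OF R] _ that])
      (auto simp: ft gv alg_hom_def ring_hom_def)
  have "bij_betw f (carrier P.P) (carrier (cayley_D R))"
    by (rule bij_betw_byWitness[where f'=g]) (use gf fg alg_homD(3)[OF f] alg_homD(3)[OF g] in auto)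
  then show ?thesis using that f ft by (simp add: alg_iso_def P)
qed

lemma cayley_T_denominators:
  assumes R: "cring R" and f: "f \<in> alg_iso R (cayley_poly R) (cayley_D R)"
    and ft: "\<And>i. f (t_gen R i) = v_gen R i"
  shows "f ` cayley_T R = cayley_S R" "central_denominators R (cayley_poly R) (cayley_T R)"
proof -
  interpret P: presentation R "cayley_rels TGen" by (intro presentation.intro R)
  have P: "cayley_poly R = P.P" by (simp add: cayley_poly_def)
  interpret P: alternative_algebra R "cayley_poly R" unfolding P by (rule P.P_alternative)
  have tc: "t_gen R i \<in> carrier (cayley_poly R)" for i
    unfolding t_gen_def P by (simp add: P.carrier_P)
  have hom: "f \<in> alg_hom R (cayley_poly R) (cayley_D R)" using f by (simp add: alg_iso_def)
  have pow: "t_gen R i [^]\<^bsub>cayley_poly R\<^esub> (n::nat) \<in> carrier (cayley_poly R)"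
    "f (t_gen R i [^]\<^bsub>cayley_poly R\<^esub> (n::nat)) = v_gen R i [^]\<^bsub>cayley_D R\<^esub> n" for i n
    using alg_hom_pow[OF hom tc[of i]] ft by auto
  have eq: "f ((t_gen R I1 [^]\<^bsub>cayley_poly R\<^esub> p \<otimes>\<^bsub>cayley_poly R\<^esub> t_gen R I2 [^]\<^bsub>cayley_poly R\<^esub> q)
      \<otimes>\<^bsub>cayley_poly R\<^esub> t_gen R I3 [^]\<^bsub>cayley_poly R\<^esub> r)
    = (v_gen R I1 [^]\<^bsub>cayley_D R\<^esub> p \<otimes>\<^bsub>cayley_D R\<^esub> v_gen R I2 [^]\<^bsub>cayley_D R\<^esub> q)
      \<otimes>\<^bsub>cayley_D R\<^esub> v_gen R I3 [^]\<^bsub>cayley_D R\<^esub> r" for p q r :: nat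
    using pow by (simp add: alg_homD(5)[OF hom])
  show ST: "f ` cayley_T R = cayley_S R"
  proof -
    have "f ` cayley_T R = {f ((t_gen R I1 [^]\<^bsub>cayley_poly R\<^esub> p \<otimes>\<^bsub>cayley_poly R\<^esub> t_gen R I2 [^]\<^bsub>cayley_poly R\<^esub> q)
      \<otimes>\<^bsub>cayley_poly R\<^esub> t_gen R I3 [^]\<^bsub>cayley_poly R\<^esub> r) | (p::nat) (q::nat) (r::nat). even p \<and> even q \<and> even r}"
      unfolding cayley_T_def by blast
    then show ?thesis unfolding eq cayley_S_powers[OF R] .
  qed
  have "cayley_T R \<subseteq> carrier (cayley_poly R)"
    using pow(1) by (auto simp: cayley_T_def)
  then show "central_denominators R (cayley_poly R) (cayley_T R)"
    using denominators_transport[OF P.alternative_algebra_axioms f] cayley_S_denominators[OF R] ST by simp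
qed

lemma (in alternative_algebra) cayley_S_central_units:
  assumes g: "g \<in> alg_hom R (cayley_D R) A"
    and u: "\<And>i. g (v_gen R i) \<otimes>\<^bsub>A\<^esub> g (v_gen R i) \<in> N.central_units"
    and s: "s \<in> cayley_S R"
  shows "g s \<in> N.central_units"
proof -
  have "cayley_S R \<subseteq> {s. g s \<in> N.central_units}"
    using u v_gen_triple(2)[OF R.is_cring]
    by (intro cayley_S_subset[OF R.is_cring])
      (simp_all add: z_elem_square[OF R.is_cring] alg_homD(5,6)[OF g] N.central_units_one N.central_units_mult)
  then show ?thesis using s by auto
qed

lemma (in alternative_algebra) cayley_poly_universal:
  assumes abc: "N.cayley_triple (a I1) (a I2) (a I3)" and gen: "generates R A (range a)"
  obtains h where "h \<in> alg_hom R (cayley_poly R) A" "h ` carrier (cayley_poly R) = carrier A"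
    "\<And>i. h (t_gen R i) = a i"
proof -
  interpret P: presentation R "cayley_rels TGen" by (intro presentation.intro R.is_cring)
  have P: "cayley_poly R = P.P" by (simp add: cayley_poly_def)
  have t: "t_gen R i = P.cl (TGen i)" for i by (simp add: t_gen_def)
  have ac: "a i \<in> carrier A" for i using gen by (auto simp: generates_def)
  have rels: "term_eval A a l = term_eval A a r" if "(l, r) \<in> cayley_rels TGen" for l r
    by (rule term_eval_cayley_rels[OF abc _ that]) simp
  obtain h where h: "h \<in> alg_hom R P.P A" and "\<And>i. h (P.cl (TGen i)) = a i"
    using P.presented_algebra_hom[OF alternative_algebra_axioms ac rels] by blast
  then have ht: "\<And>i. h (t_gen R i) = a i" by (simp add: t)
  have "t_gen R i \<in> carrier P.P" for i by (simp add: t P.carrier_P)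
  then have "range a \<subseteq> h ` carrier P.P" by (auto simp flip: ht)
  then have "h ` carrier P.P = carrier A"
    by (rule P.P.hom_onto_generators[OF alternative_algebra_axioms h gen])
  then show ?thesis using that h ht by (simp add: P)
qed

lemma (in alternative_algebra) cayley_poly_loc_universal:
  assumes h: "h \<in> alg_hom R (cayley_poly R) A" "h ` carrier (cayley_poly R) = carrier A"
    and u: "\<And>i. h (t_gen R i) \<otimes>\<^bsub>A\<^esub> h (t_gen R i) \<in> N.central_units"
  obtains k where "k \<in> alg_hom R (cayley_poly_loc R) A" "k ` carrier (cayley_poly_loc R) = carrier A"
    "\<And>i. k (loc_t R i) = h (t_gen R i)"
proof -
  note R = R.is_cring
  obtain f where f: "f \<in> alg_iso R (cayley_poly R) (cayley_D R)" and ft: "\<And>i. f (t_gen R i) = v_gen R i"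
    using cayley_poly_iso[OF R] by blast
  interpret L: central_denominators R "cayley_poly R" "cayley_T R"
    by (rule cayley_T_denominators(2)[OF R f ft])
  interpret P: presentation R "cayley_rels TGen" by (intro presentation.intro R)
  have tc: "t_gen R i \<in> carrier (cayley_poly R)" for i
    by (simp add: t_gen_def cayley_poly_def P.carrier_P)
  have pow: "h (t_gen R i) [^]\<^bsub>A\<^esub> (2 * n) \<in> N.central_units" for i and n :: nat
  proof (induction n)
    case 0 show ?case by (simp add: nat_pow_def N.central_units_one)
  next
    case (Suc n)
    have c: "h (t_gen R i) \<in> carrier A" using alg_homD(3)[OF h(1) tc] .
    have "h (t_gen R i) [^]\<^bsub>A\<^esub> (2 * Suc n)
        = (h (t_gen R i) [^]\<^bsub>A\<^esub> (2 * n) \<otimes>\<^bsub>A\<^esub> h (t_gen R i)) \<otimes>\<^bsub>A\<^esub> h (t_gen R i)"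
      by (simp add: nat_pow_def)
    also have "\<dots> = h (t_gen R i) [^]\<^bsub>A\<^esub> (2 * n) \<otimes>\<^bsub>A\<^esub> (h (t_gen R i) \<otimes>\<^bsub>A\<^esub> h (t_gen R i))"
      using Suc c by (intro N.right_alternative) (auto simp: N.central_units_def N.alg_center_closed)
    finally show ?case using N.central_units_mult[OF Suc u] by simp
  qed
  have units: "h s \<in> N.central_units" if "s \<in> cayley_T R" for s
  proof -
    obtain p q r :: nat where s: "s = (t_gen R I1 [^]\<^bsub>cayley_poly R\<^esub> p \<otimes>\<^bsub>cayley_poly R\<^esub> t_gen R I2 [^]\<^bsub>cayley_poly R\<^esub> q)
      \<otimes>\<^bsub>cayley_poly R\<^esub> t_gen R I3 [^]\<^bsub>cayley_poly R\<^esub> r" and "even p" "even q" "even r"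
      using \<open>s \<in> cayley_T R\<close> unfolding cayley_T_def by blast
    then obtain p' q' r' where pqr: "p = 2 * p'" "q = 2 * q'" "r = 2 * r'" by (elim evenE)
    have "h s = (h (t_gen R I1) [^]\<^bsub>A\<^esub> p \<otimes>\<^bsub>A\<^esub> h (t_gen R I2) [^]\<^bsub>A\<^esub> q) \<otimes>\<^bsub>A\<^esub> h (t_gen R I3) [^]\<^bsub>A\<^esub> r"
      unfolding s using alg_hom_pow[OF h(1) tc L.mult_closed L.one_closed]
      by (simp add: alg_homD(5)[OF h(1)] L.mult_closed)
    then show ?thesis unfolding pqr by (simp add: pow N.central_units_mult)
  qed
  obtain k where k: "k \<in> alg_hom R L.L A"
    "\<And>a s. \<lbrakk>a \<in> carrier (cayley_poly R); s \<in> cayley_T R\<rbrakk> \<Longrightarrow> h s \<otimes>\<^bsub>A\<^esub> k (L.fr a s) = h a"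
    using L.localization_hom[OF alternative_algebra_axioms h(1) units] by blast
  have k1: "k (L.fr a \<one>\<^bsub>cayley_poly R\<^esub>) = h a" if "a \<in> carrier (cayley_poly R)" for a
    using k(2)[OF that L.S_one] alg_homD(3)[OF k(1) L.frac_closed[OF that L.S_one]]
    by (simp add: alg_homD(6)[OF h(1)])
  have "k ` carrier L.L = carrier A"
  proof
    show "k ` carrier L.L \<subseteq> carrier A" using alg_homD(3)[OF k(1)] by auto
    show "carrier A \<subseteq> k ` carrier L.L"
    proof
      fix y assume "y \<in> carrier A"
      then obtain a where "a \<in> carrier (cayley_poly R)" "y = h a" using h(2) by auto
      then show "y \<in> k ` carrier L.L"
        by (intro image_eqI[of _ _ "L.fr a \<one>\<^bsub>cayley_poly R\<^esub>"]) (simp_all add: k1)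
    qed
  qed
  then show ?thesis
    using that k(1) k1 tc by (simp add: cayley_poly_loc_def loc_t_def)
qed

section \<open>The Cayley torus\<close>

text \<open>
  The homomorphism from the presented algebra to the torus exists because fractions satisfy the
  relations. In the other direction, the generators \<open>t\<^sub>i\<close> of the presented algebra form a Cayley triple,
  their inverses are two-sided, and \<open>t\<^sub>i\<^sup>2\<close> associates and commutes with all \<open>t\<^sub>j\<close> and therefore with their
  inverses; so \<open>t\<^sub>i\<^sup>2\<close> is central and invertible, and the map \<open>D \<rightarrow> Q\<close> extends to fractions.
\<close>

lemma torus_presentation_iso:
  fixes R (structure)
  assumes R: "cring R" and two: "\<one> \<oplus> \<one> \<in> Units R"
  shows "\<exists>h \<in> alg_iso R (torus_presentation R) (cayley_torus R).
        \<forall>i. h (torus_t R (Pos i)) = torus_v R i \<and> h (torus_t R (Inv i)) = torus_v_inv R i"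
proof -
  interpret Q: presentation R torus_rels by (intro presentation.intro R)
  interpret L: central_denominators R "cayley_D R" "cayley_S R" by (rule cayley_S_denominators[OF R])
  interpret LL: alternative_algebra R L.L by (rule L.localization_alternative)
  note v = v_gen_triple[OF R]
  have Q: "torus_presentation R = Q.P" by (simp add: torus_presentation_def)
  have torus: "cayley_torus R = L.L" by (simp add: cayley_torus_def)
  note zS = z_elem_in_cayley_S[OF R]
  have zv: "z_elem R i = v_gen R i \<otimes>\<^bsub>cayley_D R\<^esub> v_gen R i" for i by (rule z_elem_square[OF R])
  define e where "e x = (case x of Pos i \<Rightarrow> torus_v R i | Inv i \<Rightarrow> torus_v_inv R i)" for x
  have e: "e (Pos i) = L.fr (v_gen R i) \<one>\<^bsub>cayley_D R\<^esub>" "e (Inv i) = L.fr (v_gen R i) (z_elem R i)" for i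
    by (simp_all add: e_def torus_v_def torus_v_inv_def)
  have ec: "e x \<in> carrier L.L" for x
    using v(2) zS by (cases x) (simp_all add: e)
  have e_triple: "LL.N.cayley_triple (e (Pos I1)) (e (Pos I2)) (e (Pos I3))"
    unfolding e by (rule L.alg_hom_cayley_triple[OF L.localization_alternative L.frac_hom v(1)])
  have e_inv: "e (Pos i) \<otimes>\<^bsub>L.L\<^esub> e (Inv i) = \<one>\<^bsub>L.L\<^esub>" for i
    using v(2) zS[of i] by (simp add: e L.frac_mult L.L_one L.frac_eq_iff zv)
  have rels: "term_eval L.L e l = term_eval L.L e r" if "(l, r) \<in> torus_rels" for l r
  proof (cases "(l, r) \<in> cayley_rels (\<lambda>i. TGen (Pos i))")
    case True
    then show ?thesis by (rule LL.term_eval_cayley_rels[OF e_triple, rotated]) simp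
  next
    case False
    then show ?thesis using that e_inv by (auto simp: torus_rels_def)
  qed
  obtain f where f: "f \<in> alg_hom R Q.P L.L" and "\<And>x. f (Q.cl (TGen x)) = e x"
    using Q.presented_algebra_hom[OF L.localization_alternative ec rels] by blast
  then have ft: "\<And>x. f (torus_t R x) = e x" by (simp add: torus_t_def)
  define t where "t i = torus_t R (Pos i)" for i
  define w where "w i = torus_t R (Inv i)" for i
  have tc: "t i \<in> carrier Q.P" "w i \<in> carrier Q.P" for i
    by (simp_all add: t_def w_def torus_t_def Q.carrier_P)
  have triple: "Q.P.N.cayley_triple (t I1) (t I2) (t I3)"
    unfolding t_def torus_t_def by (rule Q.cayley_rels_triple) (auto simp: torus_rels_def)
  have tw: "t i \<otimes>\<^bsub>Q.P\<^esub> w i = \<one>\<^bsub>Q.P\<^esub>" for i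
  proof -
    have "Q.cl (TMul (TGen (Pos i)) (TGen (Inv i))) = Q.cl TOne"
      by (rule Q.cl_eqI[OF alt_cong.relation]) (auto simp: torus_rels_def)
    then show ?thesis by (simp add: t_def w_def torus_t_def Q.P_ops)
  qed
  note two' = Q.P.two_torsion_free[OF two]
  have triples: "Q.P.N.cayley_triple (t I2) (t I3) (t I1)" "Q.P.N.cayley_triple (t I3) (t I1) (t I2)"
    using Q.P.N.cayley_triple_rotate triple by blast+
  have wt: "w i \<otimes>\<^bsub>Q.P\<^esub> t i = \<one>\<^bsub>Q.P\<^esub>" for i
    using Q.P.N.cayley_triple_right_inverse[OF two' triple tc(2) tw tc(2) tw tc(2) tw]
      Q.P.N.cayley_triple_right_inverse[OF two' triples(1) tc(2) tw tc(2) tw tc(2) tw]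
      Q.P.N.cayley_triple_right_inverse[OF two' triples(2) tc(2) tw tc(2) tw tc(2) tw]
    by (cases i) auto
  have genQ: "generates R Q.P (range (torus_t R))"
    using Q.P_generated by (simp add: torus_t_def[abs_def])
  note on_t = Q.P.cayley_triple_square_central_on_triple[OF triple]
  have central: "t i \<otimes>\<^bsub>Q.P\<^esub> t i \<in> alg_center Q.P" for i
  proof (rule Q.P.central_if_central_on_generators[OF _ genQ])
    fix x assume "x \<in> range (torus_t R)"
    then obtain j where "x = t j \<or> x = w j" unfolding t_def w_def by (metis imageE torus_gen.exhaust)
    then show "(t i \<otimes>\<^bsub>Q.P\<^esub> t i) \<otimes>\<^bsub>Q.P\<^esub> x = x \<otimes>\<^bsub>Q.P\<^esub> (t i \<otimes>\<^bsub>Q.P\<^esub> t i) \<and> x \<in> Q.P.N.associating (t i \<otimes>\<^bsub>Q.P\<^esub> t i)"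
      using on_t(1)[of i j] on_t(2)[of j i] tc
        Q.P.N.right_inverse_of_associating[OF two' tc(1) tc(2) _ tw wt on_t(2) on_t(1), of i j]
      by auto
  qed (use tc in simp)
  obtain g where g: "g \<in> alg_hom R (cayley_D R) Q.P" and gv: "\<And>i. g (v_gen R i) = t i"
    using Q.P.cayley_D_hom[OF triple central] by blast
  have unit: "t i \<otimes>\<^bsub>Q.P\<^esub> t i \<in> Q.P.N.central_units" for i
    using Q.P.N.square_central_unit[OF tc(1) tc(2) tw central] .
  have units: "g s \<in> Q.P.N.central_units" if "s \<in> cayley_S R" for s
    using Q.P.cayley_S_central_units[OF g _ that] unit by (simp add: gv)
  obtain k where k: "k \<in> alg_hom R L.L Q.P"
    and kg: "\<And>a s. \<lbrakk>a \<in> carrier (cayley_D R); s \<in> cayley_S R\<rbrakk> \<Longrightarrow> g s \<otimes>\<^bsub>Q.P\<^esub> k (L.fr a s) = g a"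
    using L.localization_hom[OF Q.P_alternative g units] by blast
  have kc: "k X \<in> carrier Q.P" if "X \<in> carrier L.L" for X using alg_homD(3)[OF k that] .
  have kt: "k (e (Pos i)) = t i" for i
    using kg[OF v(2) L.S_one, of i] kc[OF ec[of "Pos i"]] by (simp add: e gv alg_homD(6)[OF g])
  \<comment> \<open>The image of \<open>v\<^sub>i / z\<^sub>i\<close> and \<open>w\<^sub>i\<close> both solve \<open>t\<^sub>i\<^sup>2 x = t\<^sub>i\<close>.\<close>
  have kw: "k (e (Inv i)) = w i" for i
  proof (rule Q.P.N.central_units_cancel[OF unit kc[OF ec] tc(2)])
    have "(t i \<otimes>\<^bsub>Q.P\<^esub> t i) \<otimes>\<^bsub>Q.P\<^esub> k (e (Inv i)) = t i"
      using kg[OF v(2) zS, of i i] v(2) by (simp add: e gv zv alg_homD(5)[OF g])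
    also have "t i = (t i \<otimes>\<^bsub>Q.P\<^esub> t i) \<otimes>\<^bsub>Q.P\<^esub> w i"
      using tc by (simp add: Q.P.N.left_alternative tw)
    finally show "(t i \<otimes>\<^bsub>Q.P\<^esub> t i) \<otimes>\<^bsub>Q.P\<^esub> k (e (Inv i)) = (t i \<otimes>\<^bsub>Q.P\<^esub> t i) \<otimes>\<^bsub>Q.P\<^esub> w i" .
  qed
  have kf: "k (f x) = x" if "x \<in> carrier Q.P" for x
  proof (rule Q.P.hom_eq_on_generators[OF Q.P_alternative alg_hom_compose[OF f k] _ genQ _ that])
    show "(\<lambda>x. x) \<in> alg_hom R Q.P Q.P" by (auto simp: alg_hom_def ring_hom_def)
    fix x assume "x \<in> range (torus_t R)"
    then obtain y where x: "x = torus_t R y" by auto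
    show "k (f x) = x"
      unfolding x ft by (cases y) (simp_all add: kt kw, simp_all add: t_def w_def)
  qed
  \<comment> \<open>On \<open>D\<close> the composite is the canonical map to fractions; this determines it on \<open>a / s\<close>.\<close>
  have fgv: "f (g a) = L.fr a \<one>\<^bsub>cayley_D R\<^esub>" if "a \<in> carrier (cayley_D R)" for a
  proof (rule L.hom_eq_on_generators[OF L.localization_alternative alg_hom_compose[OF g f] L.frac_hom
        v_gen_generates[OF R] _ that])
    fix x assume "x \<in> range (v_gen R)"
    then obtain i where "x = v_gen R i" by auto
    then show "f (g x) = L.fr x \<one>\<^bsub>cayley_D R\<^esub>" using ft[of "Pos i"] by (simp add: gv t_def e)
  qed
  have fk: "f (k X) = X" if X: "X \<in> carrier L.L" for X
  proof -
    obtain a s where a: "a \<in> carrier (cayley_D R)" "s \<in> cayley_S R" "X = L.fr a s" using L.frac_cases[OF X] .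
    obtain b u where b: "b \<in> carrier (cayley_D R)" "u \<in> cayley_S R" "f (k X) = L.fr b u"
      using L.frac_cases[OF alg_homD(3)[OF f kc[OF X]]] .
    have "f (g s) \<otimes>\<^bsub>L.L\<^esub> f (k X) = f (g a)"
      using kg[OF a(1,2)] a kc[OF X] alg_homD(3)[OF g] by (simp flip: alg_homD(5)[OF f])
    then have "L.fr (s \<otimes>\<^bsub>cayley_D R\<^esub> b) u = L.fr a \<one>\<^bsub>cayley_D R\<^esub>"
      using a b by (simp add: fgv L.frac_mult)
    then show ?thesis using a b by (simp add: L.frac_eq_iff)
  qed
  have "bij_betw f (carrier Q.P) (carrier L.L)"
    by (rule bij_betw_byWitness[where f'=k]) (use kf fk alg_homD(3)[OF f] kc in auto)
  then have "f \<in> alg_iso R (torus_presentation R) (cayley_torus R)"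
    using f by (simp add: alg_iso_def Q torus)
  moreover have "f (torus_t R (Pos i)) = torus_v R i \<and> f (torus_t R (Inv i)) = torus_v_inv R i" for i
    by (simp add: ft e_def)
  ultimately show ?thesis by blast
qed

theorem corollary3p4:
  fixes R :: "('k, 'm) ring_scheme" (structure)
  assumes "cring R"
    and "\<one> \<oplus> \<one> \<in> Units R"
  shows
    "(submonoid (cayley_T R) (cayley_poly R)
        \<and> cayley_T R \<subseteq> alg_center (cayley_poly R)
        \<and> cayley_T R \<inter> zero_divisors (cayley_poly R) = {}
        \<and> (\<exists>h \<in> alg_iso R (cayley_poly_loc R) (cayley_torus R).
              \<forall>i. h (loc_t R i) = torus_v R i))
     \<and>
     (\<forall>(A :: ('k, 'a) module) a1 a2 a3.
        alternative_algebra R A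
        \<and> a1 \<in> carrier A \<and> a2 \<in> carrier A \<and> a3 \<in> carrier A
        \<and> carrier A = generated_subalgebra R A {a1, a2, a3}
        \<and> a1 \<otimes>\<^bsub>A\<^esub> a2 = \<ominus>\<^bsub>A\<^esub> (a2 \<otimes>\<^bsub>A\<^esub> a1)
        \<and> a1 \<otimes>\<^bsub>A\<^esub> a3 = \<ominus>\<^bsub>A\<^esub> (a3 \<otimes>\<^bsub>A\<^esub> a1)
        \<and> a2 \<otimes>\<^bsub>A\<^esub> a3 = \<ominus>\<^bsub>A\<^esub> (a3 \<otimes>\<^bsub>A\<^esub> a2)
        \<and> (a1 \<otimes>\<^bsub>A\<^esub> a2) \<otimes>\<^bsub>A\<^esub> a3 = \<ominus>\<^bsub>A\<^esub> (a1 \<otimes>\<^bsub>A\<^esub> (a2 \<otimes>\<^bsub>A\<^esub> a3))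
        \<longrightarrow>
        (\<exists>h \<in> alg_hom R (cayley_poly R) A.
            h ` carrier (cayley_poly R) = carrier A
            \<and> h (t_gen R I1) = a1 \<and> h (t_gen R I2) = a2 \<and> h (t_gen R I3) = a3)
        \<and> a1 [^]\<^bsub>A\<^esub> (2::nat) \<in> alg_center A
        \<and> a2 [^]\<^bsub>A\<^esub> (2::nat) \<in> alg_center A
        \<and> a3 [^]\<^bsub>A\<^esub> (2::nat) \<in> alg_center A
        \<and> (a1 \<in> Units A \<and> a2 \<in> Units A \<and> a3 \<in> Units A \<longrightarrow>
            (\<exists>h \<in> alg_hom R (cayley_poly_loc R) A.
                h ` carrier (cayley_poly_loc R) = carrier A
                \<and> h (loc_t R I1) = a1 \<and> h (loc_t R I2) = a2 \<and> h (loc_t R I3) = a3)))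
     \<and>
     (\<exists>h \<in> alg_iso R (torus_presentation R) (cayley_torus R).
        \<forall>i. h (torus_t R (Pos i)) = torus_v R i \<and> h (torus_t R (Inv i)) = torus_v_inv R i)"
proof (intro conjI allI impI)
  note R = assms(1)
  obtain f where f: "f \<in> alg_iso R (cayley_poly R) (cayley_D R)" and ft: "\<And>i. f (t_gen R i) = v_gen R i"
    using cayley_poly_iso[OF R] by blast
  interpret L: central_denominators R "cayley_poly R" "cayley_T R"
    by (rule cayley_T_denominators(2)[OF R f ft])
  show "submonoid (cayley_T R) (cayley_poly R)" "cayley_T R \<subseteq> alg_center (cayley_poly R)"
    "cayley_T R \<inter> zero_divisors (cayley_poly R) = {}"
    using L.S_submonoid L.S_center L.S_regular by auto
  obtain h where h: "h \<in> alg_iso R L.L (central_localization (cayley_D R) (cayley_S R))"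
    and hf: "\<And>a s. \<lbrakk>a \<in> carrier (cayley_poly R); s \<in> cayley_T R\<rbrakk> \<Longrightarrow>
       h (L.fr a s) = frac (cayley_D R) (cayley_S R) (f a) (f s)"
    using localization_transport[OF L.central_denominators_axioms cayley_S_denominators[OF R] f
        cayley_T_denominators(1)[OF R f ft]] by blast
  interpret P: presentation R "cayley_rels TGen" by (intro presentation.intro R)
  have tc: "t_gen R i \<in> carrier (cayley_poly R)" for i
    by (simp add: t_gen_def cayley_poly_def P.carrier_P)
  have "f \<one>\<^bsub>cayley_poly R\<^esub> = \<one>\<^bsub>cayley_D R\<^esub>"
    using f by (auto simp: alg_iso_def dest: alg_homD(6))
  then have "h (loc_t R i) = torus_v R i" for i
    using hf[OF tc L.S_one, of i] by (simp add: loc_t_def torus_v_def ft)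
  then show "\<exists>h \<in> alg_iso R (cayley_poly_loc R) (cayley_torus R). \<forall>i. h (loc_t R i) = torus_v R i"
    using h by (auto simp: cayley_poly_loc_def cayley_torus_def)
next
  show "\<exists>h \<in> alg_iso R (torus_presentation R) (cayley_torus R).
        \<forall>i. h (torus_t R (Pos i)) = torus_v R i \<and> h (torus_t R (Inv i)) = torus_v_inv R i"
    by (rule torus_presentation_iso[OF assms])
next
  fix A :: "('k, 'a) module" and a1 a2 a3
  assume "alternative_algebra R A
        \<and> a1 \<in> carrier A \<and> a2 \<in> carrier A \<and> a3 \<in> carrier A
        \<and> carrier A = generated_subalgebra R A {a1, a2, a3}
        \<and> a1 \<otimes>\<^bsub>A\<^esub> a2 = \<ominus>\<^bsub>A\<^esub> (a2 \<otimes>\<^bsub>A\<^esub> a1)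
        \<and> a1 \<otimes>\<^bsub>A\<^esub> a3 = \<ominus>\<^bsub>A\<^esub> (a3 \<otimes>\<^bsub>A\<^esub> a1)
        \<and> a2 \<otimes>\<^bsub>A\<^esub> a3 = \<ominus>\<^bsub>A\<^esub> (a3 \<otimes>\<^bsub>A\<^esub> a2)
        \<and> (a1 \<otimes>\<^bsub>A\<^esub> a2) \<otimes>\<^bsub>A\<^esub> a3 = \<ominus>\<^bsub>A\<^esub> (a1 \<otimes>\<^bsub>A\<^esub> (a2 \<otimes>\<^bsub>A\<^esub> a3))"
  then have A: "alternative_algebra R A" and c: "a1 \<in> carrier A" "a2 \<in> carrier A" "a3 \<in> carrier A"
    and gen: "carrier A = generated_subalgebra R A {a1, a2, a3}"
    and rel: "a1 \<otimes>\<^bsub>A\<^esub> a2 = \<ominus>\<^bsub>A\<^esub> (a2 \<otimes>\<^bsub>A\<^esub> a1)" "a1 \<otimes>\<^bsub>A\<^esub> a3 = \<ominus>\<^bsub>A\<^esub> (a3 \<otimes>\<^bsub>A\<^esub> a1)"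
      "a2 \<otimes>\<^bsub>A\<^esub> a3 = \<ominus>\<^bsub>A\<^esub> (a3 \<otimes>\<^bsub>A\<^esub> a2)" "(a1 \<otimes>\<^bsub>A\<^esub> a2) \<otimes>\<^bsub>A\<^esub> a3 = \<ominus>\<^bsub>A\<^esub> (a1 \<otimes>\<^bsub>A\<^esub> (a2 \<otimes>\<^bsub>A\<^esub> a3))"
    by blast+
  interpret A: alternative_algebra R A by (rule A)
  define a where "a i = (case i of I1 \<Rightarrow> a1 | I2 \<Rightarrow> a2 | I3 \<Rightarrow> a3)" for i
  have a [simp]: "a I1 = a1" "a I2 = a2" "a I3 = a3" by (simp_all add: a_def)
  have UNIV: "UNIV = {I1, I2, I3}" using index3.exhaust by auto
  have triple: "A.N.cayley_triple (a I1) (a I2) (a I3)"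
    unfolding a A.N.cayley_triple_def using c rel by blast
  have gen: "generates R A (range a)"
    using generates_generated_subalgebra[OF _ gen] c by (simp add: UNIV)
  have ac: "a i \<in> carrier A" for i using c by (cases i) auto
  note central = A.cayley_triple_square_central[OF triple gen]
  have sq: "a i [^]\<^bsub>A\<^esub> (2::nat) \<in> alg_center A" for i
    using central[of i] ac by (simp add: numeral_2_eq_2 nat_pow_def)
  show "a1 [^]\<^bsub>A\<^esub> (2::nat) \<in> alg_center A" "a2 [^]\<^bsub>A\<^esub> (2::nat) \<in> alg_center A"
    "a3 [^]\<^bsub>A\<^esub> (2::nat) \<in> alg_center A"
    using sq[of I1] sq[of I2] sq[of I3] by simp_all
  obtain h where h: "h \<in> alg_hom R (cayley_poly R) A" "h ` carrier (cayley_poly R) = carrier A"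
    and ht: "\<And>i. h (t_gen R i) = a i"
    using A.cayley_poly_universal[OF triple gen] by blast
  show "\<exists>h \<in> alg_hom R (cayley_poly R) A. h ` carrier (cayley_poly R) = carrier A
            \<and> h (t_gen R I1) = a1 \<and> h (t_gen R I2) = a2 \<and> h (t_gen R I3) = a3"
    using h ht by (intro bexI[of _ h]) simp_all
  assume units: "a1 \<in> Units A \<and> a2 \<in> Units A \<and> a3 \<in> Units A"
  have "\<exists>w\<in>carrier A. a i \<otimes>\<^bsub>A\<^esub> w = \<one>\<^bsub>A\<^esub>" for i
    using units by (cases i) (auto simp: Units_def)
  then have "a i \<otimes>\<^bsub>A\<^esub> a i \<in> A.N.central_units" for i
    using A.N.square_central_unit[OF ac _ _ central] by blast
  then obtain k where "k \<in> alg_hom R (cayley_poly_loc R) A" "k ` carrier (cayley_poly_loc R) = carrier A"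
    "\<And>i. k (loc_t R i) = h (t_gen R i)"
    using A.cayley_poly_loc_universal[OF h] by (metis ht)
  then show "\<exists>h \<in> alg_hom R (cayley_poly_loc R) A. h ` carrier (cayley_poly_loc R) = carrier A
                \<and> h (loc_t R I1) = a1 \<and> h (loc_t R I2) = a2 \<and> h (loc_t R I3) = a3"
    using ht by (intro bexI[of _ k]) simp_all
qed

end
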